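(* Let $q\in\mathbb{C}\setminus\{0\}$ be not a root of unity and let $c_0\in\mathbb{C}\setminus\{0\}$. Consider the $U_q(\mathfrak{sl}_2)$-module algebra structure on the quantum plane $\mathbb{C}_q[x,y]$ given by $$\mathsf{k}(x)=q^2x,\quad \mathsf{k}(y)=q^{-1}y,\quad \mathsf{e}(x)=-qc_0^{-1}x^2,\quad \mathsf{e}(y)=c_0^{-1}xy,\quad \mathsf{f}(x)=c_0,\quad \mathsf{f}(y)=0,$$ viewed as a representation of $U_q(\mathfrak{sl}_2)$ in the vector space $\mathbb{C}_q[x,y]$. Then it splits into the direct sum of subrepresentations $\mathbb{C}_q[x,y]=\bigoplus_{n=0}^\infty\mathcal{V}_n$, where $\mathcal{V}_n=\mathbb{C}[x]y^n$. Each $\mathcal{V}_n$ admits a composition series of the form $0\subset\mathcal{J}_n\subset\mathcal{V}_n$, where the simple submodule $\mathcal{J}_n$, of dimension $n+1$, is the linear span of $y^n,xy^n,\ldots,x^{n-1}y^n,x^ny^n$. This is a finite-dimensional $U_q(\mathfrak{sl}_2)$-module whose lowest weight vector is $y^n$ with weight $q^{-n}$, and its isomorphism class is $\mathcal{V}_{1,n}$. The submodule $\mathcal{J}_n$ is not a direct summand in the category of $U_q(\mathfrak{sl}_2)$-modules (there exists no submodule $\mathcal{W}$ such that $\mathcal{V}_n=\mathcal{J}_n\oplus\mathcal{W}$). The quotient module $\mathcal{Z}_n=\mathcal{V}_n/\mathcal{J}_n$ is isomorphic to the (simple) Verma module with lowest weight $q^{n+2}$.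
   Context: The quantum plane $\mathbb{C}_q[x,y]$ is the unital associative $\mathbb{C}$-algebra with generators $x,y$ and the single relation $yx=qxy$; the monomials $x^my^n$ ($m,n\ge 0$) form a basis. $\mathbb{C}[x]$ denotes the linear span of $\{x^p\mid p\ge 0\}$. $U_q(\mathfrak{sl}_2)$ is the unital associative $\mathbb{C}$-algebra with generators $\mathsf{k},\mathsf{k}^{-1},\mathsf{e},\mathsf{f}$ and relations $\mathsf{k}^{-1}\mathsf{k}=\mathsf{k}\mathsf{k}^{-1}=\mathbf{1}$, $\mathsf{k}\mathsf{e}=q^2\mathsf{e}\mathsf{k}$, $\mathsf{k}\mathsf{f}=q^{-2}\mathsf{f}\mathsf{k}$, $\mathsf{e}\mathsf{f}-\mathsf{f}\mathsf{e}=\frac{\mathsf{k}-\mathsf{k}^{-1}}{q-q^{-1}}$, with comultiplication $\Delta(\mathsf{k})=\mathsf{k}\otimes\mathsf{k}$, $\Delta(\mathsf{e})=\mathbf{1}\otimes\mathsf{e}+\mathsf{e}\otimes\mathsf{k}$, $\Delta(\mathsf{f})=\mathsf{f}\otimes\mathbf{1}+\mathsf{k}^{-1}\otimes\mathsf{f}$ and counit $\varepsilon(\mathsf{k})=1$, $\varepsilon(\mathsf{e})=\varepsilon(\mathsf{f})=0$. A $U_q(\mathfrak{sl}_2)$-module algebra structure on $A=\mathbb{C}_q[x,y]$ is an algebra homomorphism $\pi:U_q(\mathfrak{sl}_2)\to\operatorname{End}_{\mathbb{C}}A$ such that $\pi(h)(ab)=\sum_i\pi(h_i')(a)\,\pi(h_i'')(b)$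 (where $\Delta(h)=\sum_i h_i'\otimes h_i''$) and $\pi(h)(\mathbf{1})=\varepsilon(h)\mathbf{1}$ for all $h$ and all $a,b\in A$; one writes $h(a)$ for $\pi(h)(a)$. It is uniquely determined by the values of $\mathsf{k},\mathsf{e},\mathsf{f}$ on $x,y$; the values above do define such a structure. $\mathcal{V}_{1,n}$ denotes the simple $(n+1)$-dimensional $U_q(\mathfrak{sl}_2)$-module with highest weight $q^n$: it has basis $v_0,\dots,v_n$ with $\mathsf{k}v_i=q^{n-2i}v_i$, $\mathsf{e}v_0=0$, $\mathsf{e}v_i=\frac{q^{n-i+1}-q^{-(n-i+1)}}{q-q^{-1}}v_{i-1}$ for $i\ge1$, $\mathsf{f}v_i=\frac{q^{i+1}-q^{-i-1}}{q-q^{-1}}v_{i+1}$ for $i<n$, $\mathsf{f}v_n=0$. A lowest weight vector of weight $\mu$ is a nonzero vector $w$ with $\mathsf{f}w=0$ and $\mathsf{k}w=\mu w$. The Verma module with lowest weight $\mu\in\mathbb{C}\setminus\{0\}$ is the universal module generated by a lowest weight vector of weight $\mu$, i.e. the quotient of $U_q(\mathfrak{sl}_2)$ by the left ideal generated by $\mathsf{f}$ and $\mathsf{k}-\mu$; it has basis $\{\mathsf{e}^iw_0\mid i\ge 0\}$, where $w_0$ is the image of $\mathbf{1}$. *)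

theory Defs
  imports
    "HOL-Algebra.Algebraic_Closure_Type"
    "HOL-Algebra.Module"
    "HOL-Library.Poly_Mapping"
    "HOL-Library.Product_Plus"
begin

section \<open>Modules over a not necessarily commutative ring\<close>

text \<open>The library locale \<open>module\<close> requires a commutative ring of scalars; the following has the same
  axioms over an arbitrary ring. The multiplicative fields of the record for \<open>M\<close> play no role.\<close>

locale left_module = R?: ring R + M?: abelian_group M
  for R :: "('a, 'z) ring_scheme" (structure) and M :: "('a, 'm) module" (structure) +
  assumes smult_closed:
      "\<lbrakk>a \<in> carrier R; x \<in> carrier M\<rbrakk> \<Longrightarrow> a \<odot>\<^bsub>M\<^esub> x \<in> carrier M"
    and smult_l_distr:
      "\<lbrakk>a \<in> carrier R; b \<in> carrier R; x \<in> carrier M\<rbrakk> \<Longrightarrow>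
        (a \<oplus>\<^bsub>R\<^esub> b) \<odot>\<^bsub>M\<^esub> x = a \<odot>\<^bsub>M\<^esub> x \<oplus>\<^bsub>M\<^esub> b \<odot>\<^bsub>M\<^esub> x"
    and smult_r_distr:
      "\<lbrakk>a \<in> carrier R; x \<in> carrier M; y \<in> carrier M\<rbrakk> \<Longrightarrow>
        a \<odot>\<^bsub>M\<^esub> (x \<oplus>\<^bsub>M\<^esub> y) = a \<odot>\<^bsub>M\<^esub> x \<oplus>\<^bsub>M\<^esub> a \<odot>\<^bsub>M\<^esub> y"
    and smult_assoc1:
      "\<lbrakk>a \<in> carrier R; b \<in> carrier R; x \<in> carrier M\<rbrakk> \<Longrightarrow>
        (a \<otimes>\<^bsub>R\<^esub> b) \<odot>\<^bsub>M\<^esub> x = a \<odot>\<^bsub>M\<^esub> (b \<odot>\<^bsub>M\<^esub> x)"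
    and smult_one:
      "x \<in> carrier M \<Longrightarrow> \<one>\<^bsub>R\<^esub> \<odot>\<^bsub>M\<^esub> x = x"

definition restr_module :: "('r, 'm) module \<Rightarrow> 'm set \<Rightarrow> ('r, 'm) module" where
  "restr_module M H = M\<lparr>carrier := H\<rparr>"

text \<open>The action on cosets follows the pattern of the library constant \<open>rcoset_mult\<close>.\<close>

definition quot_module :: "('r, 'm) module \<Rightarrow> 'm set \<Rightarrow> ('r, 'm set) module" where
  "quot_module M H =
    \<lparr>carrier = a_rcosets\<^bsub>M\<^esub> H, monoid.mult = undefined, one = undefined,
     zero = H, add = set_add M,
     module.smult = (\<lambda>r Y. \<Union>x\<in>Y. H +>\<^bsub>M\<^esub> (r \<odot>\<^bsub>M\<^esub> x))\<rparr>"

text \<open>For a field \<open>R\<close> this is the linear span; for the regular module it is the left ideal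
  generated by \<open>S\<close>.\<close>

definition gen_submodule :: "('r, 'z) ring_scheme \<Rightarrow> ('r, 'm) module \<Rightarrow> 'm set \<Rightarrow> 'm set" where
  "gen_submodule R M S = \<Inter>{H. submodule H R M \<and> S \<subseteq> H}"

definition regular_module :: "('r, 'z) ring_scheme \<Rightarrow> ('r, 'r) module" where
  "regular_module R =
    \<lparr>carrier = carrier R, monoid.mult = monoid.mult R, one = one R, zero = zero R, add = add R,
     module.smult = monoid.mult R\<rparr>"

definition simple_module :: "('r, 'z) ring_scheme \<Rightarrow> ('r, 'm) module \<Rightarrow> bool" where
  "simple_module R M \<longleftrightarrow>
    left_module R M \<and> carrier M \<noteq> {\<zero>\<^bsub>M\<^esub>} \<and>
    (\<forall>H. submodule H R M \<longrightarrow> H = {\<zero>\<^bsub>M\<^esub>} \<or> H = carrier M)"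

definition mod_hom :: "('r, 'z) ring_scheme \<Rightarrow> ('r, 'm) module \<Rightarrow> ('r, 'n) module \<Rightarrow> ('m \<Rightarrow> 'n) set" where
  "mod_hom R M N = {\<phi> \<in> carrier M \<rightarrow> carrier N.
    (\<forall>a\<in>carrier M. \<forall>b\<in>carrier M. \<phi> (a \<oplus>\<^bsub>M\<^esub> b) = \<phi> a \<oplus>\<^bsub>N\<^esub> \<phi> b) \<and>
    (\<forall>r\<in>carrier R. \<forall>a\<in>carrier M. \<phi> (r \<odot>\<^bsub>M\<^esub> a) = r \<odot>\<^bsub>N\<^esub> \<phi> a)}"

definition mod_isomorphic :: "('r, 'z) ring_scheme \<Rightarrow> ('r, 'm) module \<Rightarrow> ('r, 'n) module \<Rightarrow> bool" where
  "mod_isomorphic R M N \<longleftrightarrow> left_module R M \<and> left_module R N \<and>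
    (\<exists>\<phi>\<in>mod_hom R M N. bij_betw \<phi> (carrier M) (carrier N))"

definition direct_sum_decomp ::
    "('r, 'z) ring_scheme \<Rightarrow> ('r, 'm) module \<Rightarrow> (nat \<Rightarrow> 'm set) \<Rightarrow> bool" where
  "direct_sum_decomp R M N \<longleftrightarrow> (\<forall>n. submodule (N n) R M) \<and>
    (\<forall>a\<in>carrier M. \<exists>!v. (\<forall>n. v n \<in> N n) \<and> finite {n. v n \<noteq> \<zero>\<^bsub>M\<^esub>} \<and>
       a = (\<Oplus>\<^bsub>M\<^esub>n\<in>{n. v n \<noteq> \<zero>\<^bsub>M\<^esub>}. v n))"

definition direct_summand :: "('r, 'z) ring_scheme \<Rightarrow> ('r, 'm) module \<Rightarrow> 'm set \<Rightarrow> bool" where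
  "direct_summand R M H \<longleftrightarrow>
    (\<exists>W. submodule W R M \<and> H \<inter> W = {\<zero>\<^bsub>M\<^esub>} \<and> H <+>\<^bsub>M\<^esub> W = carrier M)"

definition composition_series ::
    "('r, 'z) ring_scheme \<Rightarrow> ('r, 'm) module \<Rightarrow> 'm set list \<Rightarrow> bool" where
  "composition_series R M Hs \<longleftrightarrow>
    Hs \<noteq> [] \<and> hd Hs = {\<zero>\<^bsub>M\<^esub>} \<and> last Hs = carrier M \<and>
    (\<forall>H\<in>set Hs. submodule H R M) \<and>
    (\<forall>i. Suc i < length Hs \<longrightarrow> Hs ! i \<subset> Hs ! Suc i \<and>
       simple_module R (quot_module (restr_module M (Hs ! Suc i)) (Hs ! i)))"

definition has_dimension :: "('r, 'z) ring_scheme \<Rightarrow> ('r, 'm) module \<Rightarrow> nat \<Rightarrow> bool" where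
  "has_dimension K V d \<longleftrightarrow>
    (\<exists>b \<in> {..<d} \<rightarrow> carrier V. \<forall>v\<in>carrier V.
       \<exists>!c. c \<in> {..<d} \<rightarrow>\<^sub>E carrier K \<and> v = (\<Oplus>\<^bsub>V\<^esub>i\<in>{..<d}. c i \<odot>\<^bsub>V\<^esub> b i))"


section \<open>Complex algebras given by generators and relations\<close>

text \<open>A complex algebra is a record of type \<open>(complex, 'a) module\<close>, all of whose fields are used.\<close>

abbreviation CC :: "complex ring" where
  "CC \<equiv> ring_of_type_algebra"

definition alg_hom :: "(complex, 'a) module \<Rightarrow> (complex, 'b) module \<Rightarrow> ('a \<Rightarrow> 'b) set" where
  "alg_hom A B = {\<phi> \<in> ring_hom A B.
    \<forall>c. \<forall>a\<in>carrier A. \<phi> (c \<odot>\<^bsub>A\<^esub> a) = c \<odot>\<^bsub>B\<^esub> \<phi> a}"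

definition End_alg :: "(complex, 'a) module \<Rightarrow> (complex, 'a \<Rightarrow> 'a) module" where
  "End_alg V =
    \<lparr>carrier = {\<phi> \<in> carrier V \<rightarrow>\<^sub>E carrier V.
       (\<forall>a\<in>carrier V. \<forall>b\<in>carrier V. \<phi> (a \<oplus>\<^bsub>V\<^esub> b) = \<phi> a \<oplus>\<^bsub>V\<^esub> \<phi> b) \<and>
       (\<forall>c. \<forall>a\<in>carrier V. \<phi> (c \<odot>\<^bsub>V\<^esub> a) = c \<odot>\<^bsub>V\<^esub> \<phi> a)},
     monoid.mult = (\<lambda>\<phi> \<psi>. compose (carrier V) \<phi> \<psi>),
     one = (\<lambda>a\<in>carrier V. a),
     zero = (\<lambda>a\<in>carrier V. \<zero>\<^bsub>V\<^esub>),
     add = (\<lambda>\<phi> \<psi>. \<lambda>a\<in>carrier V. \<phi> a \<oplus>\<^bsub>V\<^esub> \<psi> a),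
     module.smult = (\<lambda>c \<phi>. \<lambda>a\<in>carrier V. c \<odot>\<^bsub>V\<^esub> \<phi> a)\<rparr>"

text \<open>The free monoid, written additively: the product of \<open>poly_mapping\<close>s over an additive monoid is
  convolution, so \<open>'g fmon \<Rightarrow>\<^sub>0 complex\<close> is the free algebra on \<open>'g\<close>, and
  \<open>('g fmon \<times> 'g fmon) \<Rightarrow>\<^sub>0 complex\<close> is its tensor square with multiplication
  \<open>(a \<otimes> b)(c \<otimes> d) = ac \<otimes> bd\<close>.\<close>

datatype 'g fmon = FMon (letters: "'g list")

instantiation fmon :: (type) monoid_add
begin

definition zero_fmon :: "'a fmon" where
  "zero_fmon = FMon []"

definition plus_fmon :: "'a fmon \<Rightarrow> 'a fmon \<Rightarrow> 'a fmon" where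
  "plus_fmon v w = FMon (letters v @ letters w)"

instance
  by standard (simp_all add: zero_fmon_def plus_fmon_def)

end

type_synonym 'g free = "'g fmon \<Rightarrow>\<^sub>0 complex"
type_synonym 'g free2 = "('g fmon \<times> 'g fmon) \<Rightarrow>\<^sub>0 complex"

definition cscale :: "complex \<Rightarrow> ('k \<Rightarrow>\<^sub>0 complex) \<Rightarrow> ('k \<Rightarrow>\<^sub>0 complex)" where
  "cscale c p = Poly_Mapping.map ((*) c) p"

definition gen :: "'g \<Rightarrow> 'g free" where
  "gen g = Poly_Mapping.single (FMon [g]) 1"

text \<open>The algebra homomorphism on the free algebra extending \<open>\<phi>\<close>; \<open>sc\<close> is the scalar
  multiplication of the target.\<close>

definition free_lift :: "(complex \<Rightarrow> 'b \<Rightarrow> 'b) \<Rightarrow> ('g \<Rightarrow> 'b::ring_1) \<Rightarrow> 'g free \<Rightarrow> 'b" where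
  "free_lift sc \<phi> h =
    (\<Sum>w\<in>Poly_Mapping.keys h. sc (Poly_Mapping.lookup h w) (prod_list (map \<phi> (letters w))))"

definition tensor :: "'g free \<Rightarrow> 'g free \<Rightarrow> 'g free2" where
  "tensor u v = (\<Sum>a\<in>Poly_Mapping.keys u. \<Sum>b\<in>Poly_Mapping.keys v.
     Poly_Mapping.single (a, b) (Poly_Mapping.lookup u a * Poly_Mapping.lookup v b))"

definition rel_ideal :: "'g free set \<Rightarrow> 'g free set" where
  "rel_ideal S = Idl\<^bsub>ring_of_type_algebra\<^esub> S"

definition cls :: "'g free set \<Rightarrow> 'g free \<Rightarrow> 'g free set" where
  "cls S a = rel_ideal S +>\<^bsub>ring_of_type_algebra\<^esub> a"

text \<open>The quotient of the free algebra by the two-sided ideal generated by \<open>S\<close>; the ring fields are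
  those of the library quotient ring.\<close>

definition presented_algebra :: "'g free set \<Rightarrow> (complex, 'g free set) module" where
  "presented_algebra S =
    (let Q = (ring_of_type_algebra :: 'g free ring) Quot rel_ideal S in
     \<lparr>carrier = carrier Q, monoid.mult = monoid.mult Q, one = one Q, zero = zero Q, add = add Q,
      module.smult = (\<lambda>c Y. \<Union>a\<in>Y. cls S (cscale c a))\<rparr>)"


section \<open>The quantum plane\<close>

datatype qp_gen = Gx | Gy

definition qp_rels :: "complex \<Rightarrow> qp_gen free set" where
  "qp_rels q = {gen Gy * gen Gx - cscale q (gen Gx * gen Gy)}"

definition qplane :: "complex \<Rightarrow> (complex, qp_gen free set) module" where
  "qplane q = presented_algebra (qp_rels q)"

definition qx :: "complex \<Rightarrow> qp_gen free set" where "qx q = cls (qp_rels q) (gen Gx)"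
definition qy :: "complex \<Rightarrow> qp_gen free set" where "qy q = cls (qp_rels q) (gen Gy)"

definition qmonom :: "complex \<Rightarrow> nat \<Rightarrow> nat \<Rightarrow> qp_gen free set" where
  "qmonom q m n = (qx q [^]\<^bsub>qplane q\<^esub> m) \<otimes>\<^bsub>qplane q\<^esub> (qy q [^]\<^bsub>qplane q\<^esub> n)"

definition Cx :: "complex \<Rightarrow> qp_gen free set set" where
  "Cx q = gen_submodule CC (qplane q) {qx q [^]\<^bsub>qplane q\<^esub> p | p::nat. True}"

definition Vset :: "complex \<Rightarrow> nat \<Rightarrow> qp_gen free set set" where
  "Vset q n = {p \<otimes>\<^bsub>qplane q\<^esub> (qy q [^]\<^bsub>qplane q\<^esub> n) | p. p \<in> Cx q}"

definition Jset :: "complex \<Rightarrow> nat \<Rightarrow> qp_gen free set set" where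
  "Jset q n = gen_submodule CC (qplane q) {qmonom q i n | i. i \<le> n}"


section \<open>The quantum enveloping algebra of sl(2)\<close>

datatype uq_gen = Gk | Gki | Ge | Gf

definition uq_rels :: "complex \<Rightarrow> uq_gen free set" where
  "uq_rels q =
    {gen Gki * gen Gk - 1,
     gen Gk * gen Gki - 1,
     gen Gk * gen Ge - cscale (q ^ 2) (gen Ge * gen Gk),
     gen Gk * gen Gf - cscale (inverse (q ^ 2)) (gen Gf * gen Gk),
     gen Ge * gen Gf - gen Gf * gen Ge
       - cscale (1 / (q - inverse q)) (gen Gk - gen Gki)}"

definition Uq :: "complex \<Rightarrow> (complex, uq_gen free set) module" where
  "Uq q = presented_algebra (uq_rels q)"

definition uk :: "complex \<Rightarrow> uq_gen free set" where "uk q = cls (uq_rels q) (gen Gk)"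
definition ue :: "complex \<Rightarrow> uq_gen free set" where "ue q = cls (uq_rels q) (gen Ge)"
definition uf :: "complex \<Rightarrow> uq_gen free set" where "uf q = cls (uq_rels q) (gen Gf)"

fun comult_gen :: "uq_gen \<Rightarrow> uq_gen free2" where
  "comult_gen Gk = tensor (gen Gk) (gen Gk)"
| "comult_gen Gki = tensor (gen Gki) (gen Gki)"
| "comult_gen Ge = tensor 1 (gen Ge) + tensor (gen Ge) (gen Gk)"
| "comult_gen Gf = tensor (gen Gf) 1 + tensor (gen Gki) (gen Gf)"

fun counit_gen :: "uq_gen \<Rightarrow> complex" where
  "counit_gen Gk = 1"
| "counit_gen Gki = 1"
| "counit_gen Ge = 0"
| "counit_gen Gf = 0"

definition comult :: "uq_gen free \<Rightarrow> uq_gen free2" where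
  "comult = free_lift cscale comult_gen"

definition counit :: "uq_gen free \<Rightarrow> complex" where
  "counit = free_lift (*) counit_gen"

text \<open>The kernel of the projection from the tensor square of the free algebra onto the tensor square
  of \<open>Uq q\<close>. Equality in the latter is thus expressed by membership in this ideal.\<close>

definition tensor_ideal :: "complex \<Rightarrow> uq_gen free2 set" where
  "tensor_ideal q = Idl\<^bsub>ring_of_type_algebra\<^esub>
     ((\<lambda>r. tensor r 1) ` uq_rels q \<union> (\<lambda>r. tensor 1 r) ` uq_rels q)"

text \<open>\<open>coproduct_is q h m u v\<close> says \<open>\<Delta>(h) = \<Sum>\<^sub>i\<^sub><\<^sub>m u\<^sub>i \<otimes> v\<^sub>i\<close> in the tensor square of \<open>Uq q\<close>, where
  \<open>h\<close>, \<open>u\<^sub>i\<close>, \<open>v\<^sub>i\<close> are representatives in the free algebra.\<close>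

definition coproduct_is ::
    "complex \<Rightarrow> uq_gen free \<Rightarrow> nat \<Rightarrow> (nat \<Rightarrow> uq_gen free) \<Rightarrow> (nat \<Rightarrow> uq_gen free) \<Rightarrow> bool" where
  "coproduct_is q h m u v \<longleftrightarrow> comult h - (\<Sum>i<m. tensor (u i) (v i)) \<in> tensor_ideal q"

definition module_algebra_structure ::
    "complex \<Rightarrow> (complex, 'a) module \<Rightarrow> (uq_gen free set \<Rightarrow> 'a \<Rightarrow> 'a) \<Rightarrow> bool" where
  "module_algebra_structure q A \<pi> \<longleftrightarrow>
    \<pi> \<in> alg_hom (Uq q) (End_alg A) \<and>
    (\<forall>h m u v. coproduct_is q h m u v \<longrightarrow>
       (\<forall>a\<in>carrier A. \<forall>b\<in>carrier A.
          \<pi> (cls (uq_rels q) h) (a \<otimes>\<^bsub>A\<^esub> b) =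
          (\<Oplus>\<^bsub>A\<^esub>i\<in>{..<m}. \<pi> (cls (uq_rels q) (u i)) a \<otimes>\<^bsub>A\<^esub> \<pi> (cls (uq_rels q) (v i)) b))) \<and>
    (\<forall>h. \<pi> (cls (uq_rels q) h) \<one>\<^bsub>A\<^esub> = counit h \<odot>\<^bsub>A\<^esub> \<one>\<^bsub>A\<^esub>)"

definition rep_module ::
    "(complex, 'a) module \<Rightarrow> (uq_gen free set \<Rightarrow> 'a \<Rightarrow> 'a) \<Rightarrow> (uq_gen free set, 'a) module" where
  "rep_module A \<pi> =
    \<lparr>carrier = carrier A, monoid.mult = monoid.mult A, one = one A,
     zero = zero A, add = add A, module.smult = \<pi>\<rparr>"

text \<open>On a \<open>Uq q\<close>-module the complex number \<open>\<mu>\<close> acts as \<open>\<mu> \<cdot> \<one>\<close>.\<close>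

definition lowest_weight_vector ::
    "complex \<Rightarrow> (uq_gen free set, 'm) module \<Rightarrow> complex \<Rightarrow> 'm \<Rightarrow> bool" where
  "lowest_weight_vector q M \<mu> w \<longleftrightarrow>
    w \<in> carrier M \<and> w \<noteq> \<zero>\<^bsub>M\<^esub> \<and> uf q \<odot>\<^bsub>M\<^esub> w = \<zero>\<^bsub>M\<^esub> \<and>
    uk q \<odot>\<^bsub>M\<^esub> w = (\<mu> \<odot>\<^bsub>Uq q\<^esub> \<one>\<^bsub>Uq q\<^esub>) \<odot>\<^bsub>M\<^esub> w"

definition verma_low :: "complex \<Rightarrow> complex \<Rightarrow> (uq_gen free set, uq_gen free set set) module" where
  "verma_low q \<mu> =
    quot_module (regular_module (Uq q))
      (gen_submodule (Uq q) (regular_module (Uq q))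
        {uf q, uk q \<ominus>\<^bsub>Uq q\<^esub> (\<mu> \<odot>\<^bsub>Uq q\<^esub> \<one>\<^bsub>Uq q\<^esub>)})"


section \<open>The simple module with highest weight q^n\<close>

definition qint :: "complex \<Rightarrow> int \<Rightarrow> complex" where
  "qint q m = (q powi m - q powi (- m)) / (q - inverse q)"

text \<open>The underlying space is spanned by \<open>v\<^sub>i = single i 1\<close> for \<open>i \<le> n\<close>; \<open>V1_basis q n g i\<close> is \<open>g v\<^sub>i\<close>.\<close>

fun V1_basis :: "complex \<Rightarrow> nat \<Rightarrow> uq_gen \<Rightarrow> nat \<Rightarrow> (nat \<Rightarrow>\<^sub>0 complex)" where
  "V1_basis q n Gk i = Poly_Mapping.single i (q powi (int n - 2 * int i))"
| "V1_basis q n Gki i = Poly_Mapping.single i (q powi (2 * int i - int n))"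
| "V1_basis q n Ge i =
    (if i = 0 then 0 else Poly_Mapping.single (i - 1) (qint q (int n - int i + 1)))"
| "V1_basis q n Gf i =
    (if i < n then Poly_Mapping.single (i + 1) (qint q (int i + 1)) else 0)"

definition V1_gen :: "complex \<Rightarrow> nat \<Rightarrow> uq_gen \<Rightarrow> (nat \<Rightarrow>\<^sub>0 complex) \<Rightarrow> (nat \<Rightarrow>\<^sub>0 complex)" where
  "V1_gen q n g v =
    (\<Sum>i\<in>Poly_Mapping.keys v. cscale (Poly_Mapping.lookup v i) (V1_basis q n g i))"

definition V1_free :: "complex \<Rightarrow> nat \<Rightarrow> uq_gen free \<Rightarrow> (nat \<Rightarrow>\<^sub>0 complex) \<Rightarrow> (nat \<Rightarrow>\<^sub>0 complex)" where
  "V1_free q n h v =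
    (\<Sum>w\<in>Poly_Mapping.keys h. cscale (Poly_Mapping.lookup h w) (foldr (V1_gen q n) (letters w) v))"

text \<open>For \<open>q \<noteq> 0\<close>, \<open>q\<^sup>2 \<noteq> 1\<close> the free algebra acts on the carrier through \<open>Uq q\<close>, so that the image in
  \<open>smult\<close> is a singleton.\<close>

definition V1_module :: "complex \<Rightarrow> nat \<Rightarrow> (uq_gen free set, nat \<Rightarrow>\<^sub>0 complex) module" where
  "V1_module q n =
    \<lparr>carrier = {v. Poly_Mapping.keys v \<subseteq> {..n}}, monoid.mult = undefined, one = undefined,
     zero = 0, add = (+),
     module.smult = (\<lambda>Y v. the_elem ((\<lambda>h. V1_free q n h v) ` Y))\<rparr>"

end

theory Submission
  imports Defs
begin

text \<open>
  The basis \<open>x\<^sup>m y\<^sup>n\<close> diagonalizes \<open>\<k>\<close>, and the twisted Leibniz rules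
  \<open>\<e>(ab) = a \<e>(b) + \<e>(a) \<k>(b)\<close> and \<open>\<f>(ab) = \<f>(a) b + \<k>\<^sup>-\<^sup>1(a) \<f>(b)\<close> determine the rest by
  induction on the degree: \<open>\<e>\<close> sends \<open>x\<^sup>m y\<^sup>n\<close> to a multiple of \<open>x\<^sup>m\<^sup>+\<^sup>1 y\<^sup>n\<close> that vanishes exactly
  for \<open>m = n\<close>, and \<open>\<f>\<close> sends it to a multiple of \<open>x\<^sup>m\<^sup>-\<^sup>1 y\<^sup>n\<close> that vanishes exactly for \<open>m = 0\<close>
  (\<open>act_e\<close>, \<open>act_f\<close>, \<open>e_coeff_zero_iff\<close>, \<open>f_coeff_nonzero\<close>; here \<open>q\<close> is not a root of unity). So
  each \<open>\<V>\<^sub>n = \<complex>[x]y\<^sup>n\<close> is a chain on which \<open>\<f>\<close> descends all the way to \<open>y\<^sup>n\<close> while \<open>\<e>\<close> ascends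
  with a single gap, between degrees \<open>n\<close> and \<open>n + 1\<close>. Everything follows from this picture.

  \<^item> The polynomials of degree at most \<open>n\<close> are stable under \<open>\<e>\<close> because of the gap; they form \<open>\<J>\<^sub>n\<close>.

  \<^item> A nonzero submodule of \<open>\<V>\<^sub>n\<close> contains \<open>y\<^sup>n\<close> (apply \<open>\<f>\<close> to a nonzero element until its degree is
    \<open>0\<close>), hence \<open>\<J>\<^sub>n\<close> (apply \<open>\<e>\<close>). So \<open>\<J>\<^sub>n\<close> is simple, and it meets every nonzero submodule, which
    excludes a complement (\<open>Jset_least\<close>).

  \<^item> A submodule that properly contains \<open>\<J>\<^sub>n\<close> has an element of degree exactly \<open>n + 1\<close> (again by
    \<open>\<f>\<close>), so modulo \<open>\<J>\<^sub>n\<close> the monomial \<open>x\<^sup>n\<^sup>+\<^sup>1 y\<^sup>n\<close>, and by \<open>\<e>\<close> all higher ones; so \<open>\<V>\<^sub>n/\<J>\<^sub>n\<close> is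
    simple (\<open>Jset_maximal\<close>).

  \<^item> The class of \<open>x\<^sup>n\<^sup>+\<^sup>1 y\<^sup>n\<close> in \<open>\<V>\<^sub>n/\<J>\<^sub>n\<close> is a lowest weight vector of weight \<open>q\<^sup>n\<^sup>+\<^sup>2\<close>, which gives a
    surjection from the Verma module. The Verma module is spanned by the images of the powers of \<open>\<e>\<close>
    (\<open>verma_span\<close>), and these go to nonzero multiples of distinct monomials, so the surjection is an
    isomorphism (\<open>mod_isomorphic_Z_verma\<close>). Simplicity of the Verma module is then inherited.

  \<^item> \<open>\<J>\<^sub>n\<close> and \<open>\<V>\<^sub>1\<^sub>,\<^sub>n\<close> are both chains of length \<open>n + 1\<close>, and rescaling the basis vectors matches the
    coefficients (\<open>mod_isomorphic_J_V1\<close>).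

  The decomposition into the \<open>\<V>\<^sub>n\<close>, and every use of linear independence above, rests on the basis
  theorem for the quantum plane. Spanning is rewriting with \<open>yx = qxy\<close>; independence comes from letting
  the free algebra act on polynomials in \<open>y\<close> over \<open>\<complex>[x]\<close> in such a way that the relation acts as zero
  (\<open>qp_coord_cls\<close>, \<open>cls_qp_normal\<close>).
\<close>

section \<open>Modules over a ring: submodules, quotients, isomorphisms\<close>

lemma mod_homI:
  assumes "\<And>a. a \<in> carrier M \<Longrightarrow> \<phi> a \<in> carrier N"
    and "\<And>a b. a \<in> carrier M \<Longrightarrow> b \<in> carrier M \<Longrightarrow> \<phi> (a \<oplus>\<^bsub>M\<^esub> b) = \<phi> a \<oplus>\<^bsub>N\<^esub> \<phi> b"
    and "\<And>r a. r \<in> carrier R \<Longrightarrow> a \<in> carrier M \<Longrightarrow> \<phi> (r \<odot>\<^bsub>M\<^esub> a) = r \<odot>\<^bsub>N\<^esub> \<phi> a"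
  shows "\<phi> \<in> mod_hom R M N"
  using assms by (auto simp: mod_hom_def)

lemma mod_homD:
  assumes "\<phi> \<in> mod_hom R M N"
  shows "\<And>a. a \<in> carrier M \<Longrightarrow> \<phi> a \<in> carrier N"
    and "\<And>a b. a \<in> carrier M \<Longrightarrow> b \<in> carrier M \<Longrightarrow> \<phi> (a \<oplus>\<^bsub>M\<^esub> b) = \<phi> a \<oplus>\<^bsub>N\<^esub> \<phi> b"
    and "\<And>r a. r \<in> carrier R \<Longrightarrow> a \<in> carrier M \<Longrightarrow> \<phi> (r \<odot>\<^bsub>M\<^esub> a) = r \<odot>\<^bsub>N\<^esub> \<phi> a"
  using assms by (auto simp: mod_hom_def)

context left_module
begin

lemma smult_l_null: "x \<in> carrier M \<Longrightarrow> \<zero>\<^bsub>R\<^esub> \<odot>\<^bsub>M\<^esub> x = \<zero>\<^bsub>M\<^esub>"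
  by (metis R.r_zero R.zero_closed smult_closed smult_l_distr M.add.r_cancel_one')

lemma smult_l_minus_one: "x \<in> carrier M \<Longrightarrow> (\<ominus>\<^bsub>R\<^esub> \<one>\<^bsub>R\<^esub>) \<odot>\<^bsub>M\<^esub> x = \<ominus>\<^bsub>M\<^esub> x"
  by (metis M.minus_equality R.l_neg R.add.inv_closed R.one_closed smult_closed smult_l_distr
      smult_l_null smult_one)

lemma submodule_iff:
  "submodule H R M \<longleftrightarrow> H \<subseteq> carrier M \<and> \<zero>\<^bsub>M\<^esub> \<in> H \<and> (\<forall>a\<in>H. \<forall>b\<in>H. a \<oplus>\<^bsub>M\<^esub> b \<in> H) \<and>
     (\<forall>r\<in>carrier R. \<forall>a\<in>H. r \<odot>\<^bsub>M\<^esub> a \<in> H)" (is "_ \<longleftrightarrow> ?rhs")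
proof
  assume "submodule H R M"
  then show ?rhs
    unfolding submodule_def submodule_axioms_def subgroup_def by auto
next
  assume h: ?rhs
  have "\<ominus>\<^bsub>M\<^esub> a \<in> H" if "a \<in> H" for a
    using h that smult_l_minus_one[of a] by (metis R.add.inv_closed R.one_closed subsetD)
  then show "submodule H R M"
    using h unfolding submodule_def submodule_axioms_def subgroup_def a_inv_def by auto
qed

lemma submoduleI:
  assumes "H \<subseteq> carrier M" "\<zero>\<^bsub>M\<^esub> \<in> H" "\<And>a b. a \<in> H \<Longrightarrow> b \<in> H \<Longrightarrow> a \<oplus>\<^bsub>M\<^esub> b \<in> H"
    and "\<And>r a. r \<in> carrier R \<Longrightarrow> a \<in> H \<Longrightarrow> r \<odot>\<^bsub>M\<^esub> a \<in> H"
  shows "submodule H R M"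
  using assms by (auto simp: submodule_iff)

lemma submoduleD:
  assumes "submodule H R M"
  shows "H \<subseteq> carrier M" "\<zero>\<^bsub>M\<^esub> \<in> H" "\<And>a b. a \<in> H \<Longrightarrow> b \<in> H \<Longrightarrow> a \<oplus>\<^bsub>M\<^esub> b \<in> H"
    and "\<And>r a. r \<in> carrier R \<Longrightarrow> a \<in> H \<Longrightarrow> r \<odot>\<^bsub>M\<^esub> a \<in> H"
  using assms by (auto simp: submodule_iff)

lemma carrier_submodule: "submodule (carrier M) R M"
  by (auto intro!: submoduleI simp: smult_closed)

lemma zero_submodule: "submodule {\<zero>\<^bsub>M\<^esub>} R M"
proof (rule submoduleI)
  fix r a assume r: "r \<in> carrier R" and "a \<in> {\<zero>\<^bsub>M\<^esub>}"
  then have a: "a = \<zero>\<^bsub>M\<^esub>" by simp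
  have "r \<odot>\<^bsub>M\<^esub> \<zero>\<^bsub>M\<^esub> \<oplus>\<^bsub>M\<^esub> r \<odot>\<^bsub>M\<^esub> \<zero>\<^bsub>M\<^esub> = r \<odot>\<^bsub>M\<^esub> \<zero>\<^bsub>M\<^esub>"
    using smult_r_distr[OF r, of "\<zero>\<^bsub>M\<^esub>" "\<zero>\<^bsub>M\<^esub>"] by simp
  then show "r \<odot>\<^bsub>M\<^esub> a \<in> {\<zero>\<^bsub>M\<^esub>}"
    using a r smult_closed by auto
qed auto

lemma smult_r_null: "r \<in> carrier R \<Longrightarrow> r \<odot>\<^bsub>M\<^esub> \<zero>\<^bsub>M\<^esub> = \<zero>\<^bsub>M\<^esub>"
  using submoduleD(4)[OF zero_submodule] by auto

lemma submodule_gen_submodule: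
  assumes "S \<subseteq> carrier M"
  shows "submodule (gen_submodule R M S) R M"
proof -
  have "carrier M \<in> {H. submodule H R M \<and> S \<subseteq> H}"
    using assms carrier_submodule by auto
  then have "gen_submodule R M S \<subseteq> carrier M"
    unfolding gen_submodule_def by auto
  then show ?thesis
    by (intro submoduleI) (auto simp: gen_submodule_def dest: submoduleD)
qed

lemma abelian_subgroup_submodule:
  assumes "submodule H R M"
  shows "abelian_subgroup H M"
  using assms by (intro abelian_subgroupI3 additive_subgroupI)
    (auto simp: submodule_def M.abelian_group_axioms)

end

lemma gen_submodule_least: "submodule H R M \<Longrightarrow> S \<subseteq> H \<Longrightarrow> gen_submodule R M S \<subseteq> H"
  unfolding gen_submodule_def by auto

lemma gen_submodule_incl: "S \<subseteq> gen_submodule R M S"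
  unfolding gen_submodule_def by auto

text \<open>The axioms are identities, so they pass to any surjective image under a map that respects the
  operations. This yields the axioms for quotients and for modules given by a bijection.\<close>

lemma left_module_image:
  assumes N: "left_module R N" and surj: "\<phi> ` carrier N = carrier Q"
    and zero: "\<phi> \<zero>\<^bsub>N\<^esub> = \<zero>\<^bsub>Q\<^esub>" and hom: "\<phi> \<in> mod_hom R N Q"
  shows "left_module R Q"
proof -
  interpret N: left_module R N by fact
  note h = mod_homD(2,3)[OF hom]
  have ex: "\<exists>a\<in>carrier N. y = \<phi> a" if "y \<in> carrier Q" for y
    using that surj by auto
  have im: "\<phi> a \<in> carrier Q" if "a \<in> carrier N" for a
    using that surj by auto
  note hs = h[symmetric] zero[symmetric]
  have "abelian_group Q"
  proof (rule abelian_groupI)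
    fix x y assume "x \<in> carrier Q" "y \<in> carrier Q"
    then show "x \<oplus>\<^bsub>Q\<^esub> y \<in> carrier Q"
      by (auto dest!: ex simp: hs im)
  next
    show "\<zero>\<^bsub>Q\<^esub> \<in> carrier Q"
      by (simp add: hs im)
  next
    fix x y z assume "x \<in> carrier Q" "y \<in> carrier Q" "z \<in> carrier Q"
    then show "x \<oplus>\<^bsub>Q\<^esub> y \<oplus>\<^bsub>Q\<^esub> z = x \<oplus>\<^bsub>Q\<^esub> (y \<oplus>\<^bsub>Q\<^esub> z)"
      by (auto dest!: ex simp: hs N.M.a_assoc)
  next
    fix x y assume "x \<in> carrier Q" "y \<in> carrier Q"
    then show "x \<oplus>\<^bsub>Q\<^esub> y = y \<oplus>\<^bsub>Q\<^esub> x"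
      by (auto dest!: ex simp: hs N.M.a_comm)
  next
    fix x assume "x \<in> carrier Q"
    then show "\<zero>\<^bsub>Q\<^esub> \<oplus>\<^bsub>Q\<^esub> x = x"
      by (auto dest!: ex simp: hs)
  next
    fix x assume "x \<in> carrier Q"
    then obtain a where a: "a \<in> carrier N" "x = \<phi> a"
      using ex by blast
    then have "\<phi> (\<ominus>\<^bsub>N\<^esub> a) \<oplus>\<^bsub>Q\<^esub> x = \<zero>\<^bsub>Q\<^esub>"
      by (simp add: hs N.M.l_neg)
    then show "\<exists>y\<in>carrier Q. y \<oplus>\<^bsub>Q\<^esub> x = \<zero>\<^bsub>Q\<^esub>"
      using a im N.M.a_inv_closed by blast
  qed
  moreover have "left_module_axioms R Q"
  proof
    fix r x assume "r \<in> carrier R" "x \<in> carrier Q"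
    then show "r \<odot>\<^bsub>Q\<^esub> x \<in> carrier Q"
      by (auto dest!: ex simp: hs im N.smult_closed)
  next
    fix r s x assume "r \<in> carrier R" "s \<in> carrier R" "x \<in> carrier Q"
    then show "(r \<oplus>\<^bsub>R\<^esub> s) \<odot>\<^bsub>Q\<^esub> x = r \<odot>\<^bsub>Q\<^esub> x \<oplus>\<^bsub>Q\<^esub> s \<odot>\<^bsub>Q\<^esub> x"
      by (auto dest!: ex simp: hs N.smult_closed N.smult_l_distr)
  next
    fix r x y assume "r \<in> carrier R" "x \<in> carrier Q" "y \<in> carrier Q"
    then show "r \<odot>\<^bsub>Q\<^esub> (x \<oplus>\<^bsub>Q\<^esub> y) = r \<odot>\<^bsub>Q\<^esub> x \<oplus>\<^bsub>Q\<^esub> r \<odot>\<^bsub>Q\<^esub> y"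
      by (auto dest!: ex simp: hs N.smult_closed N.smult_r_distr)
  next
    fix r s x assume "r \<in> carrier R" "s \<in> carrier R" "x \<in> carrier Q"
    then show "(r \<otimes>\<^bsub>R\<^esub> s) \<odot>\<^bsub>Q\<^esub> x = r \<odot>\<^bsub>Q\<^esub> (s \<odot>\<^bsub>Q\<^esub> x)"
      by (auto dest!: ex simp: hs N.smult_closed N.smult_assoc1)
  next
    fix x assume "x \<in> carrier Q"
    then show "\<one>\<^bsub>R\<^esub> \<odot>\<^bsub>Q\<^esub> x = x"
      by (auto dest!: ex simp: hs N.smult_one)
  qed
  ultimately show ?thesis
    by (simp add: left_module_def N.R.ring_axioms)
qed

subsection \<open>Homomorphisms and isomorphisms\<close>

lemma mod_hom_zero:
  assumes "left_module R M" "left_module R N" "\<phi> \<in> mod_hom R M N"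
  shows "\<phi> \<zero>\<^bsub>M\<^esub> = \<zero>\<^bsub>N\<^esub>"
proof -
  interpret M: left_module R M by fact
  interpret N: left_module R N by fact
  show ?thesis
    using mod_homD[OF assms(3)] M.smult_l_null[OF M.M.zero_closed] N.smult_l_null
    by (metis M.M.zero_closed M.R.zero_closed)
qed

lemma mod_hom_vimage_submodule:
  assumes M: "left_module R M" and N: "left_module R N" and \<phi>: "\<phi> \<in> mod_hom R M N"
    and K: "submodule K R N"
  shows "submodule {a \<in> carrier M. \<phi> a \<in> K} R M"
proof -
  interpret M: left_module R M by fact
  interpret N: left_module R N by fact
  note h = mod_homD[OF \<phi>] and z = mod_hom_zero[OF M N \<phi>] and k = N.submoduleD[OF K]
  show ?thesis
    by (rule M.submoduleI) (auto simp: h z k M.smult_closed)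
qed

lemma mod_hom_image_submodule:
  assumes M: "left_module R M" and N: "left_module R N" and \<phi>: "\<phi> \<in> mod_hom R M N"
  shows "submodule (\<phi> ` carrier M) R N"
proof -
  interpret M: left_module R M by fact
  interpret N: left_module R N by fact
  note h = mod_homD[OF \<phi>] and z = mod_hom_zero[OF M N \<phi>]
  show ?thesis
  proof (rule N.submoduleI)
    show "\<zero>\<^bsub>N\<^esub> \<in> \<phi> ` carrier M"
      using z by (metis M.M.zero_closed imageI)
  qed (auto simp: h(1) h(2,3)[symmetric] M.smult_closed)
qed

lemma mod_isomorphic_sym:
  assumes "mod_isomorphic R M N"
  shows "mod_isomorphic R N M"
proof -
  obtain \<phi> where M: "left_module R M" and N: "left_module R N" and \<phi>: "\<phi> \<in> mod_hom R M N"
    and bij: "bij_betw \<phi> (carrier M) (carrier N)"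
    using assms unfolding mod_isomorphic_def by auto
  interpret M: left_module R M by fact
  interpret N: left_module R N by fact
  note h = mod_homD[OF \<phi>]
  let ?\<psi> = "inv_into (carrier M) \<phi>"
  have b: "bij_betw ?\<psi> (carrier N) (carrier M)"
    using bij by (rule bij_betw_inv_into)
  have c: "?\<psi> y \<in> carrier M" "\<phi> (?\<psi> y) = y" if "y \<in> carrier N" for y
    using that b bij by (auto simp: bij_betw_def bij_betw_inv_into_right f_inv_into_f)
  have e: "?\<psi> (\<phi> x) = x" if "x \<in> carrier M" for x
    using that bij by (simp add: bij_betw_inv_into_left)
  have "?\<psi> \<in> mod_hom R N M"
  proof (rule mod_homI)
    fix a b assume "a \<in> carrier N" "b \<in> carrier N"
    then show "?\<psi> (a \<oplus>\<^bsub>N\<^esub> b) = ?\<psi> a \<oplus>\<^bsub>M\<^esub> ?\<psi> b"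
      using c h(2)[of "?\<psi> a" "?\<psi> b"] e[of "?\<psi> a \<oplus>\<^bsub>M\<^esub> ?\<psi> b"] by simp
  next
    fix r a assume "r \<in> carrier R" "a \<in> carrier N"
    then show "?\<psi> (r \<odot>\<^bsub>N\<^esub> a) = r \<odot>\<^bsub>M\<^esub> ?\<psi> a"
      using c h(3)[of r "?\<psi> a"] e[of "r \<odot>\<^bsub>M\<^esub> ?\<psi> a"] by (simp add: M.smult_closed)
  qed (rule c)
  with b M N show ?thesis
    unfolding mod_isomorphic_def by blast
qed

lemma simple_module_isomorphic:
  assumes iso: "mod_isomorphic R M N" and simple: "simple_module R M"
  shows "simple_module R N"
proof -
  obtain \<phi> where M: "left_module R M" and N: "left_module R N" and \<phi>: "\<phi> \<in> mod_hom R M N"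
    and bij: "bij_betw \<phi> (carrier M) (carrier N)"
    using iso unfolding mod_isomorphic_def by auto
  interpret M: left_module R M by fact
  interpret N: left_module R N by fact
  note z = mod_hom_zero[OF M N \<phi>]
  have sur: "\<phi> ` carrier M = carrier N"
    using bij by (simp add: bij_betw_def)
  have "carrier N \<noteq> {\<zero>\<^bsub>N\<^esub>}"
  proof
    assume "carrier N = {\<zero>\<^bsub>N\<^esub>}"
    then have im: "\<phi> a = \<phi> \<zero>\<^bsub>M\<^esub>" if "a \<in> carrier M" for a
      using that sur z by auto
    have "a = \<zero>\<^bsub>M\<^esub>" if "a \<in> carrier M" for a
      using bij_betw_imp_inj_on[OF bij] im[OF that] that M.M.zero_closed by (rule inj_onD)
    then have "carrier M = {\<zero>\<^bsub>M\<^esub>}"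
      by auto
    then show False
      using simple by (simp add: simple_module_def)
  qed
  moreover have "K = {\<zero>\<^bsub>N\<^esub>} \<or> K = carrier N" if K: "submodule K R N" for K
  proof -
    let ?K = "{a \<in> carrier M. \<phi> a \<in> K}"
    have im: "K = \<phi> ` ?K"
      using N.submoduleD(1)[OF K] sur by auto
    consider "?K = {\<zero>\<^bsub>M\<^esub>}" | "?K = carrier M"
      using simple mod_hom_vimage_submodule[OF M N \<phi> K] by (auto simp: simple_module_def)
    then show ?thesis
    proof cases
      case 1
      then show ?thesis
        using im z by (simp only: 1 image_insert image_empty) simp
    next
      case 2
      then show ?thesis
        using im sur by (simp only: 2) simp
    qed
  qed
  ultimately show ?thesis
    by (simp add: simple_module_def N)
qed

subsection \<open>Restriction to a submodule\<close>

lemma restr_module_sel [simp]: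
  "carrier (restr_module M H) = H" "\<zero>\<^bsub>restr_module M H\<^esub> = \<zero>\<^bsub>M\<^esub>"
  "a \<oplus>\<^bsub>restr_module M H\<^esub> b = a \<oplus>\<^bsub>M\<^esub> b" "r \<odot>\<^bsub>restr_module M H\<^esub> a = r \<odot>\<^bsub>M\<^esub> a"
  "restr_module (restr_module M H) K = restr_module M K"
  by (simp_all add: restr_module_def)

lemma left_module_restr:
  assumes M: "left_module R M" and H: "submodule H R M"
  shows "left_module R (restr_module M H)"
proof -
  interpret M: left_module R M by fact
  note h = M.submoduleD[OF H]
  have hc: "a \<in> carrier M" if "a \<in> H" for a using h(1) that by auto
  have neg: "\<ominus>\<^bsub>M\<^esub> a \<in> H" if "a \<in> H" for a
    using that h M.smult_l_minus_one[of a] by (metis M.R.add.inv_closed M.R.one_closed subsetD)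
  have "abelian_group (restr_module M H)"
  proof (rule abelian_groupI)
    fix x assume "x \<in> carrier (restr_module M H)"
    then show "\<exists>y\<in>carrier (restr_module M H). y \<oplus>\<^bsub>restr_module M H\<^esub> x = \<zero>\<^bsub>restr_module M H\<^esub>"
      using neg hc M.M.l_neg by auto
  qed (auto simp: h hc M.M.a_assoc intro: M.M.a_comm)
  moreover have "left_module_axioms R (restr_module M H)"
    by standard (auto simp: h hc M.smult_l_distr M.smult_r_distr M.smult_assoc1 M.smult_one)
  ultimately show ?thesis
    by (simp add: left_module_def M.R.ring_axioms)
qed

lemma submodule_restr_iff:
  assumes M: "left_module R M" and H: "submodule H R M"
  shows "submodule K R (restr_module M H) \<longleftrightarrow> submodule K R M \<and> K \<subseteq> H"
proof -
  interpret M: left_module R M by fact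
  interpret L: left_module R "restr_module M H" using left_module_restr[OF M H] .
  show ?thesis
    using M.submoduleD(1)[OF H] by (auto simp: L.submodule_iff M.submodule_iff)
qed

subsection \<open>Quotients\<close>

lemma quot_module_proj:
  assumes M: "left_module R M" and H: "submodule H R M"
  shows "left_module R (quot_module M H)"
    and "(\<lambda>a. H +>\<^bsub>M\<^esub> a) \<in> mod_hom R M (quot_module M H)"
    and "(\<lambda>a. H +>\<^bsub>M\<^esub> a) ` carrier M = carrier (quot_module M H)"
    and "\<zero>\<^bsub>quot_module M H\<^esub> = H"
    and "\<And>a. a \<in> carrier M \<Longrightarrow> H +>\<^bsub>M\<^esub> a = H \<longleftrightarrow> a \<in> H"
proof -
  interpret M: left_module R M by fact
  interpret H: abelian_subgroup H M using M.abelian_subgroup_submodule[OF H] .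
  note h = M.submoduleD[OF H]
  show im: "(\<lambda>a. H +>\<^bsub>M\<^esub> a) ` carrier M = carrier (quot_module M H)"
    by (auto simp: quot_module_def A_RCOSETS_def')
  show z: "\<zero>\<^bsub>quot_module M H\<^esub> = H"
    by (simp add: quot_module_def)
  show eq: "H +>\<^bsub>M\<^esub> a = H \<longleftrightarrow> a \<in> H" if "a \<in> carrier M" for a
    using that M.M.a_coset_join1 M.M.a_coset_join2 H.a_subgroup by blast
  show hom: "(\<lambda>a. H +>\<^bsub>M\<^esub> a) \<in> mod_hom R M (quot_module M H)"
  proof (rule mod_homI)
    fix r a assume r: "r \<in> carrier R" and a: "a \<in> carrier M"
    have "H +>\<^bsub>M\<^esub> (r \<odot>\<^bsub>M\<^esub> x) = H +>\<^bsub>M\<^esub> (r \<odot>\<^bsub>M\<^esub> a)" if x: "x \<in> H +>\<^bsub>M\<^esub> a" for x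
    proof -
      obtain b where b: "b \<in> H" "x = b \<oplus>\<^bsub>M\<^esub> a"
        using x by (auto simp: a_r_coset_def')
      then have "r \<odot>\<^bsub>M\<^esub> x = r \<odot>\<^bsub>M\<^esub> b \<oplus>\<^bsub>M\<^esub> r \<odot>\<^bsub>M\<^esub> a"
        using M.smult_r_distr[OF r] h(1) a by blast
      then have "r \<odot>\<^bsub>M\<^esub> x \<in> H +>\<^bsub>M\<^esub> (r \<odot>\<^bsub>M\<^esub> a)"
        using b h(4)[OF r b(1)] by (auto simp: a_r_coset_def')
      then show ?thesis
        using M.M.a_repr_independence H.a_subgroup M.smult_closed[OF r a] by metis
    qed
    moreover have "H +>\<^bsub>M\<^esub> a \<noteq> {}"
      using H.a_rcos_self[OF a] by blast
    ultimately have "(\<Union>x\<in>H +>\<^bsub>M\<^esub> a. H +>\<^bsub>M\<^esub> (r \<odot>\<^bsub>M\<^esub> x)) = H +>\<^bsub>M\<^esub> (r \<odot>\<^bsub>M\<^esub> a)"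
      by (rule SUP_eq_const[rotated])
    then show "H +>\<^bsub>M\<^esub> (r \<odot>\<^bsub>M\<^esub> a) = r \<odot>\<^bsub>quot_module M H\<^esub> (H +>\<^bsub>M\<^esub> a)"
      by (simp only: quot_module_def module.simps)
  next
    fix a b assume "a \<in> carrier M" "b \<in> carrier M"
    then show "H +>\<^bsub>M\<^esub> (a \<oplus>\<^bsub>M\<^esub> b) = (H +>\<^bsub>M\<^esub> a) \<oplus>\<^bsub>quot_module M H\<^esub> (H +>\<^bsub>M\<^esub> b)"
      by (simp add: quot_module_def H.a_rcos_sum)
  qed (use im in auto)
  show "left_module R (quot_module M H)"
    using h(2) by (intro left_module_image[OF M im _ hom]) (simp add: z eq)
qed

text \<open>Submodules of the quotient correspond to submodules that contain \<open>H\<close>.\<close>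

lemma simple_quot_module:
  assumes M: "left_module R M" and H: "submodule H R M" and ne: "H \<noteq> carrier M"
    and max: "\<And>K. submodule K R M \<Longrightarrow> H \<subseteq> K \<Longrightarrow> K \<noteq> H \<Longrightarrow> K = carrier M"
  shows "simple_module R (quot_module M H)"
proof -
  interpret M: left_module R M by fact
  note p = quot_module_proj[OF M H]
  let ?p = "\<lambda>a. H +>\<^bsub>M\<^esub> a"
  interpret Q: left_module R "quot_module M H" by (rule p(1))
  have "carrier (quot_module M H) \<noteq> {\<zero>\<^bsub>quot_module M H\<^esub>}"
  proof
    assume "carrier (quot_module M H) = {\<zero>\<^bsub>quot_module M H\<^esub>}"
    then have "a \<in> H" if "a \<in> carrier M" for a
      using that p(3,4,5) by (metis imageI singletonD)
    then show False
      using ne M.submoduleD(1)[OF H] by blast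
  qed
  moreover have "K = {\<zero>\<^bsub>quot_module M H\<^esub>} \<or> K = carrier (quot_module M H)"
    if K: "submodule K R (quot_module M H)" for K
  proof -
    let ?K = "{a \<in> carrier M. ?p a \<in> K}"
    have im: "K = ?p ` ?K"
    proof -
      have "K \<subseteq> ?p ` carrier M"
        using Q.submoduleD(1)[OF K] p(3) by simp
      then show ?thesis by auto
    qed
    have sub: "submodule ?K R M"
      using mod_hom_vimage_submodule[OF M p(1) p(2) K] .
    have "H \<subseteq> ?K"
    proof
      fix a assume a: "a \<in> H"
      then have "a \<in> carrier M"
        using M.submoduleD(1)[OF H] by blast
      with a show "a \<in> ?K"
        using p(4) p(5)[of a] Q.submoduleD(2)[OF K] by simp
    qed
    then consider "?K = H" | "?K = carrier M"
      using max[OF sub] by blast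
    then show ?thesis
    proof cases
      case 1
      then have "K = ?p ` H" using im by simp
      also have "\<dots> = {H}"
        using p(5) M.submoduleD(1,2)[OF H] by (auto simp: subset_iff image_iff)
      finally show ?thesis using p(4) by simp
    next
      case 2
      then show ?thesis using im p(3) by simp
    qed
  qed
  ultimately show ?thesis
    by (simp add: simple_module_def p(1))
qed

text \<open>The first isomorphism theorem: two elements have the same image exactly when they lie in the same
  coset of the kernel, so \<open>\<phi>\<close> induces an injective map on cosets.\<close>

lemma mod_isomorphic_quot_kernel:
  assumes M: "left_module R M" and N: "left_module R N" and \<phi>: "\<phi> \<in> mod_hom R M N"
    and sur: "\<phi> ` carrier M = carrier N"
  shows "mod_isomorphic R (quot_module M {a \<in> carrier M. \<phi> a = \<zero>\<^bsub>N\<^esub>}) N"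
proof -
  interpret M: left_module R M by fact
  interpret N: left_module R N by fact
  define H where "H = {a \<in> carrier M. \<phi> a = \<zero>\<^bsub>N\<^esub>}"
  let ?p = "\<lambda>a. H +>\<^bsub>M\<^esub> a"
  note h = mod_homD[OF \<phi>]
  have H: "submodule H R M"
    using mod_hom_vimage_submodule[OF M N \<phi> N.zero_submodule] by (simp add: H_def)
  note p = quot_module_proj[OF M H]
  interpret H: abelian_subgroup H M using M.abelian_subgroup_submodule[OF H] .
  have eqI: "?p a = ?p b \<longleftrightarrow> \<phi> a = \<phi> b" if a: "a \<in> carrier M" and b: "b \<in> carrier M" for a b
  proof
    assume "?p a = ?p b"
    then have "a \<in> ?p b"
      using H.a_rcos_self[OF a] by simp
    then obtain c where cH: "c \<in> H" and ac: "a = c \<oplus>\<^bsub>M\<^esub> b"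
      by (auto simp: a_r_coset_def')
    have c: "c \<in> carrier M" "\<phi> c = \<zero>\<^bsub>N\<^esub>"
      using cH unfolding H_def by blast+
    show "\<phi> a = \<phi> b"
      using h(1)[OF b] by (simp only: ac c(2) h(2)[OF c(1) b] N.M.l_zero)
  next
    assume eq: "\<phi> a = \<phi> b"
    let ?c = "a \<oplus>\<^bsub>M\<^esub> (\<ominus>\<^bsub>M\<^esub> b)"
    have "\<phi> ?c = \<phi> (b \<oplus>\<^bsub>M\<^esub> (\<ominus>\<^bsub>M\<^esub> b))"
      using a b eq h(2) by simp
    also have "\<dots> = \<zero>\<^bsub>N\<^esub>"
      using b mod_hom_zero[OF M N \<phi>] by (simp add: M.M.r_neg)
    finally have "?c \<in> H" using a b M.M.a_closed M.M.a_inv_closed unfolding H_def by blast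
    moreover have "a = ?c \<oplus>\<^bsub>M\<^esub> b"
      using a b by (simp add: M.M.a_assoc M.M.l_neg)
    ultimately have "a \<in> ?p b"
      by (auto simp: a_r_coset_def')
    then show "?p a = ?p b"
      using M.M.a_repr_independence[OF _ b H.a_subgroup] by simp
  qed
  define \<psi> where "\<psi> Y = \<phi> (SOME a. a \<in> carrier M \<and> ?p a = Y)" for Y
  have \<psi>: "\<psi> (?p a) = \<phi> a" if a: "a \<in> carrier M" for a
  proof -
    let ?b = "SOME b. b \<in> carrier M \<and> ?p b = ?p a"
    have "?b \<in> carrier M \<and> ?p ?b = ?p a"
      by (rule someI[of _ a]) (simp add: a)
    then show ?thesis
      using eqI[of ?b a] a by (simp add: \<psi>_def)
  qed
  have ex: "\<exists>a\<in>carrier M. Y = ?p a" if "Y \<in> carrier (quot_module M H)" for Y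
    using that p(3) by (metis imageE)
  note hs = mod_homD(2,3)[OF p(2), symmetric]
  have "\<psi> \<in> mod_hom R (quot_module M H) N"
  proof (rule mod_homI)
    fix Y assume "Y \<in> carrier (quot_module M H)"
    then show "\<psi> Y \<in> carrier N"
      using ex h(1) \<psi> by metis
  next
    fix Y Z assume "Y \<in> carrier (quot_module M H)" "Z \<in> carrier (quot_module M H)"
    then obtain a b where "a \<in> carrier M" "Y = ?p a" "b \<in> carrier M" "Z = ?p b"
      using ex by metis
    then show "\<psi> (Y \<oplus>\<^bsub>quot_module M H\<^esub> Z) = \<psi> Y \<oplus>\<^bsub>N\<^esub> \<psi> Z"
      by (simp only: hs \<psi> M.M.a_closed h)
  next
    fix r Y assume r: "r \<in> carrier R" and "Y \<in> carrier (quot_module M H)"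
    then obtain a where "a \<in> carrier M" "Y = ?p a"
      using ex by metis
    with r show "\<psi> (r \<odot>\<^bsub>quot_module M H\<^esub> Y) = r \<odot>\<^bsub>N\<^esub> \<psi> Y"
      by (simp only: hs \<psi> M.smult_closed h)
  qed
  moreover have "bij_betw \<psi> (carrier (quot_module M H)) (carrier N)"
  proof (rule bij_betw_imageI)
    show "inj_on \<psi> (carrier (quot_module M H))"
      by (rule inj_onI) (metis ex \<psi> eqI)
    show "\<psi> ` carrier (quot_module M H) = carrier N"
      unfolding p(3)[symmetric] using sur \<psi> by (force simp: image_image)
  qed
  ultimately show ?thesis
    unfolding mod_isomorphic_def H_def[symmetric] using N p(1) by blast
qed

text \<open>Transport of structure along a linear bijection onto a module. Through this, \<open>V1_module\<close> becomes a
  module without any verification of the defining relations on its basis.\<close>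

lemma mod_isomorphic_transport:
  assumes N: "left_module R N" and bij: "bij_betw \<psi> (carrier Q) (carrier N)"
    and zero: "\<zero>\<^bsub>Q\<^esub> \<in> carrier Q" "\<psi> \<zero>\<^bsub>Q\<^esub> = \<zero>\<^bsub>N\<^esub>"
    and add: "\<And>a b. a \<in> carrier Q \<Longrightarrow> b \<in> carrier Q \<Longrightarrow>
       a \<oplus>\<^bsub>Q\<^esub> b \<in> carrier Q \<and> \<psi> (a \<oplus>\<^bsub>Q\<^esub> b) = \<psi> a \<oplus>\<^bsub>N\<^esub> \<psi> b"
    and smult: "\<And>r a. r \<in> carrier R \<Longrightarrow> a \<in> carrier Q \<Longrightarrow>
       r \<odot>\<^bsub>Q\<^esub> a \<in> carrier Q \<and> \<psi> (r \<odot>\<^bsub>Q\<^esub> a) = r \<odot>\<^bsub>N\<^esub> \<psi> a"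
  shows "mod_isomorphic R N Q"
proof -
  interpret N: left_module R N by fact
  let ?\<phi> = "inv_into (carrier Q) \<psi>"
  have b: "bij_betw ?\<phi> (carrier N) (carrier Q)"
    using bij by (rule bij_betw_inv_into)
  have c: "?\<phi> y \<in> carrier Q" "\<psi> (?\<phi> y) = y" if "y \<in> carrier N" for y
    using that b bij by (auto simp: bij_betw_def bij_betw_inv_into_right f_inv_into_f)
  have e: "?\<phi> (\<psi> x) = x" if "x \<in> carrier Q" for x
    using that bij by (simp add: bij_betw_inv_into_left)
  have hom: "?\<phi> \<in> mod_hom R N Q"
  proof (rule mod_homI)
    fix a b assume "a \<in> carrier N" "b \<in> carrier N"
    then show "?\<phi> (a \<oplus>\<^bsub>N\<^esub> b) = ?\<phi> a \<oplus>\<^bsub>Q\<^esub> ?\<phi> b"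
      using c add[of "?\<phi> a" "?\<phi> b"] e[of "?\<phi> a \<oplus>\<^bsub>Q\<^esub> ?\<phi> b"] by simp
  next
    fix r a assume "r \<in> carrier R" "a \<in> carrier N"
    then show "?\<phi> (r \<odot>\<^bsub>N\<^esub> a) = r \<odot>\<^bsub>Q\<^esub> ?\<phi> a"
      using c smult[of r "?\<phi> a"] e[of "r \<odot>\<^bsub>Q\<^esub> ?\<phi> a"] by simp
  qed (rule c)
  have "?\<phi> \<zero>\<^bsub>N\<^esub> = \<zero>\<^bsub>Q\<^esub>"
    using e[OF zero(1)] zero(2) by simp
  then have "left_module R Q"
    using left_module_image[OF N _ _ hom] b by (simp add: bij_betw_def)
  then show ?thesis
    unfolding mod_isomorphic_def using N hom b by blast
qed

text \<open>Composition series speak of the first step as a quotient by the zero submodule, whose elements are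
  singletons.\<close>

lemma mod_isomorphic_quot_zero:
  assumes M: "left_module R M"
  shows "mod_isomorphic R (quot_module M {\<zero>\<^bsub>M\<^esub>}) M"
proof -
  interpret M: left_module R M by fact
  have "{a \<in> carrier M. (\<lambda>a. a) a = \<zero>\<^bsub>M\<^esub>} = {\<zero>\<^bsub>M\<^esub>}" by auto
  then show ?thesis
    using mod_isomorphic_quot_kernel[OF M M, of "\<lambda>a. a"] by (simp add: mod_homI)
qed

lemma (in ring) left_module_regular: "left_module R (regular_module R)"
proof -
  have "abelian_group (regular_module R)"
  proof (rule abelian_groupI)
    fix x assume "x \<in> carrier (regular_module R)"
    then show "\<exists>y\<in>carrier (regular_module R). y \<oplus>\<^bsub>regular_module R\<^esub> x = \<zero>\<^bsub>regular_module R\<^esub>"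
      using l_neg by (auto simp: regular_module_def)
  qed (auto simp: regular_module_def a_assoc intro: a_comm)
  moreover have "left_module_axioms R (regular_module R)"
    by standard (auto simp: regular_module_def l_distr r_distr m_assoc)
  ultimately show ?thesis
    by (simp add: left_module_def ring_axioms)
qed

section \<open>Free algebras and algebras given by relations\<close>

lemma ring_of_type_algebra_sel [simp]:
  "carrier ring_of_type_algebra = UNIV" "a \<oplus>\<^bsub>ring_of_type_algebra\<^esub> b = a + b"
  "a \<otimes>\<^bsub>ring_of_type_algebra\<^esub> b = a * b" "\<zero>\<^bsub>ring_of_type_algebra\<^esub> = 0"
  "\<one>\<^bsub>ring_of_type_algebra\<^esub> = 1"
  by (simp_all add: ring_of_type_algebra_def)

lemma ring_ring_of_type_algebra: "ring (ring_of_type_algebra :: 'a::ring_1 ring)"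
proof (rule ringI)
  show "abelian_group (ring_of_type_algebra :: 'a ring)"
  proof (rule abelian_groupI)
    fix x :: 'a
    show "\<exists>y\<in>carrier ring_of_type_algebra. y \<oplus>\<^bsub>ring_of_type_algebra\<^esub> x = \<zero>\<^bsub>ring_of_type_algebra\<^esub>"
      by (auto intro: exI[of _ "- x"])
  qed (auto simp: algebra_simps)
  show "Group.monoid (ring_of_type_algebra :: 'a ring)"
    by (rule monoidI) (auto simp: algebra_simps)
qed (auto simp: algebra_simps)

lemma a_inv_ring_of_type_algebra: "\<ominus>\<^bsub>ring_of_type_algebra\<^esub> (a :: 'a::ring_1) = - a"
proof -
  interpret F: ring "ring_of_type_algebra :: 'a ring" by (rule ring_ring_of_type_algebra)
  show ?thesis by (rule F.minus_equality) simp_all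
qed

lemma lookup_cscale [simp]: "Poly_Mapping.lookup (cscale c p) k = c * Poly_Mapping.lookup p k"
  by (simp add: cscale_def Poly_Mapping.map.rep_eq when_def)

lemma cscale_simps [simp]:
  "cscale c 0 = 0" "cscale 0 p = 0" "cscale 1 p = p"
  "cscale c (cscale d p) = cscale (c * d) p"
  "cscale c (Poly_Mapping.single k x) = Poly_Mapping.single k (c * x)"
  by (auto intro!: poly_mapping_eqI simp: lookup_single when_def)

lemma cscale_uminus [simp]: "cscale (- c) a = - cscale c a"
  by (rule poly_mapping_eqI) simp

lemma cscale_add_right: "cscale c (p + r) = cscale c p + cscale c r"
  and cscale_add_left: "cscale (c + d) p = cscale c p + cscale d p"
  and cscale_diff_right: "cscale c (p - r) = cscale c p - cscale c r"
  by (auto intro!: poly_mapping_eqI simp: lookup_add lookup_minus algebra_simps)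

lemma cscale_sum: "cscale c (sum f A) = (\<Sum>i\<in>A. cscale c (f i))"
  by (induction A rule: infinite_finite_induct) (auto simp: cscale_add_right)

lemma poly_mapping_linear_induct [case_names zero single add]:
  assumes "P 0" "\<And>k c. P (Poly_Mapping.single k c)" "\<And>a b. P a \<Longrightarrow> P b \<Longrightarrow> P (a + b)"
  shows "P (h :: 'k \<Rightarrow>\<^sub>0 'b::comm_monoid_add)"
proof -
  have "h = (\<Sum>k\<in>Poly_Mapping.keys h. Poly_Mapping.single k (Poly_Mapping.lookup h k))"
    by (rule poly_mapping_eqI) (auto simp: lookup_sum lookup_single when_def in_keys_iff)
  moreover have "P (\<Sum>k\<in>A. Poly_Mapping.single k (Poly_Mapping.lookup h k))" for A
    by (induction A rule: infinite_finite_induct) (auto intro: assms)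
  ultimately show ?thesis
    by metis
qed

lemma fmon_single_mult:
  "Poly_Mapping.single (FMon v) a * Poly_Mapping.single (FMon w) b =
     Poly_Mapping.single (FMon (v @ w)) (a * b :: complex)"
  by (simp add: mult_single plus_fmon_def)

lemma one_free: "(1 :: 'g free) = Poly_Mapping.single (FMon []) 1"
  by (metis single_one zero_fmon_def)

lemma cscale_mult_left: "cscale c a * (b :: 'g free) = cscale c (a * b)"
  and cscale_mult_right: "a * cscale c (b :: 'g free) = cscale c (a * b)"
proof -
  show "cscale c a * b = cscale c (a * b)"
    by (simp add: cscale_def mult_map_scale_conv_mult mult.assoc)
  show "a * cscale c b = cscale c (a * b)"
  proof (induction a rule: poly_mapping_linear_induct)
    case (single v x)
    show ?case
    proof (induction b rule: poly_mapping_linear_induct)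
      case (single w y)
      show ?case
        by (cases v; cases w) (simp add: fmon_single_mult mult_ac)
    qed (auto simp: cscale_add_right distrib_left)
  qed (auto simp: cscale_add_right distrib_right)
qed

text \<open>Properties of the free algebra are proved by left multiplication with generators. That is the form
  in which actions and left ideals are given.\<close>

lemma free_induct [case_names zero one add scale gen]:
  assumes "P 0" "P 1" "\<And>a b. P a \<Longrightarrow> P b \<Longrightarrow> P (a + b)" "\<And>c a. P a \<Longrightarrow> P (cscale c a)"
    and "\<And>g a. P a \<Longrightarrow> P (gen g * a)"
  shows "P (h :: 'g free)"
proof (induction h rule: poly_mapping_linear_induct)
  case (single k c)
  have "P (Poly_Mapping.single (FMon w) 1)" for w
  proof (induction w)
    case (Cons g w)
    then have "P (gen g * Poly_Mapping.single (FMon w) 1)"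
      by (rule assms)
    then show ?case
      by (simp add: gen_def fmon_single_mult)
  qed (simp add: one_free[symmetric] assms)
  then have "P (cscale c (Poly_Mapping.single k 1))"
    by (cases k) (simp add: assms(4) del: cscale_simps)
  then show ?case by simp
qed (rule assms; assumption)+

subsection \<open>Actions of the free algebra\<close>

text \<open>The action of the free algebra in which the generator \<open>g\<close> acts by \<open>\<phi> g\<close>. The constant
  \<open>V1_free\<close> is an instance.\<close>

definition free_act ::
    "(complex \<Rightarrow> 'v \<Rightarrow> 'v) \<Rightarrow> ('g \<Rightarrow> 'v \<Rightarrow> 'v) \<Rightarrow> 'g free \<Rightarrow> 'v \<Rightarrow> 'v::ab_group_add" where
  "free_act sc \<phi> h v =
    (\<Sum>w\<in>Poly_Mapping.keys h. sc (Poly_Mapping.lookup h w) (foldr \<phi> (letters w) v))"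

locale free_action =
  fixes sc :: "complex \<Rightarrow> 'v::ab_group_add \<Rightarrow> 'v" and \<phi> :: "'g \<Rightarrow> 'v \<Rightarrow> 'v"
  assumes vector_space: "vector_space sc"
    and gen_add: "\<And>g v w. \<phi> g (v + w) = \<phi> g v + \<phi> g w"
    and gen_scale: "\<And>g c v. \<phi> g (sc c v) = sc c (\<phi> g v)"
begin

interpretation vector_space sc by (rule vector_space)

abbreviation act where "act \<equiv> free_act sc \<phi>"

lemma gen_zero: "\<phi> g 0 = 0"
  using gen_scale[of g 0 0] by simp

lemma act_add: "act (a + b) v = act a v + act b v"
  unfolding free_act_def
  by (rule setsum_keys_plus_distrib) (auto simp: scale_left_distrib)

lemma act_zero [simp]: "act 0 v = 0"
  by (simp add: free_act_def)

lemma act_single: "act (Poly_Mapping.single w c) v = sc c (foldr \<phi> (letters w) v)"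
  by (cases "c = 0") (auto simp: free_act_def)

lemma act_one [simp]: "act 1 v = v"
  by (simp add: one_free act_single)

lemma act_scale: "act (cscale c h) v = sc c (act h v)"
  by (induction h rule: poly_mapping_linear_induct)
    (auto simp: act_single act_add cscale_add_right scale_right_distrib)

lemma act_gen_mult: "act (gen g * h) v = \<phi> g (act h v)"
proof (induction h rule: poly_mapping_linear_induct)
  case (single w c)
  show ?case
    by (cases w) (simp add: gen_def fmon_single_mult act_single gen_scale)
qed (auto simp: gen_zero act_add gen_add distrib_left)

lemma act_mult: "act (a * b) v = act a (act b v)"
  by (induction a rule: free_induct)
    (auto simp: act_add distrib_right act_scale cscale_mult_left act_gen_mult mult.assoc)

lemma act_gen: "act (gen g) v = \<phi> g v"
  using act_gen_mult[of g 1 v] by simp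

lemma act_zero_right [simp]: "act h 0 = 0"
  by (induction h rule: free_induct) (auto simp: act_add act_scale act_gen_mult gen_zero)

lemma act_minus: "act (a - b) v = act a v - act b v"
  using act_add[of "a - b" b v] by simp

text \<open>The elements that act as zero form a two-sided ideal.\<close>

lemma act_rel_ideal:
  assumes S: "\<And>r v. r \<in> S \<Longrightarrow> act r v = 0" and h: "h \<in> rel_ideal S"
  shows "act h v = 0"
proof -
  interpret F: ring "ring_of_type_algebra :: 'g free ring"
    by (rule ring_ring_of_type_algebra)
  let ?K = "{h :: 'g free. \<forall>v. act h v = 0}"
  have "ideal ?K ring_of_type_algebra"
  proof (rule idealI)
    show "subgroup ?K (add_monoid ring_of_type_algebra)"
    proof
      fix a assume "a \<in> ?K"
      then show "inv\<^bsub>add_monoid ring_of_type_algebra\<^esub> a \<in> ?K"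
        using act_minus[of 0 a] a_inv_ring_of_type_algebra[of a] by (simp add: a_inv_def)
    qed (auto simp: act_add)
  qed (auto simp: act_mult F.ring_axioms)
  then have "rel_ideal S \<subseteq> ?K"
    unfolding rel_ideal_def using S by (intro F.genideal_minimal) auto
  then show ?thesis
    using h by auto
qed

end

subsection \<open>The projection onto a presented algebra\<close>

lemma ideal_rel_ideal: "ideal (rel_ideal S) ring_of_type_algebra"
  unfolding rel_ideal_def by (intro ring.genideal_ideal[OF ring_ring_of_type_algebra]) simp

lemma rel_ideal_closed:
  shows "S \<subseteq> rel_ideal S" "0 \<in> rel_ideal S"
    and "a \<in> rel_ideal S \<Longrightarrow> b \<in> rel_ideal S \<Longrightarrow> a + b \<in> rel_ideal S"
    and "a \<in> rel_ideal S \<Longrightarrow> - a \<in> rel_ideal S"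
    and "a \<in> rel_ideal S \<Longrightarrow> x * a \<in> rel_ideal S"
    and "a \<in> rel_ideal S \<Longrightarrow> a * x \<in> rel_ideal S"
    and "a \<in> rel_ideal S \<Longrightarrow> cscale c a \<in> rel_ideal S"
proof -
  interpret F: ring "ring_of_type_algebra :: 'a free ring" by (rule ring_ring_of_type_algebra)
  interpret I: ideal "rel_ideal S" "ring_of_type_algebra :: 'a free ring" by (rule ideal_rel_ideal)
  show "S \<subseteq> rel_ideal S"
    unfolding rel_ideal_def by (rule F.genideal_self) simp
  show "0 \<in> rel_ideal S"
    using I.zero_closed by simp
  show "a \<in> rel_ideal S \<Longrightarrow> b \<in> rel_ideal S \<Longrightarrow> a + b \<in> rel_ideal S"
    using I.a_closed by simp
  show "a \<in> rel_ideal S \<Longrightarrow> - a \<in> rel_ideal S"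
    using I.a_inv_closed[of a] by (simp add: a_inv_ring_of_type_algebra)
  show l: "a \<in> rel_ideal S \<Longrightarrow> x * a \<in> rel_ideal S" for x
    using I.I_l_closed[of a x] by simp
  show "a \<in> rel_ideal S \<Longrightarrow> a * x \<in> rel_ideal S"
    using I.I_r_closed[of a x] by simp
  show "a \<in> rel_ideal S \<Longrightarrow> cscale c a \<in> rel_ideal S"
    using l[of "cscale c 1"] by (simp add: cscale_mult_left)
qed

lemma mem_cls_iff: "x \<in> cls S y \<longleftrightarrow> x - y \<in> rel_ideal S"
  unfolding cls_def a_r_coset_def' by (auto intro: bexI[of _ "x - y"])

lemma cls_eq_iff: "cls S a = cls S b \<longleftrightarrow> a - b \<in> rel_ideal S"
proof -
  interpret F: ring "ring_of_type_algebra :: 'a free ring" by (rule ring_ring_of_type_algebra)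
  interpret I: ideal "rel_ideal S" "ring_of_type_algebra :: 'a free ring" by (rule ideal_rel_ideal)
  show ?thesis
  proof
    assume "cls S a = cls S b"
    then show "a - b \<in> rel_ideal S"
      using mem_cls_iff[of a S a] mem_cls_iff[of a S b] rel_ideal_closed(2)[of S] by simp
  next
    assume ab: "a - b \<in> rel_ideal S"
    have "x \<in> cls S a \<longleftrightarrow> x \<in> cls S b" for x
    proof -
      have "x - b = (x - a) + (a - b)" "x - a = (x - b) + - (a - b)" by simp_all
      then show ?thesis
        unfolding mem_cls_iff using ab rel_ideal_closed(3,4) by metis
    qed
    then show "cls S a = cls S b" by blast
  qed
qed

lemma cls_eq_if_mem: "x \<in> cls S y \<Longrightarrow> cls S x = cls S y"
  by (simp add: mem_cls_iff cls_eq_iff)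

lemma mem_cls_self: "x \<in> cls S x"
  by (simp add: mem_cls_iff rel_ideal_closed)

text \<open>These equations turn computations with cosets into computations with representatives: \<open>cls\<close> is a
  homomorphism from the free algebra onto the presented one.\<close>

lemma presented_algebra_sel [simp]:
  fixes S :: "'g free set"
  shows "carrier (presented_algebra S) = range (cls S)"
    and "\<zero>\<^bsub>presented_algebra S\<^esub> = cls S 0" "\<one>\<^bsub>presented_algebra S\<^esub> = cls S 1"
    and "cls S a \<oplus>\<^bsub>presented_algebra S\<^esub> cls S b = cls S (a + b)"
    and "cls S a \<otimes>\<^bsub>presented_algebra S\<^esub> cls S b = cls S (a * b)"
    and "c \<odot>\<^bsub>presented_algebra S\<^esub> cls S a = cls S (cscale c a)"
proof -
  let ?F = "ring_of_type_algebra :: 'g free ring"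
  interpret F: ring ?F by (rule ring_ring_of_type_algebra)
  interpret I: ideal "rel_ideal S" ?F by (rule ideal_rel_ideal)
  note hom = I.rcos_ring_hom
  show "carrier (presented_algebra S) = range (cls S)"
    by (auto simp: presented_algebra_def FactRing_def A_RCOSETS_def' cls_def)
  show "\<zero>\<^bsub>presented_algebra S\<^esub> = cls S 0"
    using F.a_coset_add_zero[of "rel_ideal S"]
    by (simp add: presented_algebra_def FactRing_def cls_def)
  show "\<one>\<^bsub>presented_algebra S\<^esub> = cls S 1"
    by (simp add: presented_algebra_def FactRing_def cls_def)
  show "cls S a \<oplus>\<^bsub>presented_algebra S\<^esub> cls S b = cls S (a + b)"
    using ring_hom_add[OF hom, of a b] by (simp add: presented_algebra_def cls_def Let_def)
  show "cls S a \<otimes>\<^bsub>presented_algebra S\<^esub> cls S b = cls S (a * b)"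
    using ring_hom_mult[OF hom, of a b] by (simp add: presented_algebra_def cls_def Let_def)
  have self: "a \<in> cls S a"
    unfolding cls_def by (rule I.a_rcos_self) simp
  have "cls S (cscale c x) = cls S (cscale c a)" if "x \<in> cls S a" for x
  proof -
    have "x - a \<in> rel_ideal S"
      using that unfolding cls_def a_r_coset_def' by auto
    then show ?thesis
      unfolding cls_eq_iff cscale_diff_right[symmetric] by (rule rel_ideal_closed)
  qed
  moreover have "cls S a \<noteq> {}" using self by blast
  ultimately have "(\<Union>x\<in>cls S a. cls S (cscale c x)) = cls S (cscale c a)"
    by (rule SUP_eq_const[rotated])
  then show "c \<odot>\<^bsub>presented_algebra S\<^esub> cls S a = cls S (cscale c a)"
    by (simp add: presented_algebra_def Let_def)
qed

lemma ring_presented_algebra: "ring (presented_algebra S)"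
proof (rule ringI)
  show "abelian_group (presented_algebra S)"
  proof (rule abelian_groupI)
    fix x assume "x \<in> carrier (presented_algebra S)"
    then obtain a where "x = cls S a" by auto
    then have "cls S (- a) \<oplus>\<^bsub>presented_algebra S\<^esub> x = \<zero>\<^bsub>presented_algebra S\<^esub>" by simp
    then show "\<exists>y\<in>carrier (presented_algebra S). y \<oplus>\<^bsub>presented_algebra S\<^esub> x = \<zero>\<^bsub>presented_algebra S\<^esub>"
      by auto
  qed (auto simp: algebra_simps)
  show "Group.monoid (presented_algebra S)"
    by (rule monoidI) (auto simp: mult.assoc)
qed (auto simp: distrib_left distrib_right)

lemma left_module_CC_presented_algebra: "left_module CC (presented_algebra S)"
proof -
  interpret A: ring "presented_algebra S" by (rule ring_presented_algebra)
  have "left_module_axioms CC (presented_algebra S)"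
    by standard (auto simp: cscale_add_left cscale_add_right)
  then show ?thesis
    by (simp add: left_module_def ring_ring_of_type_algebra A.abelian_group_axioms)
qed

lemma cls_pow: "cls S a [^]\<^bsub>presented_algebra S\<^esub> (n::nat) = cls S (a ^ n)"
proof -
  interpret A: ring "presented_algebra S" by (rule ring_presented_algebra)
  show ?thesis
    by (induction n) (simp_all add: power_Suc2 del: power_Suc)
qed

lemma cls_rel: "a - b \<in> S \<Longrightarrow> cls S a = cls S b"
  using rel_ideal_closed(1) by (auto simp: cls_eq_iff)

lemma cls_cong:
  assumes "cls S a = cls S a'"
  shows cls_cong_add: "cls S b = cls S b' \<Longrightarrow> cls S (a + b) = cls S (a' + b')"
    and cls_cong_mult: "cls S b = cls S b' \<Longrightarrow> cls S (a * b) = cls S (a' * b')"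
    and cls_cong_scale: "cls S (cscale c a) = cls S (cscale c a')"
  using assms presented_algebra_sel(4-6)[of S] by metis+

lemma finsum_additive:
  assumes "abelian_group G" and "finite A" and "\<iota> 0 = \<zero>\<^bsub>G\<^esub>"
    and "\<And>a b. \<iota> (a + b) = \<iota> a \<oplus>\<^bsub>G\<^esub> \<iota> b" and "\<And>i. i \<in> A \<Longrightarrow> \<iota> (f i) \<in> carrier G"
  shows "(\<Oplus>\<^bsub>G\<^esub>i\<in>A. \<iota> (f i)) = \<iota> (sum f A)"
proof -
  interpret G: abelian_group G by fact
  show ?thesis
    using assms(2,5) by (induction A rule: finite_induct) (auto simp: assms(3,4) G.finsum_insert)
qed

subsection \<open>Polynomials in an element of the free algebra\<close>

definition peval :: "'g free \<Rightarrow> complex poly \<Rightarrow> 'g free" where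
  "peval g p = (\<Sum>i\<le>Polynomial.degree p. cscale (Polynomial.coeff p i) (g ^ i))"

lemma peval_eq_sum:
  assumes "Polynomial.degree p \<le> N"
  shows "peval g p = (\<Sum>i\<le>N. cscale (Polynomial.coeff p i) (g ^ i))"
  unfolding peval_def using assms
  by (intro sum.mono_neutral_left) (auto simp: Polynomial.coeff_eq_0)

lemma peval_0 [simp]: "peval g 0 = 0"
  by (simp add: peval_def)

lemma peval_add: "peval g (p + r) = peval g p + peval g r"
proof -
  let ?N = "max (Polynomial.degree p) (Polynomial.degree r)"
  show ?thesis
    using peval_eq_sum[of p ?N g] peval_eq_sum[of r ?N g]
      peval_eq_sum[of "p + r" ?N g, OF Polynomial.degree_add_le_max]
    by (simp add: sum.distrib cscale_add_left)
qed

lemma peval_smult: "peval g (Polynomial.smult c p) = cscale c (peval g p)"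
  using peval_eq_sum[of "Polynomial.smult c p" "Polynomial.degree p" g, OF Polynomial.degree_smult_le]
  by (simp add: peval_def cscale_sum)

lemma peval_pCons: "peval g (pCons a p) = cscale a 1 + g * peval g p"
proof -
  have "peval g (pCons a p) =
      (\<Sum>i\<le>Suc (Polynomial.degree p). cscale (Polynomial.coeff (pCons a p) i) (g ^ i))"
    by (rule peval_eq_sum) (rule Polynomial.degree_pCons_le)
  also have "\<dots> = cscale a 1 + (\<Sum>i\<le>Polynomial.degree p. g * cscale (Polynomial.coeff p i) (g ^ i))"
    by (simp add: sum.atMost_Suc_shift cscale_mult_right del: sum.atMost_Suc)
  also have "\<dots> = cscale a 1 + g * peval g p"
    by (simp add: peval_def sum_distrib_left)
  finally show ?thesis .
qed

lemma peval_monom: "peval g (Polynomial.monom c i) = cscale c (g ^ i)"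
  by (induction i) (simp_all add: Polynomial.monom_0 Polynomial.monom_Suc peval_pCons cscale_mult_right)

section \<open>A normal form on the quantum plane\<close>

text \<open>The type \<open>complex poly poly\<close> models the sums of \<open>p\<^sub>n(x) y\<^sup>n\<close>, with \<open>y\<close> as the outer variable. The
  two maps are the left multiplications: moving \<open>y\<close> past \<open>p(x)\<close> turns it into \<open>p(qx)\<close>.\<close>

fun qp_act :: "complex \<Rightarrow> qp_gen \<Rightarrow> complex poly poly \<Rightarrow> complex poly poly" where
  "qp_act q Gx P = Polynomial.smult [:0, 1:] P"
| "qp_act q Gy P = pCons 0 (map_poly (\<lambda>p. pcompose p [:0, q:]) P)"

abbreviation "cx_smult \<equiv> \<lambda>c. Polynomial.smult [:c :: complex:]"

lemma map_poly_pcompose_coeff [simp]: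
  "Polynomial.coeff (map_poly (\<lambda>p. pcompose p r) P) n = pcompose (Polynomial.coeff P n) r"
  by (simp add: coeff_map_poly)

interpretation qp: free_action cx_smult "qp_act q" for q
proof
  fix g c P R
  show "qp_act q g (P + R) = qp_act q g P + qp_act q g R"
    by (cases g) (auto intro!: poly_eqI simp: smult_add_right pcompose_add coeff_pCons split: nat.splits)
  show "qp_act q g (cx_smult c P) = cx_smult c (qp_act q g P)"
    by (cases g) (auto intro!: poly_eqI simp: pcompose_smult coeff_pCons split: nat.splits)
qed (auto simp: smult_add_right smult_add_left[symmetric] one_pCons[symmetric] mult.commute)

definition qp_coord :: "complex \<Rightarrow> qp_gen free \<Rightarrow> complex poly poly" where
  "qp_coord q h = free_act cx_smult (qp_act q) h 1"

text \<open>The relation \<open>yx = qxy\<close> acts as zero, so the coordinates are well defined on the quantum plane.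
  This is the linear independence of the monomials.\<close>

lemma qp_coord_cls:
  assumes "cls (qp_rels q) a = cls (qp_rels q) b"
  shows "qp_coord q a = qp_coord q b"
proof -
  have "free_act cx_smult (qp_act q) (a - b) 1 = 0"
  proof (rule qp.act_rel_ideal)
    show "a - b \<in> rel_ideal (qp_rels q)"
      using assms by (simp add: cls_eq_iff)
    fix r P assume "r \<in> qp_rels q"
    then have "free_act cx_smult (qp_act q) r P =
        qp_act q Gy (qp_act q Gx P) - cx_smult q (qp_act q Gx (qp_act q Gy P))"
      by (simp add: qp_rels_def qp.act_minus qp.act_scale qp.act_gen_mult qp.act_gen)
    also have "\<dots> = 0"
      by (auto intro!: poly_eqI simp: coeff_pCons pcompose_mult pcompose_pCons mult.assoc[symmetric]
          split: nat.splits)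
    finally show "free_act cx_smult (qp_act q) r P = 0" .
  qed
  then show ?thesis
    by (simp add: qp_coord_def qp.act_minus)
qed

lemma qp_coord_add: "qp_coord q (a + b) = qp_coord q a + qp_coord q b"
  by (simp add: qp_coord_def qp.act_add)

lemma qp_coord_sum: "qp_coord q (sum f A) = (\<Sum>i\<in>A. qp_coord q (f i))"
  by (induction A rule: infinite_finite_induct) (auto simp: qp_coord_add, simp_all add: qp_coord_def)

lemma qp_coord_peval: "qp_coord q (peval (gen Gx) p * gen Gy ^ n) = Polynomial.monom p n"
proof -
  have x: "free_act cx_smult (qp_act q) (peval (gen Gx) p) P = Polynomial.smult p P" for P
    by (induction p) (auto simp: peval_pCons qp.act_add qp.act_scale qp.act_gen_mult smult_add_left[symmetric])
  have "free_act cx_smult (qp_act q) (gen Gy ^ n) 1 = Polynomial.monom 1 n"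
    by (induction n)
      (auto simp: qp.act_gen_mult Polynomial.monom_Suc map_poly_monom Polynomial.monom_0 pcompose_1)
  then show ?thesis
    by (simp add: qp_coord_def qp.act_mult x smult_monom)
qed

definition qp_normal :: "complex poly poly \<Rightarrow> qp_gen free" where
  "qp_normal P = (\<Sum>n\<le>Polynomial.degree P. peval (gen Gx) (Polynomial.coeff P n) * gen Gy ^ n)"

lemma qp_normal_eq_sum:
  assumes "Polynomial.degree P \<le> N"
  shows "qp_normal P = (\<Sum>n\<le>N. peval (gen Gx) (Polynomial.coeff P n) * gen Gy ^ n)"
  unfolding qp_normal_def using assms
  by (intro sum.mono_neutral_left) (auto simp: Polynomial.coeff_eq_0)

lemma qp_normal_add: "qp_normal (P + R) = qp_normal P + qp_normal R"
proof -
  let ?N = "max (Polynomial.degree P) (Polynomial.degree R)"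
  show ?thesis
    using qp_normal_eq_sum[of P ?N] qp_normal_eq_sum[of R ?N]
      qp_normal_eq_sum[of "P + R" ?N, OF Polynomial.degree_add_le_max]
    by (simp add: sum.distrib peval_add distrib_right)
qed

lemma qp_normal_scale: "qp_normal (cx_smult c P) = cscale c (qp_normal P)"
  using qp_normal_eq_sum[of "cx_smult c P" "Polynomial.degree P", OF Polynomial.degree_smult_le]
  by (simp add: qp_normal_def cscale_sum peval_smult cscale_mult_left)

lemma qp_normal_pCons: "qp_normal (pCons p P) = peval (gen Gx) p + qp_normal P * gen Gy"
proof -
  have "qp_normal (pCons p P) = (\<Sum>n\<le>Suc (Polynomial.degree P).
      peval (gen Gx) (Polynomial.coeff (pCons p P) n) * gen Gy ^ n)"
    by (rule qp_normal_eq_sum) (rule Polynomial.degree_pCons_le)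
  also have "\<dots> = peval (gen Gx) p + qp_normal P * gen Gy"
    by (simp add: sum.atMost_Suc_shift qp_normal_def sum_distrib_right mult.assoc power_Suc2
        del: sum.atMost_Suc power_Suc)
  finally show ?thesis .
qed

lemma qp_normal_0 [simp]: "qp_normal 0 = 0"
  by (simp add: qp_normal_def)

lemma cls_y_peval:
  "cls (qp_rels q) (gen Gy * peval (gen Gx) p) =
     cls (qp_rels q) (peval (gen Gx) (pcompose p [:0, q:]) * gen Gy)"
proof (induction p)
  case (pCons a p)
  let ?c = "cls (qp_rels q)" and ?x = "gen Gx" and ?y = "gen Gy"
  let ?p = "peval ?x p" and ?p' = "peval ?x (pcompose p [:0, q:])"
  have yx: "?c (?y * ?x) = ?c (cscale q (?x * ?y))"
    by (rule cls_rel) (simp add: qp_rels_def)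
  have "?c (?y * (?x * ?p)) = ?c (cscale q (?x * (?y * ?p)))"
    using cls_cong_mult[OF yx refl, of ?p] by (simp add: mult.assoc cscale_mult_left)
  also have "\<dots> = ?c (cscale q (?x * (?p' * ?y)))"
    by (intro cls_cong_scale cls_cong_mult refl pCons.IH)
  finally have "?c (cscale a ?y + ?y * (?x * ?p)) = ?c (cscale a ?y + cscale q (?x * (?p' * ?y)))"
    by (intro cls_cong_add refl)
  then show ?case
    by (simp add: peval_pCons pcompose_pCons peval_add peval_smult algebra_simps cscale_mult_left
        cscale_mult_right)
qed simp

lemma qp_normal_y:
  "cls (qp_rels q) (gen Gy * qp_normal P) = cls (qp_rels q) (qp_normal (qp_act q Gy P))"
proof (induction P)
  case (pCons p P)
  have "cls (qp_rels q) (gen Gy * peval (gen Gx) p + gen Gy * qp_normal P * gen Gy) =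
      cls (qp_rels q) (peval (gen Gx) (pcompose p [:0, q:]) * gen Gy +
        qp_normal (qp_act q Gy P) * gen Gy)"
    by (intro cls_cong_add cls_cong_mult cls_y_peval pCons.IH refl)
  then show ?case
    using pCons.hyps by (simp add: qp_normal_pCons map_poly_pCons algebra_simps)
qed simp

lemma qp_normal_x: "gen Gx * qp_normal P = qp_normal (qp_act q Gx P)"
  by (induction P) (simp_all add: qp_normal_pCons peval_pCons distrib_left mult.assoc[symmetric])

text \<open>Every element of the quantum plane has a normal form, and \<open>qp_coord\<close> shows that it is unique.\<close>

lemma cls_qp_normal: "cls (qp_rels q) h = cls (qp_rels q) (qp_normal (qp_coord q h))"
proof (induction h rule: free_induct)
  case one
  show ?case
    by (simp add: qp_coord_def qp_normal_pCons peval_pCons one_pCons)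
next
  case (add a b)
  show ?case
    unfolding qp_coord_add qp_normal_add by (intro cls_cong_add add.IH)
next
  case (scale c a)
  have "qp_coord q (cscale c a) = cx_smult c (qp_coord q a)"
    by (simp add: qp_coord_def qp.act_scale)
  then show ?case
    by (simp only: qp_normal_scale cls_cong_scale[OF scale.IH])
next
  case (gen g a)
  have "cls (qp_rels q) (gen g * a) = cls (qp_rels q) (gen g * qp_normal (qp_coord q a))"
    by (intro cls_cong_mult refl gen.IH)
  also have "\<dots> = cls (qp_rels q) (qp_normal (qp_act q g (qp_coord q a)))"
    by (cases g) (simp_all only: qp_normal_x[of _ q] qp_normal_y)
  finally show ?case
    by (simp only: qp_coord_def qp.act_gen_mult)
qed (simp add: qp_coord_def)

text \<open>The element \<open>p(x) y\<^sup>n\<close>. For fixed \<open>n\<close> this identifies \<open>\<complex>[x]y\<^sup>n\<close> with the type of polynomials.\<close>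

definition qvec :: "complex \<Rightarrow> nat \<Rightarrow> complex poly \<Rightarrow> qp_gen free set" where
  "qvec q n p = cls (qp_rels q) (peval (gen Gx) p * gen Gy ^ n)"

lemma qplane_sel [simp]:
  "carrier (qplane q) = range (cls (qp_rels q))"
  "\<zero>\<^bsub>qplane q\<^esub> = cls (qp_rels q) 0" "\<one>\<^bsub>qplane q\<^esub> = cls (qp_rels q) 1"
  "cls (qp_rels q) a \<oplus>\<^bsub>qplane q\<^esub> cls (qp_rels q) b = cls (qp_rels q) (a + b)"
  "cls (qp_rels q) a \<otimes>\<^bsub>qplane q\<^esub> cls (qp_rels q) b = cls (qp_rels q) (a * b)"
  "c \<odot>\<^bsub>qplane q\<^esub> cls (qp_rels q) a = cls (qp_rels q) (cscale c a)"
  "cls (qp_rels q) a [^]\<^bsub>qplane q\<^esub> (n::nat) = cls (qp_rels q) (a ^ n)"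
  by (simp_all add: qplane_def cls_pow)

lemma left_module_qplane: "left_module CC (qplane q)"
  unfolding qplane_def by (rule left_module_CC_presented_algebra)

lemma qvec_carrier [simp]: "qvec q n p \<in> carrier (qplane q)"
  by (simp add: qvec_def)

lemma qvec_zero: "qvec q n 0 = \<zero>\<^bsub>qplane q\<^esub>"
  by (simp add: qvec_def)

lemma qvec_add: "qvec q n (p + r) = qvec q n p \<oplus>\<^bsub>qplane q\<^esub> qvec q n r"
  by (simp add: qvec_def peval_add distrib_right)

lemma qvec_smult: "qvec q n (Polynomial.smult c p) = c \<odot>\<^bsub>qplane q\<^esub> qvec q n p"
  by (simp add: qvec_def peval_smult cscale_mult_left)

lemma qvec_inject: "qvec q n p = qvec q n r \<longleftrightarrow> p = r"
  unfolding qvec_def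
  by (metis qp_coord_cls qp_coord_peval Polynomial.coeff_monom)

lemma qmonom_eq: "qmonom q i n = qvec q n (Polynomial.monom 1 i)"
  by (simp add: qmonom_def qx_def qy_def qvec_def peval_monom)

lemma qy_pow_eq: "qy q [^]\<^bsub>qplane q\<^esub> (n::nat) = qvec q n 1"
  by (simp add: qy_def qvec_def one_pCons peval_pCons)

text \<open>The common computation of \<open>\<complex>[x]\<close> (all \<open>i\<close>) and of the span of \<open>y\<^sup>n, \<dots>, x\<^sup>n y\<^sup>n\<close> (\<open>i \<le> n\<close>).\<close>

lemma qvec_span:
  assumes S: "S = qvec q n ` {p. \<forall>i. Polynomial.coeff p i \<noteq> 0 \<longrightarrow> I i}"
    and G: "G = {qvec q n (Polynomial.monom 1 i) | i. I i}"
  shows "gen_submodule CC (qplane q) G = S"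
proof
  interpret A: left_module CC "qplane q" by (rule left_module_qplane)
  have sub: "submodule S CC (qplane q)"
  proof (rule A.submoduleI)
    show "\<zero>\<^bsub>qplane q\<^esub> \<in> S"
      unfolding S by (rule image_eqI[of _ _ 0]) (simp_all add: qvec_zero)
  next
    fix a b assume "a \<in> S" "b \<in> S"
    then obtain p r where *: "a = qvec q n p" "\<forall>i. Polynomial.coeff p i \<noteq> 0 \<longrightarrow> I i"
      "b = qvec q n r" "\<forall>i. Polynomial.coeff r i \<noteq> 0 \<longrightarrow> I i"
      unfolding S by auto
    show "a \<oplus>\<^bsub>qplane q\<^esub> b \<in> S"
      unfolding S *(1,3) qvec_add[symmetric] using *(2,4)
      by (intro imageI CollectI allI impI) (metis Polynomial.coeff_add add_0)
  next
    fix c a assume "a \<in> S"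
    then obtain p where *: "a = qvec q n p" "\<forall>i. Polynomial.coeff p i \<noteq> 0 \<longrightarrow> I i"
      unfolding S by auto
    show "c \<odot>\<^bsub>qplane q\<^esub> a \<in> S"
      unfolding S *(1) qvec_smult[symmetric] using *(2)
      by (intro imageI CollectI allI impI) auto
  qed (use S in \<open>auto simp del: qplane_sel\<close>)
  have "G \<subseteq> S"
    unfolding S G by auto
  then show "gen_submodule CC (qplane q) G \<subseteq> S"
    by (rule gen_submodule_least[OF sub])
  have "qvec q n p \<in> H"
    if H: "submodule H CC (qplane q)" "G \<subseteq> H" and p: "\<forall>i. Polynomial.coeff p i \<noteq> 0 \<longrightarrow> I i" for H p
  proof -
    note h = A.submoduleD[OF H(1)]
    have mono: "qvec q n (Polynomial.monom (Polynomial.coeff p i) i) \<in> H" for i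
    proof (cases "Polynomial.coeff p i = 0")
      case True
      then show ?thesis using h(2) by (simp add: qvec_zero)
    next
      case False
      then have "qvec q n (Polynomial.monom 1 i) \<in> H"
        using H(2) p unfolding G by auto
      then have "Polynomial.coeff p i \<odot>\<^bsub>qplane q\<^esub> qvec q n (Polynomial.monom 1 i) \<in> H"
        using h(4) by simp
      then show ?thesis
        by (simp add: qvec_smult[symmetric] smult_monom)
    qed
    have "qvec q n (\<Sum>i\<in>A. Polynomial.monom (Polynomial.coeff p i) i) \<in> H" for A
      by (induction A rule: infinite_finite_induct)
        (use h(2,3) mono in \<open>auto simp: qvec_zero qvec_add\<close>)
    then show ?thesis
      using poly_as_sum_of_monoms[of p] by metis
  qed
  then show "S \<subseteq> gen_submodule CC (qplane q) G"
    unfolding gen_submodule_def S by blast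
qed

lemma Jset_eq: "Jset q n = qvec q n ` {p. \<forall>i. Polynomial.coeff p i \<noteq> 0 \<longrightarrow> i \<le> n}"
  unfolding Jset_def by (rule qvec_span[OF refl]) (simp add: qmonom_eq)

lemma Vset_eq: "Vset q n = range (qvec q n)"
proof -
  have "{qx q [^]\<^bsub>qplane q\<^esub> p | p::nat. True} = {qvec q 0 (Polynomial.monom 1 i) | i. True}"
    by (simp add: qx_def qvec_def peval_monom)
  then have "Cx q = range (qvec q 0)"
    unfolding Cx_def by (subst qvec_span[OF refl]) auto
  then show ?thesis
    unfolding Vset_def qvec_def qy_def by (auto simp: image_iff) (metis qplane_sel(5))
qed

lemma has_dimension_Jset:
  "has_dimension CC (restr_module (qplane q) (Jset q n)) (n + 1)"
proof -
  let ?J = "restr_module (qplane q) (Jset q n)"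
  have J: "left_module CC ?J"
  proof (rule left_module_restr[OF left_module_qplane])
    interpret A: left_module CC "qplane q" by (rule left_module_qplane)
    show "submodule (Jset q n) CC (qplane q)"
      unfolding Jset_def by (rule A.submodule_gen_submodule) (auto simp: qmonom_eq simp del: qplane_sel)
  qed
  interpret J: left_module CC ?J by (rule J)
  let ?b = "\<lambda>i. qvec q n (Polynomial.monom 1 i)"
  have comb: "(\<Oplus>\<^bsub>?J\<^esub>i\<in>{..<n+1}. c i \<odot>\<^bsub>?J\<^esub> ?b i) =
      qvec q n (\<Sum>i<n+1. Polynomial.monom (c i) i)" for c
  proof -
    have "(\<Oplus>\<^bsub>?J\<^esub>i\<in>{..<n+1}. qvec q n (Polynomial.monom (c i) i)) =
      qvec q n (\<Sum>i<n+1. Polynomial.monom (c i) i)"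
      by (rule finsum_additive) (use J.M.abelian_group_axioms in \<open>auto simp: qvec_zero qvec_add Jset_eq simp del: qplane_sel\<close>)
    then show ?thesis
      by (simp add: qvec_smult[symmetric] smult_monom)
  qed
  have cf: "Polynomial.coeff (\<Sum>i<n+1. Polynomial.monom (c i) i) j = (if j \<le> n then c j else 0)"
    for c :: "nat \<Rightarrow> complex" and j
    by (auto simp: Polynomial.coeff_sum)
  have "\<exists>!c. c \<in> {..<n+1} \<rightarrow>\<^sub>E carrier CC \<and> v = (\<Oplus>\<^bsub>?J\<^esub>i\<in>{..<n+1}. c i \<odot>\<^bsub>?J\<^esub> ?b i)"
    if v: "v \<in> carrier ?J" for v
  proof -
    obtain p where p: "v = qvec q n p" "\<And>i. Polynomial.coeff p i \<noteq> 0 \<Longrightarrow> i \<le> n"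
      using v unfolding restr_module_sel Jset_eq by blast
    have iff: "v = (\<Oplus>\<^bsub>?J\<^esub>i\<in>{..<n+1}. c i \<odot>\<^bsub>?J\<^esub> ?b i) \<longleftrightarrow> (\<forall>j\<le>n. c j = Polynomial.coeff p j)" for c
      unfolding comb p(1) qvec_inject poly_eq_iff cf using p(2) by fastforce
    show ?thesis
      unfolding iff
      by (rule ex1I[of _ "\<lambda>i\<in>{..<n+1}. Polynomial.coeff p i"])
        (auto simp: fun_eq_iff PiE_def extensional_def)
  qed
  moreover have "?b \<in> {..<n+1} \<rightarrow> carrier ?J"
    by (auto simp: Jset_eq)
  ultimately show ?thesis
    unfolding has_dimension_def by (intro bexI[of _ ?b] ballI)
qed

text \<open>The component in \<open>\<complex>[x]y\<^sup>n\<close> of an element is its \<open>n\<close>-th coordinate; uniqueness follows by reading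
  off the coordinates of a given decomposition.\<close>

lemma qplane_decomp:
  assumes "a \<in> carrier (qplane q)"
  shows "\<exists>!v. (\<forall>n. v n \<in> Vset q n) \<and> finite {n. v n \<noteq> \<zero>\<^bsub>qplane q\<^esub>} \<and>
    a = (\<Oplus>\<^bsub>qplane q\<^esub>n\<in>{n. v n \<noteq> \<zero>\<^bsub>qplane q\<^esub>}. v n)"
proof -
  interpret A: left_module CC "qplane q" by (rule left_module_qplane)
  obtain h where h: "a = cls (qp_rels q) h"
    using assms by auto
  let ?P = "qp_coord q h"
  have sum_cls: "(\<Oplus>\<^bsub>qplane q\<^esub>n\<in>A. qvec q n (w n)) =
      cls (qp_rels q) (\<Sum>n\<in>A. peval (gen Gx) (w n) * gen Gy ^ n)" if "finite A" for A w
    unfolding qvec_def using that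
    by (intro finsum_additive) (auto simp: A.M.abelian_group_axioms)
  show ?thesis
  proof (intro ex1I[of _ "\<lambda>n. qvec q n (Polynomial.coeff ?P n)"] conjI allI)
    fix n show "qvec q n (Polynomial.coeff ?P n) \<in> Vset q n"
      by (simp add: Vset_eq)
  next
    have nz: "{n. qvec q n (Polynomial.coeff ?P n) \<noteq> \<zero>\<^bsub>qplane q\<^esub>} = {n. Polynomial.coeff ?P n \<noteq> 0}"
      using qvec_inject qvec_zero by metis
    show fin: "finite {n. qvec q n (Polynomial.coeff ?P n) \<noteq> \<zero>\<^bsub>qplane q\<^esub>}"
      unfolding nz using MOST_coeff_eq_0[of ?P] by (simp add: eventually_cofinite)
    have "a = cls (qp_rels q) (qp_normal ?P)"
      unfolding h by (rule cls_qp_normal)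
    also have "qp_normal ?P = (\<Sum>n | Polynomial.coeff ?P n \<noteq> 0.
        peval (gen Gx) (Polynomial.coeff ?P n) * gen Gy ^ n)"
      unfolding qp_normal_def by (intro sum.mono_neutral_right) (auto intro: le_degree)
    finally show "a = (\<Oplus>\<^bsub>qplane q\<^esub>n\<in>{n. qvec q n (Polynomial.coeff ?P n) \<noteq> \<zero>\<^bsub>qplane q\<^esub>}.
        qvec q n (Polynomial.coeff ?P n))"
      using sum_cls[OF fin, of "Polynomial.coeff ?P"] by (simp only: nz)
  next
    fix v
    assume "(\<forall>n. v n \<in> Vset q n) \<and> finite {n. v n \<noteq> \<zero>\<^bsub>qplane q\<^esub>} \<and>
      a = (\<Oplus>\<^bsub>qplane q\<^esub>n\<in>{n. v n \<noteq> \<zero>\<^bsub>qplane q\<^esub>}. v n)"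
    then have v: "\<forall>n. v n \<in> Vset q n" and fin: "finite {n. v n \<noteq> \<zero>\<^bsub>qplane q\<^esub>}"
      and a: "a = (\<Oplus>\<^bsub>qplane q\<^esub>n\<in>{n. v n \<noteq> \<zero>\<^bsub>qplane q\<^esub>}. v n)"
      by (simp_all del: qplane_sel)
    let ?F = "{n. v n \<noteq> \<zero>\<^bsub>qplane q\<^esub>}"
    obtain w where w: "\<And>n. v n = qvec q n (w n)"
      using v unfolding Vset_eq image_iff by metis
    have w0: "w n = 0" if "n \<notin> ?F" for n
      using that qvec_zero[of q n] qvec_inject[of q n "w n" 0] by (simp add: w)
    have "cls (qp_rels q) h = cls (qp_rels q) (\<Sum>n\<in>?F. peval (gen Gx) (w n) * gen Gy ^ n)"
      using a sum_cls[OF fin, of w] by (simp only: w h)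
    then have "?P = (\<Sum>n\<in>?F. Polynomial.monom (w n) n)"
      using qp_coord_cls by (simp only: qp_coord_sum qp_coord_peval)
    then have "Polynomial.coeff ?P n = w n" for n
      using fin w0[of n] by (simp add: Polynomial.coeff_sum)
    then show "v = (\<lambda>n. qvec q n (Polynomial.coeff ?P n))"
      by (simp add: w fun_eq_iff)
  qed
qed

section \<open>Weighted shifts of polynomials\<close>

text \<open>In the monomial basis of \<open>\<complex>[x]\<close>: the diagonal map \<open>x\<^sup>i \<mapsto> l\<^sub>i x\<^sup>i\<close>, the raising map
  \<open>x\<^sup>i \<mapsto> a\<^sub>i x\<^sup>i\<^sup>+\<^sup>1\<close> and the lowering map \<open>x\<^sup>i \<mapsto> b\<^sub>i x\<^sup>i\<^sup>-\<^sup>1\<close> (with \<open>1 \<mapsto> 0\<close>). The generators of the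
  quantum group act on \<open>\<complex>[x]y\<^sup>n\<close> by maps of this kind.\<close>

definition wdiag :: "(nat \<Rightarrow> complex) \<Rightarrow> complex poly \<Rightarrow> complex poly" where
  "wdiag l p = Abs_poly (\<lambda>i. l i * Polynomial.coeff p i)"

definition wup :: "(nat \<Rightarrow> complex) \<Rightarrow> complex poly \<Rightarrow> complex poly" where
  "wup a p = pCons 0 (wdiag a p)"

definition wdown :: "(nat \<Rightarrow> complex) \<Rightarrow> complex poly \<Rightarrow> complex poly" where
  "wdown b p = Abs_poly (\<lambda>i. b (Suc i) * Polynomial.coeff p (Suc i))"

lemma coeff_wdiag [simp]: "Polynomial.coeff (wdiag l p) i = l i * Polynomial.coeff p i"
  unfolding wdiag_def by (subst coeff_Abs_poly[of "Polynomial.degree p"]) (simp_all add: Polynomial.coeff_eq_0)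

lemma coeff_wup [simp]:
  "Polynomial.coeff (wup a p) i = (case i of 0 \<Rightarrow> 0 | Suc j \<Rightarrow> a j * Polynomial.coeff p j)"
  by (simp add: wup_def coeff_pCons split: nat.split)

lemma coeff_wdown [simp]: "Polynomial.coeff (wdown b p) i = b (Suc i) * Polynomial.coeff p (Suc i)"
  unfolding wdown_def by (subst coeff_Abs_poly[of "Polynomial.degree p"]) (simp_all add: Polynomial.coeff_eq_0)

lemma wshift_add:
  "wdiag l (p + r) = wdiag l p + wdiag l r" "wup l (p + r) = wup l p + wup l r"
  "wdown l (p + r) = wdown l p + wdown l r"
  by (auto intro!: poly_eqI simp: distrib_left split: nat.split)

lemma wshift_smult:
  "wdiag l (Polynomial.smult c p) = Polynomial.smult c (wdiag l p)"
  "wup l (Polynomial.smult c p) = Polynomial.smult c (wup l p)"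
  "wdown l (Polynomial.smult c p) = Polynomial.smult c (wdown l p)"
  by (auto intro!: poly_eqI split: nat.split)

lemma wshift_monom:
  "wdiag l (Polynomial.monom c i) = Polynomial.monom (l i * c) i"
  "wup l (Polynomial.monom c i) = Polynomial.monom (l i * c) (Suc i)"
  "l 0 = 0 \<Longrightarrow> wdown l (Polynomial.monom c i) = Polynomial.monom (l i * c) (i - 1)"
proof -
  show "wdown l (Polynomial.monom c i) = Polynomial.monom (l i * c) (i - 1)" if "l 0 = 0"
    using that by (cases i) (auto intro!: poly_eqI)
qed (auto intro!: poly_eqI split: nat.split)

locale poly_subspace =
  fixes S :: "complex poly set"
  assumes zero: "0 \<in> S" and add: "p \<in> S \<Longrightarrow> r \<in> S \<Longrightarrow> p + r \<in> S"
    and smult: "p \<in> S \<Longrightarrow> Polynomial.smult c p \<in> S"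
begin

lemma mem_if_monoms:
  assumes "\<And>i. Polynomial.coeff p i \<noteq> 0 \<Longrightarrow> Polynomial.monom 1 i \<in> S"
  shows "p \<in> S"
proof -
  have "Polynomial.monom (Polynomial.coeff p i) i \<in> S" for i
    using assms[of i] smult[of "Polynomial.monom 1 i" "Polynomial.coeff p i"] zero
    by (cases "Polynomial.coeff p i = 0") (auto simp: smult_monom)
  then have "(\<Sum>i\<in>A. Polynomial.monom (Polynomial.coeff p i) i) \<in> S" for A
    by (induction A rule: infinite_finite_induct) (auto intro: zero add)
  then show ?thesis
    using poly_as_sum_of_monoms[of p] by metis
qed

text \<open>A lowering map with nonzero coefficients lowers the degree by exactly one.\<close>

lemma descend:
  assumes down: "\<And>p. p \<in> S \<Longrightarrow> wdown b p \<in> S" and b: "\<And>i. b (Suc i) \<noteq> 0"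
    and p: "p \<in> S" "p \<noteq> 0" and d: "d \<le> Polynomial.degree p"
  shows "\<exists>r\<in>S. r \<noteq> 0 \<and> Polynomial.degree r = d"
  using d
proof (induction rule: inc_induct)
  case (step d)
  then obtain r where r: "r \<in> S" "r \<noteq> 0" "Polynomial.degree r = Suc d" by auto
  have "Polynomial.coeff r (Suc d) \<noteq> 0"
    using r by (metis leading_coeff_0_iff)
  then have nz: "Polynomial.coeff (wdown b r) d \<noteq> 0"
    using b by simp
  have "Polynomial.degree (wdown b r) \<le> d"
    using r(3) by (intro Polynomial.degree_le) (auto simp: Polynomial.coeff_eq_0)
  then have "Polynomial.degree (wdown b r) = d"
    using le_degree[OF nz] by (rule antisym)
  moreover have "wdown b r \<noteq> 0" using nz by (auto simp del: coeff_wdown)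
  ultimately show ?case
    using down[OF r(1)] by (intro bexI[of _ "wdown b r"] conjI)
qed (use p in blast)

lemma ascend:
  assumes up: "\<And>p. p \<in> S \<Longrightarrow> wup a p \<in> S" and m: "Polynomial.monom 1 m \<in> S"
    and a: "\<And>i. m \<le> i \<Longrightarrow> i < k \<Longrightarrow> a i \<noteq> 0" and k: "m \<le> k"
  shows "Polynomial.monom 1 k \<in> S"
  using k a
proof (induction rule: dec_induct)
  case (step k)
  then have "Polynomial.monom (a k) (Suc k) \<in> S"
    using up[of "Polynomial.monom 1 k"] by (simp add: wshift_monom)
  from smult[OF this, of "1 / a k"] show ?case
    using step by (simp add: smult_monom)
qed (rule m)

lemma one_mem:
  assumes down: "\<And>p. p \<in> S \<Longrightarrow> wdown b p \<in> S" and b: "\<And>i. b (Suc i) \<noteq> 0"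
    and p: "p \<in> S" "p \<noteq> 0"
  shows "1 \<in> S"
proof -
  obtain r where r: "r \<in> S" "r \<noteq> 0" "Polynomial.degree r = 0"
    using descend[OF down b p, of 0] by auto
  then obtain c where c: "r = [:c:]" "c \<noteq> 0"
    by (metis degree_eq_zeroE pCons_0_0)
  then show ?thesis
    using smult[OF r(1), of "1 / c"] by (simp add: one_pCons)
qed

text \<open>Here the raising map may have a gap at degree \<open>n\<close>. An element of degree above \<open>n\<close> descends to one of
  degree exactly \<open>n + 1\<close>; its lower part is in \<open>S\<close> anyway, so \<open>x\<^sup>n\<^sup>+\<^sup>1\<close> is in \<open>S\<close>, and raising it
  reaches all higher monomials.\<close>

lemma eq_UNIV:
  assumes down: "\<And>p. p \<in> S \<Longrightarrow> wdown b p \<in> S" and b: "\<And>i. b (Suc i) \<noteq> 0"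
    and up: "\<And>p. p \<in> S \<Longrightarrow> wup a p \<in> S" and a: "\<And>i. i > n \<Longrightarrow> a i \<noteq> 0"
    and low: "\<And>i. i \<le> n \<Longrightarrow> Polynomial.monom 1 i \<in> S"
    and p: "p \<in> S" "Polynomial.coeff p j \<noteq> 0" "j > n"
  shows "S = UNIV"
proof -
  have "Suc n \<le> Polynomial.degree p" "p \<noteq> 0"
    using p(2,3) le_degree[of p j] by auto
  then obtain r where r: "r \<in> S" "r \<noteq> 0" "Polynomial.degree r = Suc n"
    using descend[OF down b p(1), of "Suc n"] by auto
  define c where "c = Polynomial.coeff r (Suc n)"
  have c: "c \<noteq> 0"
    using r unfolding c_def by (metis leading_coeff_0_iff)
  define s where "s = Polynomial.monom c (Suc n) - r"
  have "s \<in> S"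
  proof (rule mem_if_monoms)
    fix i assume i: "Polynomial.coeff s i \<noteq> 0"
    have "i \<le> n"
    proof (rule ccontr)
      assume "\<not> i \<le> n"
      then have "i = Suc n \<or> i > Suc n" by auto
      then show False
        using i r(3) by (auto simp: s_def c_def Polynomial.coeff_eq_0)
    qed
    then show "Polynomial.monom 1 i \<in> S" by (rule low)
  qed
  from add[OF this r(1)] have "Polynomial.monom c (Suc n) \<in> S"
    by (simp add: s_def)
  from smult[OF this, of "1 / c"] have "Polynomial.monom 1 (Suc n) \<in> S"
    using c by (simp add: smult_monom)
  then have "Polynomial.monom 1 i \<in> S" for i
    using low[of i] ascend[OF up, of "Suc n" i] a by (cases "i \<le> n") auto
  then show ?thesis
    using mem_if_monoms by blast
qed

end

section \<open>The action on normal forms\<close>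

lemma Uq_sel [simp]:
  "carrier (Uq q) = range (cls (uq_rels q))"
  "\<zero>\<^bsub>Uq q\<^esub> = cls (uq_rels q) 0" "\<one>\<^bsub>Uq q\<^esub> = cls (uq_rels q) 1"
  "cls (uq_rels q) a \<oplus>\<^bsub>Uq q\<^esub> cls (uq_rels q) b = cls (uq_rels q) (a + b)"
  "cls (uq_rels q) a \<otimes>\<^bsub>Uq q\<^esub> cls (uq_rels q) b = cls (uq_rels q) (a * b)"
  "c \<odot>\<^bsub>Uq q\<^esub> cls (uq_rels q) a = cls (uq_rels q) (cscale c a)"
  by (simp_all add: Uq_def)

lemma ring_Uq: "ring (Uq q)"
  unfolding Uq_def by (rule ring_presented_algebra)

lemma ring_qplane: "ring (qplane q)"
  unfolding qplane_def by (rule ring_presented_algebra)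

lemma qplane_smult_mult:
  assumes "a \<in> carrier (qplane q)" "b \<in> carrier (qplane q)"
  shows "(c \<odot>\<^bsub>qplane q\<^esub> a) \<otimes>\<^bsub>qplane q\<^esub> b = c \<odot>\<^bsub>qplane q\<^esub> (a \<otimes>\<^bsub>qplane q\<^esub> b)"
  using assms by (auto simp: cscale_mult_left)

lemma comult_gen: "comult (gen g) = comult_gen g"
  by (simp add: comult_def free_lift_def gen_def)

lemma counit_gen: "counit (gen g) = counit_gen g"
  by (simp add: counit_def free_lift_def gen_def)

lemma zero_tensor_ideal: "0 \<in> tensor_ideal q"
proof -
  interpret T: ring "ring_of_type_algebra :: uq_gen free2 ring"
    by (rule ring_ring_of_type_algebra)
  have "ideal (tensor_ideal q) ring_of_type_algebra"
    unfolding tensor_ideal_def by (rule T.genideal_ideal) simp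
  then interpret I: ideal "tensor_ideal q" "ring_of_type_algebra :: uq_gen free2 ring" .
  show ?thesis using I.zero_closed by simp
qed

lemma rep_module_sel [simp]:
  "carrier (rep_module A \<pi>) = carrier A" "\<zero>\<^bsub>rep_module A \<pi>\<^esub> = \<zero>\<^bsub>A\<^esub>"
  "a \<oplus>\<^bsub>rep_module A \<pi>\<^esub> b = a \<oplus>\<^bsub>A\<^esub> b" "r \<odot>\<^bsub>rep_module A \<pi>\<^esub> a = \<pi> r a"
  by (simp_all add: rep_module_def)

text \<open>Both sides are sums over the same additive group, but their records carry different scalars.\<close>

lemma finsum_rep_module: "finsum (rep_module A \<pi>) = finsum A"
  by (intro ext) (simp add: finsum_def finprod_def rep_module_def)

text \<open>The module algebra structure of the proposition. Below, the action is written with representatives in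
  the free algebra: \<open>act h a\<close>.\<close>

locale qplane_action =
  fixes q c0 :: complex
    and \<pi> :: "uq_gen free set \<Rightarrow> qp_gen free set \<Rightarrow> qp_gen free set"
  assumes q_nonzero: "q \<noteq> 0"
    and q_not_root_of_unity: "\<forall>m::nat. m > 0 \<longrightarrow> q ^ m \<noteq> 1"
    and c0_nonzero: "c0 \<noteq> 0"
    and module_alg: "module_algebra_structure q (qplane q) \<pi>"
    and k_x: "\<pi> (uk q) (qx q) = q ^ 2 \<odot>\<^bsub>qplane q\<^esub> qx q"
    and k_y: "\<pi> (uk q) (qy q) = inverse q \<odot>\<^bsub>qplane q\<^esub> qy q"
    and e_x: "\<pi> (ue q) (qx q) = (- q * inverse c0) \<odot>\<^bsub>qplane q\<^esub> (qx q \<otimes>\<^bsub>qplane q\<^esub> qx q)"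
    and e_y: "\<pi> (ue q) (qy q) = inverse c0 \<odot>\<^bsub>qplane q\<^esub> (qx q \<otimes>\<^bsub>qplane q\<^esub> qy q)"
    and f_x: "\<pi> (uf q) (qx q) = c0 \<odot>\<^bsub>qplane q\<^esub> \<one>\<^bsub>qplane q\<^esub>"
    and f_y: "\<pi> (uf q) (qy q) = \<zero>\<^bsub>qplane q\<^esub>"
begin

abbreviation "A \<equiv> qplane q"
abbreviation "act h a \<equiv> \<pi> (cls (uq_rels q) h) a"

sublocale A: ring A by (rule ring_qplane)
sublocale AV: left_module CC A by (rule left_module_qplane)

declare qplane_sel [simp del]

lemma pi_hom: "\<pi> \<in> alg_hom (Uq q) (End_alg A)"
  using module_alg by (simp add: module_algebra_structure_def)

lemma act_End: "\<pi> (cls (uq_rels q) h) \<in> carrier (End_alg A)"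
  using pi_hom by (auto simp: alg_hom_def ring_hom_def)

lemma act_closed [simp]: "a \<in> carrier A \<Longrightarrow> act h a \<in> carrier A"
  using act_End[of h] by (auto simp: End_alg_def)

lemma act_plus: "a \<in> carrier A \<Longrightarrow> b \<in> carrier A \<Longrightarrow> act h (a \<oplus>\<^bsub>A\<^esub> b) = act h a \<oplus>\<^bsub>A\<^esub> act h b"
  using act_End[of h] by (auto simp: End_alg_def)

lemma act_smult: "a \<in> carrier A \<Longrightarrow> act h (c \<odot>\<^bsub>A\<^esub> a) = c \<odot>\<^bsub>A\<^esub> act h a"
  using act_End[of h] by (auto simp: End_alg_def)

lemma act_one: "a \<in> carrier A \<Longrightarrow> act 1 a = a"
proof -
  have "\<pi> \<one>\<^bsub>Uq q\<^esub> = \<one>\<^bsub>End_alg A\<^esub>"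
    using pi_hom by (intro ring_hom_one) (simp add: alg_hom_def)
  then show "a \<in> carrier A \<Longrightarrow> act 1 a = a"
    by (simp add: End_alg_def)
qed

lemma act_mult: "a \<in> carrier A \<Longrightarrow> act (h * h') a = act h (act h' a)"
proof -
  have "\<pi> (cls (uq_rels q) h \<otimes>\<^bsub>Uq q\<^esub> cls (uq_rels q) h') =
      \<pi> (cls (uq_rels q) h) \<otimes>\<^bsub>End_alg A\<^esub> \<pi> (cls (uq_rels q) h')"
    using pi_hom by (intro ring_hom_mult[of \<pi> "Uq q"]) (auto simp: alg_hom_def)
  then show "a \<in> carrier A \<Longrightarrow> act (h * h') a = act h (act h' a)"
    by (simp add: End_alg_def compose_def)
qed

lemma act_add: "a \<in> carrier A \<Longrightarrow> act (h + h') a = act h a \<oplus>\<^bsub>A\<^esub> act h' a"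
proof -
  have "\<pi> (cls (uq_rels q) h \<oplus>\<^bsub>Uq q\<^esub> cls (uq_rels q) h') =
      \<pi> (cls (uq_rels q) h) \<oplus>\<^bsub>End_alg A\<^esub> \<pi> (cls (uq_rels q) h')"
    using pi_hom by (intro ring_hom_add[of \<pi> "Uq q"]) (auto simp: alg_hom_def)
  then show "a \<in> carrier A \<Longrightarrow> act (h + h') a = act h a \<oplus>\<^bsub>A\<^esub> act h' a"
    by (simp add: End_alg_def)
qed

lemma act_cscale: "a \<in> carrier A \<Longrightarrow> act (cscale c h) a = c \<odot>\<^bsub>A\<^esub> act h a"
proof -
  have "\<pi> (c \<odot>\<^bsub>Uq q\<^esub> cls (uq_rels q) h) = c \<odot>\<^bsub>End_alg A\<^esub> \<pi> (cls (uq_rels q) h)"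
    using pi_hom by (auto simp: alg_hom_def)
  then show "a \<in> carrier A \<Longrightarrow> act (cscale c h) a = c \<odot>\<^bsub>A\<^esub> act h a"
    by (simp add: End_alg_def)
qed

lemma act_zero_left: "a \<in> carrier A \<Longrightarrow> act 0 a = \<zero>\<^bsub>A\<^esub>"
  using act_cscale[of a 0 1] AV.smult_l_null[of "act 1 a"] by simp

abbreviation "M \<equiv> rep_module A \<pi>"

lemma left_module_M: "left_module (Uq q) M"
proof -
  have "abelian_group M"
  proof (rule abelian_groupI)
    fix x assume "x \<in> carrier M"
    then show "\<exists>y\<in>carrier M. y \<oplus>\<^bsub>M\<^esub> x = \<zero>\<^bsub>M\<^esub>"
      using A.l_neg by auto
  next
    fix x y assume "x \<in> carrier M" "y \<in> carrier M"
    then show "x \<oplus>\<^bsub>M\<^esub> y = y \<oplus>\<^bsub>M\<^esub> x"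
      by (simp add: A.a_comm)
  qed (simp_all add: A.a_assoc)
  moreover have "left_module_axioms (Uq q) M"
    by standard (auto simp: act_plus act_add act_mult act_one)
  ultimately show ?thesis
    by (simp add: left_module_def ring_Uq)
qed

sublocale M: left_module "Uq q" M by (rule left_module_M)

subsection \<open>The twisted Leibniz rules\<close>

lemma act_coproduct:
  assumes "coproduct_is q h m u v" "a \<in> carrier A" "b \<in> carrier A"
  shows "act h (a \<otimes>\<^bsub>A\<^esub> b) = (\<Oplus>\<^bsub>A\<^esub>i\<in>{..<m}. act (u i) a \<otimes>\<^bsub>A\<^esub> act (v i) b)"
  using module_alg assms unfolding module_algebra_structure_def by blast

lemma act_unit: "act h \<one>\<^bsub>A\<^esub> = counit h \<odot>\<^bsub>A\<^esub> \<one>\<^bsub>A\<^esub>"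
  using module_alg unfolding module_algebra_structure_def by blast

text \<open>The compatibility with the comultiplication, made explicit on the generators.\<close>

lemma k_mult:
  assumes "a \<in> carrier A" "b \<in> carrier A"
  shows "act (gen Gk) (a \<otimes>\<^bsub>A\<^esub> b) = act (gen Gk) a \<otimes>\<^bsub>A\<^esub> act (gen Gk) b"
proof -
  have "coproduct_is q (gen Gk) (Suc 0) (\<lambda>_. gen Gk) (\<lambda>_. gen Gk)"
    by (simp add: coproduct_is_def comult_gen zero_tensor_ideal)
  from act_coproduct[OF this assms] show ?thesis
    using assms by (simp add: lessThan_Suc)
qed

lemma e_mult:
  assumes "a \<in> carrier A" "b \<in> carrier A"
  shows "act (gen Ge) (a \<otimes>\<^bsub>A\<^esub> b) =
    a \<otimes>\<^bsub>A\<^esub> act (gen Ge) b \<oplus>\<^bsub>A\<^esub> act (gen Ge) a \<otimes>\<^bsub>A\<^esub> act (gen Gk) b"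
proof -
  have "coproduct_is q (gen Ge) (Suc (Suc 0)) (\<lambda>i. if i = 0 then 1 else gen Ge)
      (\<lambda>i. if i = 0 then gen Ge else gen Gk)"
    by (simp add: coproduct_is_def comult_gen zero_tensor_ideal lessThan_Suc)
  from act_coproduct[OF this assms] show ?thesis
    using assms by (simp add: lessThan_Suc act_one A.a_comm)
qed

lemma f_mult:
  assumes "a \<in> carrier A" "b \<in> carrier A"
  shows "act (gen Gf) (a \<otimes>\<^bsub>A\<^esub> b) =
    act (gen Gf) a \<otimes>\<^bsub>A\<^esub> b \<oplus>\<^bsub>A\<^esub> act (gen Gki) a \<otimes>\<^bsub>A\<^esub> act (gen Gf) b"
proof -
  have "coproduct_is q (gen Gf) (Suc (Suc 0)) (\<lambda>i. if i = 0 then gen Gf else gen Gki)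
      (\<lambda>i. if i = 0 then 1 else gen Gf)"
    by (simp add: coproduct_is_def comult_gen zero_tensor_ideal lessThan_Suc)
  from act_coproduct[OF this assms] show ?thesis
    using assms by (simp add: lessThan_Suc act_one A.a_comm)
qed

lemma act_ki_k: "a \<in> carrier A \<Longrightarrow> act (gen Gki) (act (gen Gk) a) = a"
  using act_mult[of a "gen Gki" "gen Gk"] cls_rel[of "gen Gki * gen Gk" 1 "uq_rels q"] act_one
  by (simp add: uq_rels_def)

text \<open>The values of \<open>\<k>\<^sup>-\<^sup>1\<close> are not prescribed; they follow from those of \<open>\<k>\<close>.\<close>

lemma act_ki_eigenvector:
  assumes "a \<in> carrier A" "act (gen Gk) a = l \<odot>\<^bsub>A\<^esub> a" "l \<noteq> 0"
  shows "act (gen Gki) a = inverse l \<odot>\<^bsub>A\<^esub> a"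
proof -
  have "inverse l \<odot>\<^bsub>A\<^esub> a = inverse l \<odot>\<^bsub>A\<^esub> act (gen Gki) (l \<odot>\<^bsub>A\<^esub> a)"
    using act_ki_k[OF assms(1)] assms(2) by simp
  also have "\<dots> = (inverse l * l) \<odot>\<^bsub>A\<^esub> act (gen Gki) a"
    using assms(1) AV.smult_assoc1[of "inverse l" l "act (gen Gki) a"] by (simp add: act_smult)
  finally show ?thesis
    using assms AV.smult_one[of "act (gen Gki) a"] by simp
qed

subsection \<open>The generators act by weighted shifts\<close>

lemma qx_carrier [simp]: "qx q \<in> carrier A" "qy q \<in> carrier A"
  by (auto simp: qx_def qy_def qplane_sel)

lemma qx_mult_qvec: "qx q \<otimes>\<^bsub>A\<^esub> qvec q n p = qvec q n (pCons 0 p)"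
  by (simp add: qx_def qvec_def qplane_sel peval_pCons mult.assoc)

lemma qy_mult_qvec: "qy q \<otimes>\<^bsub>A\<^esub> qvec q n p = qvec q (Suc n) (pcompose p [:0, q:])"
  using cls_cong_mult[OF cls_y_peval refl, of q p "gen Gy ^ n"]
  by (simp add: qy_def qvec_def qplane_sel mult.assoc)

lemma one_eq_qvec: "\<one>\<^bsub>A\<^esub> = qvec q 0 1"
  by (simp add: qvec_def qplane_sel one_pCons peval_pCons)

lemmas qvec_hom = qvec_zero[symmetric] qvec_add[symmetric] qvec_smult[symmetric]

text \<open>The coefficients with which \<open>\<k>\<close>, \<open>\<e>\<close> and \<open>\<f>\<close> act on \<open>x\<^sup>m y\<^sup>n\<close>:
  \<open>\<k>(x\<^sup>m y\<^sup>n) = q\<^sup>2\<^sup>m\<^sup>-\<^sup>n x\<^sup>m y\<^sup>n\<close>,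
  \<open>\<e>(x\<^sup>m y\<^sup>n) = (q\<^sup>n - q\<^sup>2\<^sup>m\<^sup>-\<^sup>n) / (c\<^sub>0 (q - q\<^sup>-\<^sup>1)) x\<^sup>m\<^sup>+\<^sup>1 y\<^sup>n\<close> and
  \<open>\<f>(x\<^sup>m y\<^sup>n) = c\<^sub>0 (1 - q\<^sup>-\<^sup>2\<^sup>m) / (1 - q\<^sup>-\<^sup>2) x\<^sup>m\<^sup>-\<^sup>1 y\<^sup>n\<close>. They solve the recursions that the
  Leibniz rules give for multiplication by \<open>x\<close> and \<open>y\<close> on the left.\<close>

definition k_coeff :: "nat \<Rightarrow> nat \<Rightarrow> complex" where
  "k_coeff n m = q ^ (2 * m) * inverse q ^ n"

definition e_coeff :: "nat \<Rightarrow> nat \<Rightarrow> complex" where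
  "e_coeff n m = (q ^ n - k_coeff n m) / (c0 * (q - inverse q))"

definition f_coeff :: "nat \<Rightarrow> complex" where
  "f_coeff m = c0 * (1 - inverse q ^ (2 * m)) / (1 - inverse q ^ 2)"

lemma q_square: "q ^ 2 \<noteq> 1" "q - inverse q \<noteq> 0" "1 - inverse q ^ 2 \<noteq> 0"
proof -
  show q2: "q ^ 2 \<noteq> 1"
    using q_not_root_of_unity by simp
  then show "q - inverse q \<noteq> 0" "1 - inverse q ^ 2 \<noteq> 0"
    using q_nonzero by (auto simp: field_simps power2_eq_square)
qed

lemma k_coeff_simps: "k_coeff 0 0 = 1" "k_coeff (Suc n) m = inverse q * k_coeff n m" "k_coeff n (Suc m) = q ^ 2 * k_coeff n m"
  by (simp_all add: k_coeff_def power2_eq_square)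

lemma k_coeff_nonzero: "k_coeff n m \<noteq> 0"
  using q_nonzero by (simp add: k_coeff_def)

lemma f_coeff_simps: "f_coeff 0 = 0" "f_coeff (Suc m) = c0 + inverse q ^ 2 * f_coeff m"
proof -
  have "c0 * (1 - r ^ Suc m) / (1 - r) = c0 + r * (c0 * (1 - r ^ m) / (1 - r))" if "1 - r \<noteq> 0" for r
  proof -
    have "c0 * (1 - r ^ Suc m) = c0 * (1 - r) + r * (c0 * (1 - r ^ m))"
      by (simp add: algebra_simps)
    then show ?thesis
      using that by (simp add: add_divide_distrib del: power_Suc)
  qed
  from this[OF q_square(3)] show "f_coeff (Suc m) = c0 + inverse q ^ 2 * f_coeff m"
    unfolding f_coeff_def power_mult .
qed (simp add: f_coeff_def)

lemma e_coeff_simps: "e_coeff 0 0 = 0" "e_coeff n (Suc m) = e_coeff n m - q / c0 * k_coeff n m"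
  "e_coeff (Suc n) 0 = q * e_coeff n 0 + inverse c0 * k_coeff n 0"
proof -
  have d: "q * q - 1 \<noteq> 0"
    using q_square(1) by (simp add: power2_eq_square)
  have *: "q - inverse q = (q * q - 1) / q"
    using q_nonzero by (simp add: field_simps)
  show "e_coeff n (Suc m) = e_coeff n m - q / c0 * k_coeff n m"
    unfolding e_coeff_def k_coeff_simps * using d q_nonzero c0_nonzero
    by (simp add: field_simps power2_eq_square)
  show "e_coeff (Suc n) 0 = q * e_coeff n 0 + inverse c0 * k_coeff n 0"
    unfolding e_coeff_def k_coeff_simps * using d q_nonzero c0_nonzero
    by (simp add: field_simps power2_eq_square)
qed (simp add: e_coeff_def k_coeff_def)

lemma f_coeff_nonzero: "f_coeff (Suc m) \<noteq> 0"
proof -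
  have "0 < 2 * Suc m" by simp
  then have "q ^ (2 * Suc m) \<noteq> 1"
    using q_not_root_of_unity by blast
  then have "inverse q ^ (2 * Suc m) \<noteq> 1"
    by (simp only: power_inverse inverse_eq_1_iff not_False_eq_True)
  then show ?thesis
    using c0_nonzero q_square(3) by (simp add: f_coeff_def del: power_Suc)
qed

text \<open>The raising map has exactly one gap, from degree \<open>n\<close> to degree \<open>n + 1\<close>, because
  \<open>q\<^sup>n = q\<^sup>2\<^sup>m\<^sup>-\<^sup>n\<close> forces \<open>m = n\<close>.\<close>

lemma e_coeff_zero_iff: "e_coeff n m = 0 \<longleftrightarrow> m = n"
proof -
  have "e_coeff n m = 0 \<longleftrightarrow> q ^ n = k_coeff n m"
    using c0_nonzero q_square(2) by (simp add: e_coeff_def)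
  also have "\<dots> \<longleftrightarrow> q ^ n * q ^ n = q ^ (2 * m)"
    using q_nonzero by (simp add: k_coeff_def field_simps)
  also have "\<dots> \<longleftrightarrow> q ^ (2 * n) = q ^ (2 * m)"
    by (simp add: mult_2[of n] power_add)
  also have "\<dots> \<longleftrightarrow> m = n"
  proof -
    have "q ^ i \<noteq> q ^ j" if "i < j" for i j
    proof
      assume "q ^ i = q ^ j"
      moreover have "q ^ j = q ^ i * q ^ (j - i)"
        using that by (simp flip: power_add)
      ultimately have "q ^ i * 1 = q ^ i * q ^ (j - i)"
        by simp
      then have "q ^ (j - i) = 1"
        using q_nonzero by simp
      then show False
        using q_not_root_of_unity that by simp
    qed
    then have "q ^ i = q ^ j \<longleftrightarrow> i = j" for i j
      by (metis linorder_neqE_nat)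
    then show ?thesis by auto
  qed
  finally show ?thesis .
qed

lemma act_linear_extend:
  assumes mono: "\<And>m. act h (qvec q n (Polynomial.monom 1 m)) = qvec q n (D (Polynomial.monom 1 m))"
    and D: "\<And>p r. D (p + r) = D p + D r" "\<And>c p. D (Polynomial.smult c p) = Polynomial.smult c (D p)"
  shows "act h (qvec q n p) = qvec q n (D p)"
proof -
  have D0: "D 0 = 0"
    using D(2)[of 0 0] by simp
  have z: "act h \<zero>\<^bsub>A\<^esub> = \<zero>\<^bsub>A\<^esub>"
    using M.smult_r_null[of "cls (uq_rels q) h"] by simp
  have one: "act h (qvec q n (Polynomial.monom c m)) = qvec q n (D (Polynomial.monom c m))" for c m
  proof -
    have "Polynomial.monom c m = Polynomial.smult c (Polynomial.monom 1 m)"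
      by (simp add: smult_monom)
    then show ?thesis
      by (simp only: qvec_smult D act_smult qvec_carrier mono)
  qed
  have "act h (qvec q n (\<Sum>i\<in>I. Polynomial.monom (Polynomial.coeff p i) i)) =
      qvec q n (D (\<Sum>i\<in>I. Polynomial.monom (Polynomial.coeff p i) i))" for I
    by (induction I rule: infinite_finite_induct)
      (simp_all add: D0 z qvec_zero qvec_add D act_plus one)
  then show ?thesis
    using poly_as_sum_of_monoms[of p] by metis
qed

text \<open>The formulas for \<open>\<k>\<close>, \<open>\<e>\<close> and \<open>\<f>\<close> are obtained on monomials: first for \<open>y\<^sup>n\<close>, by multiplying with \<open>y\<close>
  on the left, then for \<open>x\<^sup>m y\<^sup>n\<close>, by multiplying with \<open>x\<close> on the left.\<close>

lemma act_k: "act (gen Gk) (qvec q n p) = qvec q n (wdiag (k_coeff n) p)"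
proof (rule act_linear_extend[OF _ wshift_add(1) wshift_smult(1)])
  fix m
  have "act (gen Gk) (qvec q n 1) = qvec q n [:k_coeff n 0:]"
  proof (induction n)
    case 0
    then show ?case
      using act_unit[of "gen Gk"] AV.smult_one[of "\<one>\<^bsub>A\<^esub>"]
      by (simp add: one_eq_qvec counit_gen k_coeff_simps one_pCons)
  next
    case (Suc n)
    have y: "qvec q (Suc n) 1 = qy q \<otimes>\<^bsub>A\<^esub> qvec q n 1"
      by (simp add: qy_mult_qvec pcompose_1)
    show ?case
      using k_y Suc
      by (simp add: y k_mult uk_def qplane_smult_mult)
        (simp add: qy_mult_qvec qvec_hom k_coeff_simps pcompose_const)
  qed
  then have "act (gen Gk) (qvec q n (Polynomial.monom 1 m)) = qvec q n (Polynomial.monom (k_coeff n m) m)"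
  proof (induction m)
    case (Suc m)
    then show ?case
      using k_x
      by (simp add: Polynomial.monom_Suc qx_mult_qvec[symmetric] k_mult uk_def)
        (simp add: qplane_smult_mult qx_mult_qvec qvec_hom k_coeff_simps smult_monom)
  qed (simp add: Polynomial.monom_0 one_pCons)
  then show "act (gen Gk) (qvec q n (Polynomial.monom 1 m)) =
      qvec q n (wdiag (k_coeff n) (Polynomial.monom 1 m))"
    by (simp add: wshift_monom)
qed

lemma act_ki: "act (gen Gki) (qvec q n p) = qvec q n (wdiag (\<lambda>m. inverse (k_coeff n m)) p)"
proof (rule act_linear_extend[OF _ wshift_add(1) wshift_smult(1)])
  fix m
  have "act (gen Gki) (qvec q n (Polynomial.monom 1 m)) =
      inverse (k_coeff n m) \<odot>\<^bsub>A\<^esub> qvec q n (Polynomial.monom 1 m)"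
    by (rule act_ki_eigenvector) (simp_all add: k_coeff_nonzero act_k wshift_monom qvec_hom smult_monom)
  then show "act (gen Gki) (qvec q n (Polynomial.monom 1 m)) =
      qvec q n (wdiag (\<lambda>m. inverse (k_coeff n m)) (Polynomial.monom 1 m))"
    by (simp add: wshift_monom qvec_hom smult_monom)
qed

lemma act_e: "act (gen Ge) (qvec q n p) = qvec q n (wup (e_coeff n) p)"
proof (rule act_linear_extend[OF _ wshift_add(2) wshift_smult(2)])
  fix m
  have "act (gen Ge) (qvec q n 1) = qvec q n [:0, e_coeff n 0:]"
  proof (induction n)
    case 0
    then show ?case
      using act_unit[of "gen Ge"]
      by (simp add: one_eq_qvec counit_gen e_coeff_simps qvec_hom)
  next
    case (Suc n)
    have y: "qvec q (Suc n) 1 = qy q \<otimes>\<^bsub>A\<^esub> qvec q n 1"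
      by (simp add: qy_mult_qvec pcompose_1)
    have "act (gen Ge) (qvec q (Suc n) 1) = qy q \<otimes>\<^bsub>A\<^esub> qvec q n [:0, e_coeff n 0:] \<oplus>\<^bsub>A\<^esub>
        (inverse c0 \<odot>\<^bsub>A\<^esub> (qx q \<otimes>\<^bsub>A\<^esub> qy q)) \<otimes>\<^bsub>A\<^esub> qvec q n (wdiag (k_coeff n) 1)"
      using e_y by (simp add: y e_mult Suc.IH ue_def act_k)
    also have "\<dots> = qvec q (Suc n) [:0, e_coeff (Suc n) 0:]"
    proof -
      have "wdiag (k_coeff n) 1 = [:k_coeff n 0:]"
        using wshift_monom(1)[of "k_coeff n" 1 0] by (simp add: Polynomial.monom_0 one_pCons)
      then show ?thesis
        by (simp add: qplane_smult_mult A.m_assoc qy_mult_qvec qx_mult_qvec qvec_hom pcompose_pCons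
            e_coeff_simps mult.commute)
    qed
    finally show ?case .
  qed
  then have "act (gen Ge) (qvec q n (Polynomial.monom 1 m)) =
      qvec q n (Polynomial.monom (e_coeff n m) (Suc m))"
  proof (induction m)
    case (Suc m)
    have "act (gen Ge) (qvec q n (Polynomial.monom 1 (Suc m))) =
      qx q \<otimes>\<^bsub>A\<^esub> qvec q n (Polynomial.monom (e_coeff n m) (Suc m)) \<oplus>\<^bsub>A\<^esub>
      ((- q * inverse c0) \<odot>\<^bsub>A\<^esub> (qx q \<otimes>\<^bsub>A\<^esub> qx q)) \<otimes>\<^bsub>A\<^esub> qvec q n (Polynomial.monom (k_coeff n m) m)"
      using e_x Suc
      by (simp add: Polynomial.monom_Suc[of 1] qx_mult_qvec[symmetric] e_mult ue_def act_k wshift_monom)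
    also have "\<dots> = qvec q n (Polynomial.monom (e_coeff n (Suc m)) (Suc (Suc m)))"
      by (simp add: qplane_smult_mult A.m_assoc qx_mult_qvec qvec_hom Polynomial.monom_Suc[symmetric]
          smult_monom add_monom e_coeff_simps  field_simps)
    finally show ?case .
  qed (simp add: Polynomial.monom_Suc Polynomial.monom_0 one_pCons)
  then show "act (gen Ge) (qvec q n (Polynomial.monom 1 m)) =
      qvec q n (wup (e_coeff n) (Polynomial.monom 1 m))"
    by (simp add: wshift_monom)
qed

lemma act_f: "act (gen Gf) (qvec q n p) = qvec q n (wdown f_coeff p)"
proof (rule act_linear_extend[OF _ wshift_add(3) wshift_smult(3)])
  fix m
  have kix: "act (gen Gki) (qx q) = inverse q ^ 2 \<odot>\<^bsub>A\<^esub> qx q"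
    using act_ki_eigenvector[of "qx q" "q ^ 2"] k_x q_nonzero by (simp add: uk_def power_inverse)
  have "act (gen Gf) (qvec q n 1) = qvec q n 0"
  proof (induction n)
    case 0
    then show ?case
      using act_unit[of "gen Gf"]
      by (simp add: one_eq_qvec counit_gen qvec_hom)
  next
    case (Suc n)
    have y: "qvec q (Suc n) 1 = qy q \<otimes>\<^bsub>A\<^esub> qvec q n 1"
      by (simp add: qy_mult_qvec pcompose_1)
    show ?case
      using f_y Suc by (simp add: y f_mult uf_def qvec_zero)
  qed
  then have "act (gen Gf) (qvec q n (Polynomial.monom 1 m)) =
      qvec q n (Polynomial.monom (f_coeff m) (m - 1))"
  proof (induction m)
    case (Suc m)
    have "act (gen Gf) (qvec q n (Polynomial.monom 1 (Suc m))) =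
      (c0 \<odot>\<^bsub>A\<^esub> \<one>\<^bsub>A\<^esub>) \<otimes>\<^bsub>A\<^esub> qvec q n (Polynomial.monom 1 m) \<oplus>\<^bsub>A\<^esub>
      (inverse q ^ 2 \<odot>\<^bsub>A\<^esub> qx q) \<otimes>\<^bsub>A\<^esub> qvec q n (Polynomial.monom (f_coeff m) (m - 1))"
      using f_x Suc by (simp add: Polynomial.monom_Suc[of 1] qx_mult_qvec[symmetric] f_mult uf_def kix)
    also have "\<dots> = qvec q n (Polynomial.smult c0 (Polynomial.monom 1 m) +
        Polynomial.smult (inverse q ^ 2) (pCons 0 (Polynomial.monom (f_coeff m) (m - 1))))"
      by (simp add: qplane_smult_mult qx_mult_qvec qvec_hom)
    also have "\<dots> = qvec q n (Polynomial.monom (f_coeff (Suc m)) m)"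
      by (cases m) (simp_all add: f_coeff_simps Polynomial.monom_Suc[symmetric] Polynomial.monom_0 smult_monom add_monom)
    finally show ?case by simp
  qed (simp add: Polynomial.monom_0 one_pCons f_coeff_simps)
  then show "act (gen Gf) (qvec q n (Polynomial.monom 1 m)) =
      qvec q n (wdown f_coeff (Polynomial.monom 1 m))"
    by (simp add: wshift_monom f_coeff_simps)
qed

end

context qplane_action
begin

section \<open>The submodules \<open>\<V>\<^sub>n\<close> and \<open>\<J>\<^sub>n\<close>\<close>

lemma poly_action_closed:
  assumes S: "poly_subspace S"
    and k: "\<And>p. p \<in> S \<Longrightarrow> wdiag (k_coeff n) p \<in> S" "\<And>p. p \<in> S \<Longrightarrow> wdiag (\<lambda>m. inverse (k_coeff n m)) p \<in> S"
    and e: "\<And>p. p \<in> S \<Longrightarrow> wup (e_coeff n) p \<in> S" and f: "\<And>p. p \<in> S \<Longrightarrow> wdown f_coeff p \<in> S"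
    and p: "p \<in> S"
  shows "act h (qvec q n p) \<in> qvec q n ` S"
proof (induction h rule: free_induct)
  interpret S: poly_subspace S by (rule S)
  note sub = S.zero S.add S.smult
  { case zero
    show ?case
      using sub(1) by (auto simp: act_zero_left qvec_zero[of q n, symmetric]) }
  { case one
    show ?case using p by (simp add: act_one) }
  { case (add a b)
    then obtain r s where "r \<in> S" "s \<in> S" "act a (qvec q n p) = qvec q n r"
      "act b (qvec q n p) = qvec q n s" by blast
    then show ?case
      using sub(2) by (auto simp: act_add qvec_add[symmetric]) }
  { case (scale c a)
    then obtain r where "r \<in> S" "act a (qvec q n p) = qvec q n r" by blast
    then show ?case
      using sub(3) by (auto simp: act_cscale qvec_smult[symmetric]) }
  { case (gen g a)
    then obtain r where "r \<in> S" "act a (qvec q n p) = qvec q n r" by blast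
    then show ?case
      using k e f by (cases g) (auto simp: act_mult act_k act_ki act_e act_f) }
qed

lemma submodule_qvec_image:
  assumes S: "poly_subspace S"
    and "\<And>p. p \<in> S \<Longrightarrow> wdiag (k_coeff n) p \<in> S" "\<And>p. p \<in> S \<Longrightarrow> wdiag (\<lambda>m. inverse (k_coeff n m)) p \<in> S"
    and "\<And>p. p \<in> S \<Longrightarrow> wup (e_coeff n) p \<in> S" and "\<And>p. p \<in> S \<Longrightarrow> wdown f_coeff p \<in> S"
  shows "submodule (qvec q n ` S) (Uq q) M"
proof (rule M.submoduleI)
  interpret S: poly_subspace S by (rule S)
  show "\<zero>\<^bsub>M\<^esub> \<in> qvec q n ` S"
    using S.zero by (auto simp: qvec_zero[of q n, symmetric])
  show "a \<oplus>\<^bsub>M\<^esub> b \<in> qvec q n ` S" if "a \<in> qvec q n ` S" "b \<in> qvec q n ` S" for a b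
    using that S.add by (auto simp: qvec_add[symmetric])
  show "r \<odot>\<^bsub>M\<^esub> a \<in> qvec q n ` S" if "r \<in> carrier (Uq q)" "a \<in> qvec q n ` S" for r a
    using that poly_action_closed[OF assms] by auto
qed auto

abbreviation low :: "nat \<Rightarrow> complex poly set" where
  "low n \<equiv> {p. \<forall>i. Polynomial.coeff p i \<noteq> 0 \<longrightarrow> i \<le> n}"

lemma submodule_Vset: "submodule (Vset q n) (Uq q) M"
  unfolding Vset_eq by (rule submodule_qvec_image) (simp_all add: poly_subspace_def)

lemma submodule_Jset: "submodule (Jset q n) (Uq q) M"
  unfolding Jset_eq
proof (rule submodule_qvec_image)
  show "poly_subspace (low n)"
  proof
    fix p r assume pr: "p \<in> low n" "r \<in> low n"
    have "i \<le> n" if "Polynomial.coeff (p + r) i \<noteq> 0" for i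
    proof -
      from that have "Polynomial.coeff p i \<noteq> 0 \<or> Polynomial.coeff r i \<noteq> 0" by auto
      then show ?thesis using pr by blast
    qed
    then show "p + r \<in> low n" by blast
  qed auto
  fix p assume p: "p \<in> low n"
  have "i \<le> n" if i: "Polynomial.coeff (wup (e_coeff n) p) i \<noteq> 0" for i
  proof (cases i)
    case (Suc j)
    \<comment> \<open>The coefficient with which the raising operator leaves degree \<open>n\<close> vanishes.\<close>
    then have "j \<noteq> n" "Polynomial.coeff p j \<noteq> 0"
      using i by (auto simp: e_coeff_zero_iff)
    then show ?thesis
      using p Suc by (simp add: Suc_le_eq order_less_le)
  qed simp
  then show "wup (e_coeff n) p \<in> low n" by blast
  have "i \<le> n" if "Polynomial.coeff (wdown f_coeff p) i \<noteq> 0" for i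
  proof -
    have "Suc i \<le> n"
      using that p by simp
    then show ?thesis by simp
  qed
  then show "wdown f_coeff p \<in> low n" by blast
qed auto

lemma Jset_subset_Vset: "Jset q n \<subseteq> Vset q n"
  by (auto simp: Jset_eq Vset_eq)

lemma qvec_mem_Jset_iff: "qvec q n p \<in> Jset q n \<longleftrightarrow> p \<in> low n"
  by (auto simp: Jset_eq qvec_inject)

lemma monom_Suc_notin_low: "Polynomial.monom 1 (Suc n) \<notin> low n"
proof
  assume "Polynomial.monom 1 (Suc n) \<in> low n"
  then have "Polynomial.coeff (Polynomial.monom 1 (Suc n) :: complex poly) (Suc n) \<noteq> 0 \<longrightarrow> Suc n \<le> n"
    by blast
  then show False by simp
qed

lemma Jset_neq_Vset: "Jset q n \<noteq> Vset q n"
proof -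
  have "qvec q n (Polynomial.monom 1 (Suc n)) \<notin> Jset q n"
    unfolding qvec_mem_Jset_iff by (rule monom_Suc_notin_low)
  then show ?thesis
    unfolding Vset_eq by blast
qed

lemma Jset_neq_zero: "Jset q n \<noteq> {\<zero>\<^bsub>M\<^esub>}"
proof -
  have "qvec q n 1 \<in> Jset q n"
    by (auto simp: qvec_mem_Jset_iff one_pCons coeff_pCons split: nat.splits)
  moreover have "qvec q n 1 \<noteq> \<zero>\<^bsub>M\<^esub>"
    by (simp add: qvec_zero[of q n, symmetric] qvec_inject)
  ultimately show ?thesis by auto
qed

lemma smult_eq_act: "a \<in> carrier A \<Longrightarrow> c \<odot>\<^bsub>A\<^esub> a = act (cscale c 1) a"
  by (simp add: act_cscale act_one)

lemma submodule_qvec_preimage: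
  assumes H: "submodule H (Uq q) M"
  shows "poly_subspace {p. qvec q n p \<in> H}"
    and "\<And>p. p \<in> {p. qvec q n p \<in> H} \<Longrightarrow> wup (e_coeff n) p \<in> {p. qvec q n p \<in> H}"
    and "\<And>p. p \<in> {p. qvec q n p \<in> H} \<Longrightarrow> wdown f_coeff p \<in> {p. qvec q n p \<in> H}"
proof -
  note h = M.submoduleD[OF H]
  have act: "act g a \<in> H" if "a \<in> H" for g a
    using h(4)[of "cls (uq_rels q) g" a] that by simp
  show "poly_subspace {p. qvec q n p \<in> H}"
    using h(2,3) act by unfold_locales (auto simp: qvec_zero qvec_add qvec_smult smult_eq_act)
  fix p assume "p \<in> {p. qvec q n p \<in> H}"
  then show "wup (e_coeff n) p \<in> {p. qvec q n p \<in> H}" "wdown f_coeff p \<in> {p. qvec q n p \<in> H}"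
    using act[of "qvec q n p" "gen Ge"] act[of "qvec q n p" "gen Gf"] by (simp_all add: act_e act_f)
qed

text \<open>Lowering a nonzero element yields \<open>y\<^sup>n\<close>, and raising \<open>y\<^sup>n\<close> yields \<open>x\<^sup>i y\<^sup>n\<close> for all \<open>i \<le> n\<close>, since
  the gap comes only after degree \<open>n\<close>. Both the simplicity of \<open>\<J>\<^sub>n\<close> and the absence of a
  complement rest on this.\<close>

lemma Jset_least:
  assumes H: "submodule H (Uq q) M" and sub: "H \<subseteq> Vset q n" and nz: "H \<noteq> {\<zero>\<^bsub>M\<^esub>}"
  shows "Jset q n \<subseteq> H"
proof -
  let ?S = "{p. qvec q n p \<in> H}"
  note S = submodule_qvec_preimage[OF H, where n = n]
  interpret S: poly_subspace ?S by (rule S(1))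
  obtain a where a: "a \<in> H" "a \<noteq> \<zero>\<^bsub>M\<^esub>"
    using nz M.submoduleD(2)[OF H] by blast
  then obtain p where p: "a = qvec q n p"
    using sub by (auto simp: Vset_eq)
  have "p \<in> ?S" "p \<noteq> 0"
    using a p qvec_zero by auto
  then have "1 \<in> ?S"
    by (intro S.one_mem[OF S(3) f_coeff_nonzero])
  then have one: "Polynomial.monom 1 0 \<in> ?S"
    by (simp add: Polynomial.monom_0 one_pCons)
  have mono: "Polynomial.monom 1 i \<in> ?S" if "i \<le> n" for i
    using that by (intro S.ascend[OF S(2) one]) (auto simp: e_coeff_zero_iff)
  have "p \<in> ?S" if p: "p \<in> low n" for p
  proof (rule S.mem_if_monoms)
    fix i assume "Polynomial.coeff p i \<noteq> 0"
    then have "i \<le> n" using p by blast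
    then show "Polynomial.monom 1 i \<in> ?S" by (rule mono)
  qed
  then show ?thesis
    unfolding Jset_eq by blast
qed

text \<open>Above degree \<open>n\<close> the raising map has no further gap, so \<open>poly_subspace.eq_UNIV\<close> applies.\<close>

lemma Jset_maximal:
  assumes H: "submodule H (Uq q) M" and sub: "H \<subseteq> Vset q n" and J: "Jset q n \<subseteq> H" "H \<noteq> Jset q n"
  shows "H = Vset q n"
proof -
  let ?S = "{p. qvec q n p \<in> H}"
  note S = submodule_qvec_preimage[OF H, where n = n]
  interpret S: poly_subspace ?S by (rule S(1))
  obtain a where a: "a \<in> H" "a \<notin> Jset q n"
    using J by blast
  then obtain p where p: "a = qvec q n p"
    using sub by (auto simp: Vset_eq)
  then obtain j where j: "Polynomial.coeff p j \<noteq> 0" "j > n"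
    using a(2) by (auto simp: qvec_mem_Jset_iff)
  have pS: "p \<in> ?S"
    using a p by simp
  have lo: "Polynomial.monom 1 i \<in> ?S" if "i \<le> n" for i
    using J(1) that by (auto simp: qvec_mem_Jset_iff intro!: subsetD[OF J(1)])
  have hi: "e_coeff n i \<noteq> 0" if "i > n" for i
    using that by (simp add: e_coeff_zero_iff)
  have "?S = UNIV"
    using S(3) f_coeff_nonzero S(2) hi lo pS j by (rule S.eq_UNIV)
  then show ?thesis
    using sub by (auto simp: Vset_eq)
qed

abbreviation "V n \<equiv> restr_module M (Vset q n)"
abbreviation "J n \<equiv> restr_module M (Jset q n)"

lemma left_module_V: "left_module (Uq q) (V n)"
  by (rule left_module_restr[OF left_module_M submodule_Vset])

lemma left_module_J: "left_module (Uq q) (J n)"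
  by (rule left_module_restr[OF left_module_M submodule_Jset])

lemma submodule_Jset_V: "submodule (Jset q n) (Uq q) (V n)"
  using submodule_restr_iff[OF left_module_M submodule_Vset] submodule_Jset Jset_subset_Vset by blast

lemma simple_J: "simple_module (Uq q) (J n)"
  unfolding simple_module_def
proof (intro conjI allI impI)
  fix H assume "submodule H (Uq q) (J n)"
  then have H: "submodule H (Uq q) M" "H \<subseteq> Jset q n"
    using submodule_restr_iff[OF left_module_M submodule_Jset] by auto
  then have "H = {\<zero>\<^bsub>M\<^esub>} \<or> Jset q n \<subseteq> H"
    using Jset_least[OF H(1), of n] Jset_subset_Vset by blast
  then show "H = {\<zero>\<^bsub>J n\<^esub>} \<or> H = carrier (J n)"
    using H(2) by auto
qed (use left_module_J Jset_neq_zero in simp_all)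

lemma simple_Z: "simple_module (Uq q) (quot_module (V n) (Jset q n))"
proof (rule simple_quot_module[OF left_module_V submodule_Jset_V])
  show "Jset q n \<noteq> carrier (V n)"
    using Jset_neq_Vset by simp
  fix K assume K: "submodule K (Uq q) (V n)" "Jset q n \<subseteq> K" "K \<noteq> Jset q n"
  then have "submodule K (Uq q) M" "K \<subseteq> Vset q n"
    using submodule_restr_iff[OF left_module_M submodule_Vset] by blast+
  then have "K = Vset q n"
    using K(2,3) by (rule Jset_maximal)
  then show "K = carrier (V n)" by simp
qed

lemma composition_series_V:
  "composition_series (Uq q) (V n) [{\<zero>\<^bsub>M\<^esub>}, Jset q n, Vset q n]"
proof -
  interpret V: left_module "Uq q" "V n" by (rule left_module_V)
  have zero: "submodule {\<zero>\<^bsub>M\<^esub>} (Uq q) (V n)"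
    using V.zero_submodule by simp
  have "{\<zero>\<^bsub>M\<^esub>} \<subset> Jset q n"
    using M.submoduleD(2)[OF submodule_Jset[of n]] Jset_neq_zero[of n] by auto
  moreover have "Jset q n \<subset> Vset q n"
    using Jset_subset_Vset Jset_neq_Vset by blast
  moreover have "simple_module (Uq q) (quot_module (J n) {\<zero>\<^bsub>M\<^esub>})"
    using simple_module_isomorphic[OF mod_isomorphic_sym[OF mod_isomorphic_quot_zero[OF left_module_J]]
        simple_J] by simp
  ultimately show ?thesis
    using simple_Z[of n] zero submodule_Jset_V[of n] V.carrier_submodule
    by (auto simp: composition_series_def less_Suc_eq nth_Cons' simp del: rep_module_sel)
qed

lemma lowest_weight_vector_J:
  "lowest_weight_vector q (J n) (q powi (- int n)) (qy q [^]\<^bsub>A\<^esub> n)"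
proof -
  have low1: "1 \<in> low n"
    by (auto simp: one_pCons coeff_pCons split: nat.splits)
  have "wdown f_coeff 1 = 0"
    by (rule poly_eqI) (simp add: one_pCons)
  then have f: "act (gen Gf) (qvec q n 1) = \<zero>\<^bsub>A\<^esub>"
    by (simp add: act_f qvec_zero)
  have "wdiag (k_coeff n) 1 = Polynomial.smult (q powi (- int n)) 1"
    by (rule poly_eqI) (simp add: one_pCons coeff_pCons k_coeff_def power_int_minus power_inverse split: nat.split)
  then have k: "act (gen Gk) (qvec q n 1) = q powi (- int n) \<odot>\<^bsub>A\<^esub> qvec q n 1"
    by (simp only: act_k qvec_smult)
  have "qvec q n 1 \<noteq> \<zero>\<^bsub>A\<^esub>"
    by (simp add: qvec_zero[of q n, symmetric] qvec_inject)
  then show ?thesis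
    using low1 by (simp add: lowest_weight_vector_def qy_pow_eq qvec_mem_Jset_iff uf_def uk_def f k
        act_cscale act_one)
qed

lemma not_direct_summand_J: "\<not> direct_summand (Uq q) (V n) (Jset q n)"
proof
  assume "direct_summand (Uq q) (V n) (Jset q n)"
  then obtain W where W: "submodule W (Uq q) (V n)" "Jset q n \<inter> W = {\<zero>\<^bsub>M\<^esub>}"
    and sum: "Jset q n <+>\<^bsub>V n\<^esub> W = Vset q n"
    by (auto simp: direct_summand_def)
  then have W': "submodule W (Uq q) M" "W \<subseteq> Vset q n"
    using submodule_restr_iff[OF left_module_M submodule_Vset] by auto
  have "W = {\<zero>\<^bsub>M\<^esub>}"
    using Jset_least[OF W'] W(2) Jset_neq_zero[of n] by blast
  then have "Vset q n \<subseteq> Jset q n"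
    using sum M.submoduleD(1)[OF submodule_Jset[of n]] by (auto simp: set_add_def' subset_iff)
  then show False
    using Jset_neq_Vset Jset_subset_Vset by blast
qed

lemma direct_sum_V: "direct_sum_decomp (Uq q) M (Vset q)"
  unfolding direct_sum_decomp_def finsum_rep_module
  using submodule_Vset qplane_decomp by simp

end

section \<open>Verma modules\<close>

lemma regular_module_sel [simp]:
  "carrier (regular_module R) = carrier R" "\<zero>\<^bsub>regular_module R\<^esub> = \<zero>\<^bsub>R\<^esub>"
  "a \<oplus>\<^bsub>regular_module R\<^esub> b = a \<oplus>\<^bsub>R\<^esub> b" "a \<odot>\<^bsub>regular_module R\<^esub> b = a \<otimes>\<^bsub>R\<^esub> b"
  by (simp_all add: regular_module_def)

lemma left_module_regular_Uq: "left_module (Uq q) (regular_module (Uq q))"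
  by (rule ring.left_module_regular[OF ring_Uq])

lemma Uq_minus: "cls (uq_rels q) a \<ominus>\<^bsub>Uq q\<^esub> cls (uq_rels q) b = cls (uq_rels q) (a - b)"
proof -
  interpret U: ring "Uq q" by (rule ring_Uq)
  have "\<ominus>\<^bsub>Uq q\<^esub> cls (uq_rels q) b = cls (uq_rels q) (- b)"
    by (rule U.minus_equality) auto
  then show ?thesis by (simp add: a_minus_def)
qed

text \<open>Modulo a left ideal that contains \<open>\<f>\<close> and \<open>\<k> - \<mu>\<close>, the powers of \<open>\<e>\<close> span the algebra. Their span
  contains \<open>1\<close>, and it is stable under left multiplication by the generators, because each of \<open>\<k>\<close>,
  \<open>\<k>\<^sup>-\<^sup>1\<close> and \<open>\<f>\<close> can be moved to the right past \<open>\<e>\<close> by the defining relations, and modulo the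
  left ideal each of them is a scalar.\<close>

lemma verma_span:
  fixes q \<mu> :: complex
  assumes q: "q \<noteq> 0" and \<mu>: "\<mu> \<noteq> 0"
    and L: "submodule L (Uq q) (regular_module (Uq q))"
    and f: "cls (uq_rels q) (gen Gf) \<in> L" and k: "cls (uq_rels q) (gen Gk - cscale \<mu> 1) \<in> L"
  shows "\<exists>p l. cls (uq_rels q) h = cls (uq_rels q) (peval (gen Ge) p + l) \<and> cls (uq_rels q) l \<in> L"
proof -
  interpret U: left_module "Uq q" "regular_module (Uq q)" by (rule left_module_regular_Uq)
  let ?c = "cls (uq_rels q)"
  let ?k = "gen Gk" and ?ki = "gen Gki" and ?e = "gen Ge" and ?f = "gen Gf"
  note sub = U.submoduleD[OF L]
  have L_zero: "?c 0 \<in> L"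
    using sub(2) by simp
  have L_add: "?c (a + b) \<in> L" if "?c a \<in> L" "?c b \<in> L" for a b
    using sub(3)[OF that] by simp
  have L_mult: "?c (x * a) \<in> L" if "?c a \<in> L" for x a
    using sub(4)[of "?c x" "?c a"] that by simp
  have L_scale: "?c (cscale c a) \<in> L" if "?c a \<in> L" for c a
    using L_mult[OF that, of "cscale c 1"] by (simp add: cscale_mult_left)
  define P where "P h \<longleftrightarrow> (\<exists>p l. ?c h = ?c (peval ?e p + l) \<and> ?c l \<in> L)" for h
  have P_cong: "P a" if "?c a = ?c b" "P b" for a b
    using that by (simp add: P_def)
  have P_L: "P a" if "?c a \<in> L" for a
    unfolding P_def using that by (intro exI[of _ 0] exI[of _ a]) simp
  have P_add: "P (a + b)" if "P a" "P b" for a b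
  proof -
    obtain p l p' l' where *: "?c a = ?c (peval ?e p + l)" "?c l \<in> L"
      "?c b = ?c (peval ?e p' + l')" "?c l' \<in> L"
      using \<open>P a\<close> \<open>P b\<close> unfolding P_def by blast
    have "?c (a + b) = ?c (peval ?e (p + p') + (l + l'))"
      using cls_cong_add[OF *(1,3)] by (simp add: peval_add algebra_simps)
    then show ?thesis
      unfolding P_def using L_add[OF *(2,4)] by blast
  qed
  have P_scale: "P (cscale c a)" if Pa: "P a" for a c
  proof -
    obtain p l where *: "?c a = ?c (peval ?e p + l)" "?c l \<in> L"
      using Pa unfolding P_def by blast
    have "?c (cscale c a) = ?c (peval ?e (Polynomial.smult c p) + cscale c l)"
      using cls_cong_scale[OF *(1)] by (simp add: peval_smult cscale_add_right)
    then show ?thesis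
      unfolding P_def using L_scale[OF *(2)] by blast
  qed
  have P_e: "P (?e * a)" if Pa: "P a" for a
  proof -
    obtain p l where *: "?c a = ?c (peval ?e p + l)" "?c l \<in> L"
      using Pa unfolding P_def by blast
    have "?c (?e * a) = ?c (peval ?e (pCons 0 p) + ?e * l)"
      using cls_cong_mult[OF refl *(1), of ?e] by (simp add: peval_pCons distrib_left)
    then show ?thesis
      unfolding P_def using L_mult[OF *(2)] by blast
  qed
  have P_one: "P 1"
    unfolding P_def using L_zero by (intro exI[of _ 1] exI[of _ 0]) (simp add: one_pCons peval_pCons)
  have P_k: "P ?k"
    using P_add[OF P_L[OF k] P_scale[OF P_one, of \<mu>]] by simp
  have ki_k: "?c (?ki * ?k) = ?c 1" and k_ki: "?c (?k * ?ki) = ?c 1"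
    and ke: "?c (?k * ?e) = ?c (cscale (q ^ 2) (?e * ?k))"
    by (rule cls_rel; simp add: uq_rels_def)+
  have ef: "?c (?e * ?f - ?f * ?e) = ?c (cscale (1 / (q - inverse q)) (?k - ?ki))"
    by (rule cls_rel) (simp add: uq_rels_def)
  have P_ki: "P ?ki"
  proof (rule P_cong)
    \<comment> \<open>\<open>k\<^sup>-\<^sup>1(k - \<mu>) = 1 - \<mu>k\<^sup>-\<^sup>1\<close>, so that \<open>k\<^sup>-\<^sup>1\<close> acts on the generator by \<open>\<mu>\<^sup>-\<^sup>1\<close>.\<close>
    show "P (cscale (inverse \<mu>) 1 + cscale (- inverse \<mu>) (?ki * (?k - cscale \<mu> 1)))"
      by (intro P_add P_scale P_one P_L L_mult k)
    have "?c (cscale (inverse \<mu>) 1 + cscale (- inverse \<mu>) (?ki * ?k) + ?ki) =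
        ?c (cscale (inverse \<mu>) 1 + cscale (- inverse \<mu>) 1 + ?ki)"
      by (intro cls_cong_add cls_cong_scale ki_k refl)
    then show "?c ?ki = ?c (cscale (inverse \<mu>) 1 + cscale (- inverse \<mu>) (?ki * (?k - cscale \<mu> 1)))"
      using \<mu> by (simp add: right_diff_distrib cscale_diff_right cscale_mult_right
          cscale_add_left[symmetric] algebra_simps)
  qed
  have kie: "?c (?ki * ?e) = ?c (cscale (inverse (q ^ 2)) (?e * ?ki))"
  proof -
    have "?c (?ki * (?k * ?e) * ?ki) = ?c (?ki * cscale (q ^ 2) (?e * ?k) * ?ki)"
      by (intro cls_cong_mult ke refl)
    moreover have "?c ((?ki * ?k) * (?e * ?ki)) = ?c (1 * (?e * ?ki))"
      by (intro cls_cong_mult ki_k refl)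
    moreover have "?c (cscale (q ^ 2) (?ki * ?e * (?k * ?ki))) = ?c (cscale (q ^ 2) (?ki * ?e * 1))"
      by (intro cls_cong_scale cls_cong_mult k_ki refl)
    ultimately have "?c (?e * ?ki) = ?c (cscale (q ^ 2) (?ki * ?e))"
      by (simp add: mult.assoc cscale_mult_left cscale_mult_right)
    from cls_cong_scale[OF this, of "inverse (q ^ 2)"] show ?thesis
      using q by simp
  qed
  have fe: "?c (?f * ?e) = ?c (?e * ?f +
      (cscale (- (1 / (q - inverse q))) ?k + cscale (1 / (q - inverse q)) ?ki))"
  proof -
    have "?c (?e * ?f + cscale (- 1) (?e * ?f - ?f * ?e)) =
        ?c (?e * ?f + cscale (- 1) (cscale (1 / (q - inverse q)) (?k - ?ki)))"
      by (intro cls_cong_add cls_cong_scale ef refl)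
    then show ?thesis
      by (simp add: cscale_diff_right)
  qed
  \<comment> \<open>Induction on the exponent of \<open>\<e>\<close>: it suffices to move \<open>g\<close> past a single \<open>\<e>\<close>.\<close>
  have shift: "P (g * peval ?e p)"
    if "P g" and "\<And>p. P (g * peval ?e p) \<Longrightarrow> P (g * ?e * peval ?e p)" for g p
  proof (induction p)
    case 0
    show ?case using P_L[OF L_zero] by simp
  next
    case (pCons a p)
    have "P (cscale a g + g * ?e * peval ?e p)"
      by (intro P_add P_scale that pCons.IH)
    then show ?case
      by (simp add: peval_pCons distrib_left cscale_mult_right mult.assoc)
  qed
  have shift_k: "P (g * ?e * peval ?e p)"
    if "P (g * peval ?e p)" and "?c (g * ?e) = ?c (cscale c (?e * g))" for g c p
  proof (rule P_cong)
    show "?c (g * ?e * peval ?e p) = ?c (cscale c (?e * g) * peval ?e p)"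
      by (intro cls_cong_mult that refl)
    show "P (cscale c (?e * g) * peval ?e p)"
      using P_scale[OF P_e[OF that(1)], of c] by (simp add: cscale_mult_left mult.assoc)
  qed
  have P_k_peval: "P (?k * peval ?e p)" for p
    by (rule shift[OF P_k shift_k[OF _ ke]])
  have P_ki_peval: "P (?ki * peval ?e p)" for p
    by (rule shift[OF P_ki shift_k[OF _ kie]])
  have P_f_peval: "P (?f * peval ?e p)" for p
  proof (rule shift[OF P_L[OF f]])
    fix p assume IH: "P (?f * peval ?e p)"
    let ?r = "?e * ?f + (cscale (- (1 / (q - inverse q))) ?k + cscale (1 / (q - inverse q)) ?ki)"
    show "P (?f * ?e * peval ?e p)"
    proof (rule P_cong)
      show "?c (?f * ?e * peval ?e p) = ?c (?r * peval ?e p)"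
        by (intro cls_cong_mult fe refl)
      have "P (?e * (?f * peval ?e p) + (cscale (- (1 / (q - inverse q))) (?k * peval ?e p) +
          cscale (1 / (q - inverse q)) (?ki * peval ?e p)))"
        by (intro P_add P_scale P_e IH P_k_peval P_ki_peval)
      then show "P (?r * peval ?e p)"
        by (simp add: distrib_right left_diff_distrib cscale_mult_left mult.assoc)
    qed
  qed
  have "P h"
  proof (induction h rule: free_induct)
    case (gen g a)
    then obtain p l where *: "?c a = ?c (peval ?e p + l)" "?c l \<in> L"
      unfolding P_def by blast
    have "P (gen g * peval ?e p)"
    proof (cases g)
      case Ge
      have "P (peval ?e p)"
        unfolding P_def using L_zero by (intro exI[of _ p] exI[of _ 0]) simp
      then show ?thesis using P_e Ge by simp
    qed (simp_all only: P_k_peval P_ki_peval P_f_peval)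
    then have "P (gen g * (peval ?e p + l))"
      unfolding distrib_left by (rule P_add[OF _ P_L[OF L_mult[OF *(2)]]])
    then show ?case
      by (rule P_cong[OF cls_cong_mult[OF refl *(1)]])
  qed (fact P_L[OF L_zero] P_one P_add P_scale)+
  then show ?thesis
    by (simp add: P_def)
qed

context qplane_action
begin

text \<open>The vectors \<open>\<e>\<^sup>i(x\<^sup>n\<^sup>+\<^sup>1 y\<^sup>n)\<close> are linearly independent modulo \<open>\<J>\<^sub>n\<close>: the gap lies below
  degree \<open>n + 1\<close>, so they are nonzero multiples of \<open>x\<^sup>n\<^sup>+\<^sup>1\<^sup>+\<^sup>i y\<^sup>n\<close>. In the induction, the gap also
  separates the new constant term \<open>a\<close> from the contribution of \<open>r\<close>.\<close>

lemma act_peval_e: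
  "\<exists>r. act (peval (gen Ge) p) (qvec q n (Polynomial.monom 1 (Suc n))) = qvec q n r \<and>
    (r \<in> low n \<longrightarrow> p = 0)"
proof (induction p)
  case 0
  show ?case
    by (intro exI[of _ 0]) (simp add: act_zero_left qvec_zero)
next
  case (pCons a p)
  let ?w = "Polynomial.monom 1 (Suc n) :: complex poly"
  obtain r where r: "act (peval (gen Ge) p) (qvec q n ?w) = qvec q n r" "r \<in> low n \<longrightarrow> p = 0"
    using pCons.IH by blast
  let ?r = "Polynomial.smult a ?w + wup (e_coeff n) r"
  have "act (peval (gen Ge) (pCons a p)) (qvec q n ?w) = qvec q n ?r"
    by (simp add: peval_pCons act_add act_cscale act_one act_mult r(1) act_e qvec_hom)
  moreover have "pCons a p = 0" if low: "?r \<in> low n"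
  proof -
    have cf: "Polynomial.coeff ?r i = 0" if "i > n" for i
      using low that by (auto simp del: Polynomial.coeff_add coeff_wup)
    have "e_coeff n n = 0"
      by (simp add: e_coeff_zero_iff)
    then have "a = 0"
      using cf[of "Suc n"] by simp
    moreover have "Polynomial.coeff r i = 0" if "i > n" for i
      using cf[of "Suc i"] that by (simp add: e_coeff_zero_iff)
    then have "r \<in> low n"
      by (auto simp: not_less[symmetric])
    ultimately show ?thesis
      using r(2) by simp
  qed
  ultimately show ?case by blast
qed

text \<open>The map \<open>h \<mapsto> h(x\<^sup>n\<^sup>+\<^sup>1 y\<^sup>n)\<close> is onto the quotient because the quotient is simple, and its kernel is
  the left ideal \<open>L\<close> that defines the Verma module: modulo \<open>L\<close> an element of the kernel is a polynomial
  in \<open>\<e>\<close>, which must vanish by the linear independence just shown.\<close>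

lemma mod_isomorphic_Z_verma:
  "mod_isomorphic (Uq q) (quot_module (V n) (Jset q n)) (verma_low q (q ^ (n + 2)))"
proof -
  let ?U = "regular_module (Uq q)" and ?Z = "quot_module (V n) (Jset q n)"
  let ?w = "qvec q n (Polynomial.monom 1 (Suc n))" and ?\<mu> = "q ^ (n + 2)"
  let ?c = "cls (uq_rels q)"
  define L where "L = gen_submodule (Uq q) ?U {uf q, uk q \<ominus>\<^bsub>Uq q\<^esub> (?\<mu> \<odot>\<^bsub>Uq q\<^esub> \<one>\<^bsub>Uq q\<^esub>)}"
  interpret V: left_module "Uq q" "V n" by (rule left_module_V)
  interpret U: left_module "Uq q" ?U by (rule left_module_regular_Uq)
  note Zp = quot_module_proj[OF left_module_V[of n] submodule_Jset_V[of n]]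
  define \<phi> where "\<phi> Y = Jset q n +>\<^bsub>V n\<^esub> (\<pi> Y ?w)" for Y
  have gens: "{uf q, uk q \<ominus>\<^bsub>Uq q\<^esub> (?\<mu> \<odot>\<^bsub>Uq q\<^esub> \<one>\<^bsub>Uq q\<^esub>)} =
      {?c (gen Gf), ?c (gen Gk - cscale ?\<mu> 1)}"
    by (simp add: uf_def uk_def Uq_minus)
  have wV: "act h ?w \<in> carrier (V n)" for h
    using M.submoduleD(4)[OF submodule_Vset[of n], of "?c h" ?w] by (simp add: Vset_eq)
  have \<phi>_hom: "\<phi> \<in> mod_hom (Uq q) ?U ?Z"
  proof (rule mod_homI)
    fix Y assume "Y \<in> carrier ?U"
    then show "\<phi> Y \<in> carrier ?Z"
      using mod_homD(1)[OF Zp(2)] wV by (auto simp: \<phi>_def)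
  next
    fix Y Y' assume "Y' \<in> carrier ?U" "Y \<in> carrier ?U"
    then obtain a b where ab: "Y' = ?c a" "Y = ?c b" by auto
    have "\<pi> (Y' \<oplus>\<^bsub>?U\<^esub> Y) ?w = act a ?w \<oplus>\<^bsub>V n\<^esub> act b ?w"
      by (simp add: ab act_add)
    then show "\<phi> (Y' \<oplus>\<^bsub>?U\<^esub> Y) = \<phi> Y' \<oplus>\<^bsub>?Z\<^esub> \<phi> Y"
      using mod_homD(2)[OF Zp(2) wV wV] by (simp only: \<phi>_def ab)
  next
    fix Y Y' assume "Y' \<in> carrier (Uq q)" "Y \<in> carrier ?U"
    then obtain a b where ab: "Y' = ?c a" "Y = ?c b" by auto
    have "\<pi> (Y' \<odot>\<^bsub>?U\<^esub> Y) ?w = Y' \<odot>\<^bsub>V n\<^esub> act b ?w"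
      by (simp add: ab act_mult)
    then show "\<phi> (Y' \<odot>\<^bsub>?U\<^esub> Y) = Y' \<odot>\<^bsub>?Z\<^esub> \<phi> Y"
      using mod_homD(3)[OF Zp(2) \<open>Y' \<in> carrier (Uq q)\<close> wV] by (simp only: \<phi>_def ab)
  qed
  have ker: "\<phi> (?c h) = \<zero>\<^bsub>?Z\<^esub> \<longleftrightarrow> act h ?w \<in> Jset q n" for h
    using Zp(5)[OF wV] by (simp add: \<phi>_def Zp(4))
  have "\<phi> ` carrier ?U = carrier ?Z"
  proof -
    have "submodule (\<phi> ` carrier ?U) (Uq q) ?Z"
      using mod_hom_image_submodule[OF left_module_regular_Uq Zp(1) \<phi>_hom] .
    moreover have "\<phi> ` carrier ?U \<noteq> {\<zero>\<^bsub>?Z\<^esub>}"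
    proof
      assume "\<phi> ` carrier ?U = {\<zero>\<^bsub>?Z\<^esub>}"
      then have "\<phi> (?c 1) = \<zero>\<^bsub>?Z\<^esub>" by auto
      then have "?w \<in> Jset q n"
        by (simp add: ker act_one)
      then show False
        unfolding qvec_mem_Jset_iff using monom_Suc_notin_low by blast
    qed
    ultimately show ?thesis
      using simple_Z[of n] by (auto simp: simple_module_def)
  qed
  then have iso: "mod_isomorphic (Uq q) (quot_module ?U {Y \<in> carrier ?U. \<phi> Y = \<zero>\<^bsub>?Z\<^esub>}) ?Z"
    by (rule mod_isomorphic_quot_kernel[OF left_module_regular_Uq Zp(1) \<phi>_hom])
  let ?K = "{Y \<in> carrier ?U. \<phi> Y = \<zero>\<^bsub>?Z\<^esub>}"
  have K: "submodule ?K (Uq q) ?U"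
  proof -
    interpret Z: left_module "Uq q" ?Z by (rule Zp(1))
    show ?thesis
      using mod_hom_vimage_submodule[OF left_module_regular_Uq Zp(1) \<phi>_hom Z.zero_submodule] by (simp only: singleton_iff)
  qed
  have memK: "?c h \<in> ?K \<longleftrightarrow> act h ?w \<in> Jset q n" for h
    by (simp add: ker)
  have LK: "L \<subseteq> ?K"
    unfolding L_def gens
  proof (rule gen_submodule_least[OF K], unfold insert_subset memK, intro conjI)
    show "act (gen Gf) ?w \<in> Jset q n"
      by (auto simp: act_f qvec_mem_Jset_iff wshift_monom f_coeff_simps)
    have "k_coeff n (Suc n) = ?\<mu>"
    proof -
      have "q ^ (2 * Suc n) = ?\<mu> * q ^ n"
        by (simp flip: power_add add: mult_2)
      then show ?thesis
        using q_nonzero by (simp add: k_coeff_def power_inverse del: power_Suc)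
    qed
    then have "act (gen Gk + cscale (- ?\<mu>) 1) ?w = \<zero>\<^bsub>A\<^esub>"
      by (simp add: act_add act_cscale act_one act_k qvec_hom wshift_monom smult_monom add_monom
          qvec_zero del: cscale_uminus power_Suc power_add)
    then show "act (gen Gk - cscale ?\<mu> 1) ?w \<in> Jset q n"
      using M.submoduleD(2)[OF submodule_Jset[of n]] by (simp del: power_Suc power_add)
  qed simp
  have L: "submodule L (Uq q) ?U"
    unfolding L_def gens by (rule U.submodule_gen_submodule) simp
  have gL: "?c (gen Gf) \<in> L" "?c (gen Gk - cscale ?\<mu> 1) \<in> L"
    unfolding L_def gens by (rule subsetD[OF gen_submodule_incl], simp)+
  have "?K \<subseteq> L"
  proof
    fix Y assume Y: "Y \<in> ?K"
    then obtain h where h: "Y = ?c h" by auto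
    obtain p l where pl: "?c h = ?c (peval (gen Ge) p + l)" "?c l \<in> L"
      using verma_span[OF q_nonzero _ L gL, of h] q_nonzero by auto
    have "?c (cscale (- 1) 1) \<otimes>\<^bsub>Uq q\<^esub> ?c l \<in> ?K"
      using U.submoduleD(4)[OF K, of "?c (cscale (- 1) 1)" "?c l"] pl(2) LK by auto
    then have "?c h \<oplus>\<^bsub>Uq q\<^esub> ?c (cscale (- 1) l) \<in> ?K"
      using U.submoduleD(3)[OF K, of "?c h" "?c (cscale (- 1) l)"] Y h by (simp add: cscale_mult_left)
    moreover have "peval (gen Ge) p + l + cscale (- 1) l = peval (gen Ge) p"
      by (rule poly_mapping_eqI) (simp add: lookup_add)
    ultimately have "?c (peval (gen Ge) p) \<in> ?K"
      by (simp add: pl(1))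
    then have pJ: "act (peval (gen Ge) p) ?w \<in> Jset q n"
      by (simp only: memK)
    obtain r where r: "act (peval (gen Ge) p) ?w = qvec q n r" "r \<in> low n \<longrightarrow> p = 0"
      using act_peval_e by blast
    have "p = 0"
      using pJ r(2) unfolding r(1) qvec_mem_Jset_iff by (rule rev_mp)
    then have "Y = ?c l"
      using pl(1) unfolding h by simp
    then show "Y \<in> L"
      using pl(2) by simp
  qed
  then have "L = ?K"
    using LK by (rule subset_antisym[rotated])
  then have "verma_low q ?\<mu> = quot_module ?U ?K"
    by (simp only: verma_low_def L_def)
  then show ?thesis
    using mod_isomorphic_sym[OF iso] by (simp only:)
qed

end

section \<open>\<open>\<J>\<^sub>n\<close> as a highest weight module\<close>

lemma V1_module_sel [simp]:
  "carrier (V1_module q n) = {v. Poly_Mapping.keys v \<subseteq> {..n}}" "\<zero>\<^bsub>V1_module q n\<^esub> = 0"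
  "a \<oplus>\<^bsub>V1_module q n\<^esub> b = a + b"
  "Y \<odot>\<^bsub>V1_module q n\<^esub> v = the_elem ((\<lambda>h. V1_free q n h v) ` Y)"
  by (simp_all add: V1_module_def)

lemma V1_gen_eq_sum:
  assumes "finite I" "Poly_Mapping.keys v \<subseteq> I"
  shows "V1_gen q n g v = (\<Sum>i\<in>I. cscale (Poly_Mapping.lookup v i) (V1_basis q n g i))"
  unfolding V1_gen_def using assms by (intro sum.mono_neutral_left) (auto simp: in_keys_iff)

interpretation V1: free_action cscale "V1_gen q n" for q n
proof
  fix g v w c
  show "V1_gen q n g (v + w) = V1_gen q n g v + V1_gen q n g w"
  proof -
    let ?I = "Poly_Mapping.keys v \<union> Poly_Mapping.keys w"
    have "Poly_Mapping.keys (v + w) \<subseteq> ?I"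
      by (rule Poly_Mapping.keys_add)
    then show ?thesis
      by (simp add: V1_gen_eq_sum[of ?I] lookup_add cscale_add_left sum.distrib)
  qed
  show "V1_gen q n g (cscale c v) = cscale c (V1_gen q n g v)"
  proof -
    have "Poly_Mapping.keys (cscale c v) \<subseteq> Poly_Mapping.keys v"
      by (auto simp: in_keys_iff)
    then show ?thesis
      by (simp add: V1_gen_eq_sum[of "Poly_Mapping.keys v"] cscale_sum)
  qed
qed (auto simp: cscale_add_right cscale_add_left)

lemma V1_free_eq: "V1_free q n = free_act cscale (V1_gen q n)"
  by (intro ext) (simp add: V1_free_def free_act_def)

context qplane_action
begin

definition qnum :: "nat \<Rightarrow> complex" where
  "qnum m = (q ^ m - inverse q ^ m) / (q - inverse q)"

lemma qint_eq_qnum: "qint q (int m) = qnum m"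
  by (simp add: qint_def qnum_def power_int_minus power_inverse)

lemma qnum_nonzero: "m > 0 \<Longrightarrow> qnum m \<noteq> 0"
proof
  assume m: "m > 0" and "qnum m = 0"
  then have "q ^ m = inverse q ^ m"
    using q_square(2) by (simp add: qnum_def)
  then have "q ^ m * q ^ m = q ^ m * inverse (q ^ m)"
    by (simp add: power_inverse)
  then have "q ^ (2 * m) = 1"
    using q_nonzero by (simp add: mult_2 power_add)
  then show False
    using q_not_root_of_unity m by (metis nat_0_less_mult_iff zero_less_numeral)
qed

lemma e_coeff_eq_qnum:
  assumes "i \<le> n"
  shows "e_coeff n i = q ^ i * qnum (n - i) / c0"
proof -
  obtain m where n: "n = i + m"
    using assms le_Suc_ex by blast
  have "k_coeff n i = q ^ i * inverse q ^ m * (q ^ i * inverse q ^ i)"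
    by (simp add: k_coeff_def n mult_2 power_add)
  then have "k_coeff n i = q ^ i * inverse q ^ m"
    using q_nonzero by (simp add: power_inverse)
  then have "q ^ n - k_coeff n i = q ^ i * (q ^ m - inverse q ^ m)"
    by (simp add: n power_add right_diff_distrib)
  then show ?thesis
    by (simp add: e_coeff_def qnum_def n)
qed

lemma f_coeff_eq_qnum: "f_coeff (Suc i) = c0 * inverse q ^ i * qnum (Suc i)"
proof -
  let ?r = "inverse q"
  have "?r ^ Suc i * q ^ Suc i = 1"
    using q_nonzero by (simp add: power_inverse del: power_Suc)
  then have "1 - ?r ^ (2 * Suc i) = ?r ^ Suc i * (q ^ Suc i - ?r ^ Suc i)"
    by (simp only: right_diff_distrib mult_2 power_add)
  moreover have "1 - ?r ^ 2 = ?r * (q - ?r)"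
    using q_nonzero by (simp add: right_diff_distrib power2_eq_square)
  ultimately have "f_coeff (Suc i) = c0 * (?r ^ Suc i * (q ^ Suc i - ?r ^ Suc i)) / (?r * (q - ?r))"
    by (simp only: f_coeff_def)
  also have "\<dots> = c0 * ?r ^ i * qnum (Suc i)"
    using q_nonzero q_square(2) by (simp add: qnum_def)
  finally show ?thesis .
qed

text \<open>The isomorphism sends \<open>v\<^sub>n\<^sub>-\<^sub>i\<close> to \<open>\<delta>\<^sub>i x\<^sup>i y\<^sup>n\<close>. Compatibility with \<open>\<f>\<close> forces this recursion, and
  compatibility with \<open>\<e>\<close> is then the identity \<open>e_coeff n i * f_coeff (i + 1) = [n - i] [i + 1]\<close>
  (\<open>\<delta>_e\<close>), where \<open>[m]\<close> is \<open>qnum m\<close>.\<close>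

fun \<delta> :: "nat \<Rightarrow> nat \<Rightarrow> complex" where
  "\<delta> n 0 = 1"
| "\<delta> n (Suc i) = \<delta> n i * qnum (n - i) / f_coeff (Suc i)"

lemma \<delta>_nonzero: "i \<le> n \<Longrightarrow> \<delta> n i \<noteq> 0"
  by (induction i) (auto simp: qnum_nonzero f_coeff_nonzero)

lemma \<delta>_f: "\<delta> n i * qnum (n - i) = f_coeff (Suc i) * \<delta> n (Suc i)"
  using f_coeff_nonzero[of i] by simp

lemma \<delta>_e:
  assumes "i < n"
  shows "\<delta> n (Suc i) * qnum (Suc i) = e_coeff n i * \<delta> n i"
proof -
  have "q ^ i * inverse q ^ i = 1"
    using q_nonzero by (simp add: power_inverse)
  then have *: "e_coeff n i * f_coeff (Suc i) = qnum (n - i) * qnum (Suc i)"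
    using assms c0_nonzero by (simp add: e_coeff_eq_qnum f_coeff_eq_qnum mult.assoc del: power_Suc)
  have "f_coeff (Suc i) * (\<delta> n (Suc i) * qnum (Suc i)) = (\<delta> n i * qnum (n - i)) * qnum (Suc i)"
    by (simp only: \<delta>_f mult.assoc)
  also have "\<dots> = \<delta> n i * (e_coeff n i * f_coeff (Suc i))"
    by (simp only: * mult.assoc)
  also have "\<dots> = f_coeff (Suc i) * (e_coeff n i * \<delta> n i)"
    by (simp only: mult_ac)
  finally have "f_coeff (Suc i) * (\<delta> n (Suc i) * qnum (Suc i)) = f_coeff (Suc i) * (e_coeff n i * \<delta> n i)" .
  then show ?thesis
    by (simp only: mult_left_cancel[OF f_coeff_nonzero])
qed

definition V1_poly :: "nat \<Rightarrow> (nat \<Rightarrow>\<^sub>0 complex) \<Rightarrow> complex poly" where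
  "V1_poly n v = (\<Sum>j\<le>n. Polynomial.monom (\<delta> n (n - j) * Poly_Mapping.lookup v j) (n - j))"

lemma coeff_V1_poly:
  "Polynomial.coeff (V1_poly n v) i = (if i \<le> n then \<delta> n i * Poly_Mapping.lookup v (n - i) else 0)"
proof -
  have "Polynomial.coeff (V1_poly n v) i =
      (\<Sum>j\<le>n. if n - j = i then \<delta> n (n - j) * Poly_Mapping.lookup v j else 0)"
    unfolding V1_poly_def Polynomial.coeff_sum by (intro sum.cong) auto
  also have "\<dots> = (\<Sum>j\<in>{j. j \<le> n \<and> n - j = i}. \<delta> n (n - j) * Poly_Mapping.lookup v j)"
    by (rule sum.mono_neutral_cong_right) auto
  also have "{j. j \<le> n \<and> n - j = i} = (if i \<le> n then {n - i} else {})"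
    by auto
  finally show ?thesis by simp
qed

lemma V1_poly_add: "V1_poly n (v + w) = V1_poly n v + V1_poly n w"
  and V1_poly_scale: "V1_poly n (cscale c v) = Polynomial.smult c (V1_poly n v)"
  and V1_poly_zero: "V1_poly n 0 = 0"
  by (auto intro!: poly_eqI simp: coeff_V1_poly lookup_add distrib_left)

lemma V1_poly_single:
  "j \<le> n \<Longrightarrow> V1_poly n (Poly_Mapping.single j c) = Polynomial.monom (\<delta> n (n - j) * c) (n - j)"
proof -
  assume j: "j \<le> n"
  have "V1_poly n (Poly_Mapping.single j c) =
      (\<Sum>i\<le>n. if i = j then Polynomial.monom (\<delta> n (n - j) * c) (n - j) else 0)"
    unfolding V1_poly_def by (intro sum.cong) (auto simp: lookup_single when_def)
  then show ?thesis
    using j by simp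
qed

abbreviation V1_iso :: "nat \<Rightarrow> (nat \<Rightarrow>\<^sub>0 complex) \<Rightarrow> qp_gen free set" where
  "V1_iso n v \<equiv> qvec q n (V1_poly n v)"

lemma V1_basis_closed: "i \<le> n \<Longrightarrow> Poly_Mapping.keys (V1_basis q n g i) \<subseteq> {..n}"
  by (cases g) (auto simp: in_keys_iff lookup_single when_def split: if_splits)

lemma V1_iso_basis:
  assumes j: "j \<le> n"
  shows "V1_iso n (V1_basis q n g j) = act (gen g) (V1_iso n (Poly_Mapping.single j 1))"
proof -
  obtain i where n: "n = i + j"
    using j by (metis le_add_diff_inverse2)
  have ij: "n - j = i" "i + j - j = i" by (simp_all add: n)
  have k_coeff: "k_coeff n i = q powi (int n - 2 * int j)"
  proof -
    have "q powi (int n - 2 * int j) = q powi (2 * int i - int n)"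
      by (rule arg_cong[of _ _ "\<lambda>z. q powi z"]) (simp add: n)
    also have "\<dots> = q powi (int (2 * i)) / q powi (int n)"
      using q_nonzero by (subst power_int_diff) auto
    also have "\<dots> = k_coeff n i"
      by (simp only: power_int_of_nat k_coeff_def power_inverse divide_inverse)
    finally show ?thesis by simp
  qed
  have "inverse (k_coeff n i) = q powi (2 * int j - int n)"
    using power_int_minus[of q "int n - 2 * int j"] by (simp add: k_coeff)
  note kws = k_coeff[symmetric] this[symmetric]
  show ?thesis
  proof (cases g)
    case Gk
    then have "V1_basis q n g j = Poly_Mapping.single j (k_coeff n i)"
      by (simp only: V1_basis.simps kws)
    then show ?thesis
      using Gk j by (simp add: V1_poly_single act_k wshift_monom ij mult.commute)
  next
    case Gki
    then have "V1_basis q n g j = Poly_Mapping.single j (inverse (k_coeff n i))"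
      by (simp only: V1_basis.simps kws)
    then show ?thesis
      using Gki j by (simp add: V1_poly_single act_ki wshift_monom ij mult.commute)
  next
    case Ge
    show ?thesis
    proof (cases j)
      case 0
      have "e_coeff n n = 0"
        by (simp add: e_coeff_zero_iff)
      then show ?thesis
        using Ge 0 by (simp add: V1_poly_single V1_poly_zero act_e wshift_monom del: single_one)
    next
      case (Suc j')
      then have "qint q (int n - int j + 1) = qnum (Suc i)" "n - j' = Suc i" "i < n"
        "n - Suc j' = i"
        using n qint_eq_qnum[of "Suc i"] by (simp_all add: algebra_simps)
      then show ?thesis
        using Ge Suc j by (simp add: V1_poly_single act_e wshift_monom ij \<delta>_e del: \<delta>.simps single_one)
    qed
  next
    case Gf
    show ?thesis
    proof (cases i)
      case 0
      have "wdown f_coeff 1 = 0"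
        by (rule poly_eqI) (simp add: one_pCons)
      then show ?thesis
        using Gf n 0 by (simp add: V1_poly_single V1_poly_zero act_f wshift_monom f_coeff_simps del: single_one)
    next
      case (Suc i')
      then have "qint q (int j + 1) = qnum (n - i')" "n - Suc j = i'" "j < n" "n - i' = Suc j"
        using n qint_eq_qnum[of "Suc j"] by (simp_all add: algebra_simps)
      then show ?thesis
        using Gf Suc \<delta>_f[of n i'] by (simp add: V1_poly_single act_f wshift_monom f_coeff_simps(1) ij del: \<delta>.simps single_one)
    qed
  qed
qed

lemma V1_iso_gen:
  assumes v: "Poly_Mapping.keys v \<subseteq> {..n}"
  shows "Poly_Mapping.keys (V1_gen q n g v) \<subseteq> {..n}"
    and "V1_iso n (V1_gen q n g v) = act (gen g) (V1_iso n v)"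
proof -
  let ?l = "Poly_Mapping.lookup v"
  have z: "act (gen g) \<zero>\<^bsub>A\<^esub> = \<zero>\<^bsub>A\<^esub>"
    using M.smult_r_null[of "cls (uq_rels q) (gen g)"] by simp
  have gv: "V1_gen q n g v = (\<Sum>i\<le>n. cscale (?l i) (V1_basis q n g i))"
    using v by (intro V1_gen_eq_sum) auto
  have "Poly_Mapping.lookup (cscale (?l i) (V1_basis q n g i)) k = 0" if "i \<le> n" "k > n" for i k
    using V1_basis_closed[OF that(1), of g] that(2) by (auto simp: in_keys_iff)
  then show "Poly_Mapping.keys (V1_gen q n g v) \<subseteq> {..n}"
    unfolding gv by (auto simp: in_keys_iff lookup_sum not_less[symmetric] intro!: sum.neutral)
  have vv: "v = (\<Sum>i\<le>n. cscale (?l i) (Poly_Mapping.single i 1))"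
    using v by (intro poly_mapping_eqI) (auto simp: lookup_sum lookup_single when_def in_keys_iff subset_iff)
  have "V1_iso n (\<Sum>i\<in>I. cscale (?l i) (V1_basis q n g i)) =
      act (gen g) (V1_iso n (\<Sum>i\<in>I. cscale (?l i) (Poly_Mapping.single i 1)))"
    if "finite I" "I \<subseteq> {..n}" for I
    using that
  proof (induction I rule: finite_induct)
    case empty
    show ?case by (simp add: V1_poly_zero qvec_zero z)
  next
    case (insert i I)
    then have "i \<le> n" by simp
    with insert show ?case
      by (simp add: V1_poly_add V1_poly_scale qvec_add qvec_smult act_plus act_smult V1_iso_basis
          AV.smult_closed del: cscale_simps)
  qed
  from this[of "{..n}"] show "V1_iso n (V1_gen q n g v) = act (gen g) (V1_iso n v)"
    using gv vv by simp
qed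

text \<open>Since the isomorphism intertwines the generators, it intertwines the whole free algebra. As the action
  on \<open>\<J>\<^sub>n\<close> factors through the quantum group, so does the one on the left.\<close>

lemma V1_iso_free:
  assumes v: "Poly_Mapping.keys v \<subseteq> {..n}"
  shows "Poly_Mapping.keys (V1_free q n h v) \<subseteq> {..n} \<and> V1_iso n (V1_free q n h v) = act h (V1_iso n v)"
  unfolding V1_free_eq
proof (induction h rule: free_induct)
  case zero
  show ?case by (simp add: V1_poly_zero qvec_zero act_zero_left)
next
  case one
  show ?case using v by (simp add: act_one)
next
  case (add a b)
  then show ?case
    using Poly_Mapping.keys_add by (fastforce simp: V1.act_add V1_poly_add qvec_add act_add)
next
  case (scale c a)
  then show ?case
    by (auto simp: V1.act_scale V1_poly_scale qvec_smult act_cscale in_keys_iff)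
next
  case (gen g a)
  then show ?case
    using V1_iso_gen[of "free_act cscale (V1_gen q n) a v" n g] by (simp add: V1.act_gen_mult act_mult)
qed

lemma V1_iso_bij: "bij_betw (V1_iso n) {v. Poly_Mapping.keys v \<subseteq> {..n}} (Jset q n)"
proof (rule bij_betw_imageI)
  show "inj_on (V1_iso n) {v. Poly_Mapping.keys v \<subseteq> {..n}}"
  proof (rule inj_onI)
    fix v w assume v: "v \<in> {v. Poly_Mapping.keys v \<subseteq> {..n}}" and w: "w \<in> {v. Poly_Mapping.keys v \<subseteq> {..n}}"
      and "V1_iso n v = V1_iso n w"
    then have eq: "V1_poly n v = V1_poly n w"
      by (simp add: qvec_inject)
    show "v = w"
    proof (rule poly_mapping_eqI)
      fix j
      show "Poly_Mapping.lookup v j = Poly_Mapping.lookup w j"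
      proof (cases "j \<le> n")
        case True
        then show ?thesis
          using arg_cong[OF eq, of "\<lambda>p. Polynomial.coeff p (n - j)"] \<delta>_nonzero[of "n - j" n]
          by (simp add: coeff_V1_poly)
      next
        case False
        then have "j \<notin> Poly_Mapping.keys v" "j \<notin> Poly_Mapping.keys w"
          using v w by auto
        then show ?thesis
          by (simp add: in_keys_iff)
      qed
    qed
  qed
  show "V1_iso n ` {v. Poly_Mapping.keys v \<subseteq> {..n}} = Jset q n"
  proof
    show "V1_iso n ` {v. Poly_Mapping.keys v \<subseteq> {..n}} \<subseteq> Jset q n"
      by (auto simp: qvec_mem_Jset_iff coeff_V1_poly split: if_splits)
    show "Jset q n \<subseteq> V1_iso n ` {v. Poly_Mapping.keys v \<subseteq> {..n}}"
    proof
      fix a assume "a \<in> Jset q n"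
      then obtain p where p: "a = qvec q n p" "p \<in> low n"
        unfolding Jset_eq by blast
      let ?v = "\<Sum>j\<le>n. Poly_Mapping.single j (Polynomial.coeff p (n - j) / \<delta> n (n - j))"
      have lv: "Poly_Mapping.lookup ?v j =
          (if j \<le> n then Polynomial.coeff p (n - j) / \<delta> n (n - j) else 0)" for j
        by (auto simp: lookup_sum lookup_single when_def)
      have "V1_poly n ?v = p"
      proof (rule poly_eqI)
        fix i
        show "Polynomial.coeff (V1_poly n ?v) i = Polynomial.coeff p i"
          using p(2) \<delta>_nonzero[of i n] by (cases "i \<le> n") (auto simp: coeff_V1_poly lv)
      qed
      moreover have "Poly_Mapping.keys ?v \<subseteq> {..n}"
        by (auto simp: in_keys_iff lv split: if_splits)
      ultimately show "a \<in> V1_iso n ` {v. Poly_Mapping.keys v \<subseteq> {..n}}"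
        using p(1) by (intro image_eqI[of _ _ ?v]) simp_all
    qed
  qed
qed

lemma mod_isomorphic_J_V1: "mod_isomorphic (Uq q) (J n) (V1_module q n)"
proof (rule mod_isomorphic_transport[OF left_module_J, where \<psi> = "V1_iso n"])
  show "bij_betw (V1_iso n) (carrier (V1_module q n)) (carrier (J n))"
    using V1_iso_bij by simp
next
  fix a b assume "a \<in> carrier (V1_module q n)" "b \<in> carrier (V1_module q n)"
  then show "a \<oplus>\<^bsub>V1_module q n\<^esub> b \<in> carrier (V1_module q n) \<and>
      V1_iso n (a \<oplus>\<^bsub>V1_module q n\<^esub> b) = V1_iso n a \<oplus>\<^bsub>J n\<^esub> V1_iso n b"
    using Poly_Mapping.keys_add[of a b] by (auto simp: V1_poly_add qvec_add)
next
  fix Y v assume Y: "Y \<in> carrier (Uq q)" and "v \<in> carrier (V1_module q n)"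
  then have v: "Poly_Mapping.keys v \<subseteq> {..n}" by simp
  obtain h where h: "Y = cls (uq_rels q) h"
    using Y by auto
  have "V1_free q n h' v = V1_free q n h v" if "h' \<in> Y" for h'
  proof (rule inj_onD[OF bij_betw_imp_inj_on[OF V1_iso_bij[of n]]])
    have "cls (uq_rels q) h' = cls (uq_rels q) h"
      using that h by (metis cls_eq_if_mem)
    then show "V1_iso n (V1_free q n h' v) = V1_iso n (V1_free q n h v)"
      using V1_iso_free[OF v, of h] V1_iso_free[OF v, of h'] by simp
  qed (use V1_iso_free[OF v] in simp_all)
  moreover have "h \<in> Y"
    using h by (simp add: mem_cls_self)
  ultimately have "(\<lambda>h. V1_free q n h v) ` Y = {V1_free q n h v}"
    by blast
  then have "Y \<odot>\<^bsub>V1_module q n\<^esub> v = V1_free q n h v"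
    by simp
  then show "Y \<odot>\<^bsub>V1_module q n\<^esub> v \<in> carrier (V1_module q n) \<and>
      V1_iso n (Y \<odot>\<^bsub>V1_module q n\<^esub> v) = Y \<odot>\<^bsub>J n\<^esub> V1_iso n v"
    using V1_iso_free[OF v, of h] by (simp add: h del: V1_module_sel(4))
qed (simp_all add: V1_poly_zero qvec_zero)

end

section \<open>The quantum plane as a representation\<close>

theorem proposition21:
  fixes q c0 :: complex
    and \<pi> :: "uq_gen free set \<Rightarrow> qp_gen free set \<Rightarrow> qp_gen free set"
  assumes q_nonzero: "q \<noteq> 0"
    and q_not_root_of_unity: "\<forall>m::nat. m > 0 \<longrightarrow> q ^ m \<noteq> 1"
    and c0_nonzero: "c0 \<noteq> 0"
    and module_alg: "module_algebra_structure q (qplane q) \<pi>"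
    and k_x: "\<pi> (uk q) (qx q) = q ^ 2 \<odot>\<^bsub>qplane q\<^esub> qx q"
    and k_y: "\<pi> (uk q) (qy q) = inverse q \<odot>\<^bsub>qplane q\<^esub> qy q"
    and e_x: "\<pi> (ue q) (qx q) = (- q * inverse c0) \<odot>\<^bsub>qplane q\<^esub> (qx q \<otimes>\<^bsub>qplane q\<^esub> qx q)"
    and e_y: "\<pi> (ue q) (qy q) = inverse c0 \<odot>\<^bsub>qplane q\<^esub> (qx q \<otimes>\<^bsub>qplane q\<^esub> qy q)"
    and f_x: "\<pi> (uf q) (qx q) = c0 \<odot>\<^bsub>qplane q\<^esub> \<one>\<^bsub>qplane q\<^esub>"
    and f_y: "\<pi> (uf q) (qy q) = \<zero>\<^bsub>qplane q\<^esub>"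
  defines "M \<equiv> rep_module (qplane q) \<pi>"
  defines "V \<equiv> \<lambda>n. restr_module M (Vset q n)"
    and "J \<equiv> \<lambda>n. restr_module M (Jset q n)"
    and "Z \<equiv> \<lambda>n. quot_module (restr_module M (Vset q n)) (Jset q n)"
  shows "direct_sum_decomp (Uq q) M (Vset q) \<and>
    (\<forall>n. composition_series (Uq q) (V n) [{\<zero>\<^bsub>M\<^esub>}, Jset q n, Vset q n] \<and>
         simple_module (Uq q) (J n) \<and>
         has_dimension CC (restr_module (qplane q) (Jset q n)) (n + 1) \<and>
         lowest_weight_vector q (J n) (q powi (- int n)) (qy q [^]\<^bsub>qplane q\<^esub> n) \<and>
         mod_isomorphic (Uq q) (J n) (V1_module q n) \<and>
         \<not> direct_summand (Uq q) (V n) (Jset q n) \<and>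
         mod_isomorphic (Uq q) (Z n) (verma_low q (q ^ (n + 2))) \<and>
         simple_module (Uq q) (verma_low q (q ^ (n + 2))))"
proof -
  interpret a: qplane_action q c0 \<pi>
    by (rule qplane_action.intro) (fact q_nonzero q_not_root_of_unity c0_nonzero module_alg
        k_x k_y e_x e_y f_x f_y)+
  show ?thesis
    unfolding M_def V_def J_def Z_def
    by (intro conjI allI a.direct_sum_V a.composition_series_V a.simple_J has_dimension_Jset
        a.lowest_weight_vector_J a.mod_isomorphic_J_V1 a.not_direct_summand_J
        a.mod_isomorphic_Z_verma simple_module_isomorphic[OF a.mod_isomorphic_Z_verma a.simple_Z])
qed

end
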